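(* Let $\Gamma_5:=\beta\gamma^5$. There exist constants $c>0$ and $C>0$, depending only on the fixed frequency cutoff, such that for every $m>0$, every $T>0$, every dyadic $K$ with $K\le c\,m$ (the low-frequency regime $K\ll m$), every energy branch $s\in\{+,-\}$, and all $\Phi_0,\Psi_0\in L^2(\mathbb{R}^3;\mathbb{C}^4)$, the functions $$\Phi_{K,s}:=S_m(t)P_K\Pi^m_s(D)\Phi_0,\qquad \Psi_{K,s}:=S_m(t)P_K\Pi^m_s(D)\Psi_0$$ satisfy $$\big\|B_{\Gamma_5}(\Phi_{K,s},\Psi_{K,s})\big\|_{L^2([0,T]\times\mathbb{R}^3)}\le C\min\Big\{K\sqrt{2+mT},\;T^{1/2}\,\frac{K^{5/2}}{m}\Big\}\,\|\Phi_{K,s}(0)\|_{L^2_x}\|\Psi_{K,s}(0)\|_{L^2_x}.$$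
   Context: Gamma matrices (Dirac representation): $\gamma^0=\begin{pmatrix}I_2&0\\0&-I_2\end{pmatrix}$, $\gamma^j=\begin{pmatrix}0&\sigma^j\\-\sigma^j&0\end{pmatrix}$, $j=1,2,3$, with Pauli matrices $\sigma^1=\begin{pmatrix}0&1\\1&0\end{pmatrix}$, $\sigma^2=\begin{pmatrix}0&-i\\i&0\end{pmatrix}$, $\sigma^3=\begin{pmatrix}1&0\\0&-1\end{pmatrix}$. Set $\beta=\gamma^0$, $\alpha^j=\gamma^0\gamma^j$, $\gamma^5=i\gamma^0\gamma^1\gamma^2\gamma^3$, and $\alpha\cdot\xi=\sum_{j=1}^3\xi_j\alpha^j$. Massive Dirac Hamiltonian: $H_m(D)=\alpha\cdot D+m\beta$ with $D=-i\nabla$; its symbol is $H_m(\xi)=\alpha\cdot\xi+m\beta$, with eigenvalues $\pm\lambda_m(\xi)$, $\lambda_m(\xi)=\sqrt{|\xi|^2+m^2}$. The propagator of $i\partial_t\Phi=H_m(D)\Phi$ is $S_m(t)=e^{-itH_m(D)}$. The spectral projection onto energy branch $s\in\{+,-\}$ is the Fourier multiplier $\Pi^m_s(D)$ with symbol $$\Pi^m_s(\xi)=\tfrac12\Big(I+s\,\frac{H_m(\xi)}{\lambda_m(\xi)}\Big).$$ $P_K$, for a dyadic number $K\in2^{\mathbb{Z}}$, is the standard Littlewood-Paley frequency projection to $\{|\xi|\sim K\}$: the Fourier multiplier with symbol $\chi(\xi/K)$, where $\chi:\mathbb{R}^3\to[0,1]$ is a fixed smooth cutoff supported in a fixed annulus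 $\{c_0\le|\xi|\le C_0\}$ with $0<c_0<C_0$. $\langle z,w\rangle_{\mathbb{C}^4}=z^*w$ is the Hermitian inner product (conjugate-linear in the first slot), and $B_\Gamma(z,w):=\langle\Gamma z,w\rangle_{\mathbb{C}^4}$, applied pointwise in $(t,x)$. *)

theory Defs
  imports "HOL-Analysis.Analysis"
begin

section \<open>Dirac matrices\<close>

definition pauli :: "3 \<Rightarrow> complex^2^2" where
  "pauli j =
    (if j = 1 then vector [vector [0, 1], vector [1, 0]]
     else if j = 2 then vector [vector [0, - \<i>], vector [\<i>, 0]]
     else vector [vector [1, 0], vector [0, - 1]])"

definition block_matrix ::
    "complex^2^2 \<Rightarrow> complex^2^2 \<Rightarrow> complex^2^2 \<Rightarrow> complex^2^2 \<Rightarrow> complex^4^4" where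
  "block_matrix A B C D = vector
     [vector [A$1$1, A$1$2, B$1$1, B$1$2],
      vector [A$2$1, A$2$2, B$2$1, B$2$2],
      vector [C$1$1, C$1$2, D$1$1, D$1$2],
      vector [C$2$1, C$2$2, D$2$1, D$2$2]]"

definition gamma0 :: "complex^4^4" where
  "gamma0 = block_matrix (mat 1) 0 0 (- mat 1)"

text \<open>The spatial gamma matrices; the index type \<open>3\<close> has the elements 1, 2, 3.\<close>

definition gamma :: "3 \<Rightarrow> complex^4^4" where
  "gamma j = block_matrix 0 (pauli j) (- pauli j) 0"

definition beta :: "complex^4^4" where
  "beta = gamma0"

definition alpha :: "3 \<Rightarrow> complex^4^4" where
  "alpha j = gamma0 ** gamma j"

definition gamma5 :: "complex^4^4" where
  "gamma5 = map_matrix ((*) \<i>) (gamma0 ** gamma 1 ** gamma 2 ** gamma 3)"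

definition Gamma5 :: "complex^4^4" where
  "Gamma5 = beta ** gamma5"

definition hermitian_inner :: "complex^4 \<Rightarrow> complex^4 \<Rightarrow> complex" where
  "hermitian_inner z w = (\<Sum>a\<in>UNIV. cnj (z$a) * w$a)"

definition bilin :: "complex^4^4 \<Rightarrow> complex^4 \<Rightarrow> complex^4 \<Rightarrow> complex" where
  "bilin G z w = hermitian_inner (G *v z) w"


section \<open>The symbols\<close>

definition dirac_symbol :: "real \<Rightarrow> real^3 \<Rightarrow> complex^4^4" where
  "dirac_symbol m \<xi> = (\<Sum>j\<in>UNIV. (\<xi>$j) *\<^sub>R alpha j) + m *\<^sub>R beta"

definition dispersion :: "real \<Rightarrow> real^3 \<Rightarrow> real" where
  "dispersion m \<xi> = sqrt ((norm \<xi>)\<^sup>2 + m\<^sup>2)"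

definition projection_symbol :: "real \<Rightarrow> real \<Rightarrow> real^3 \<Rightarrow> complex^4^4" where
  "projection_symbol m s \<xi> = (1/2) *\<^sub>R (mat 1 + (s / dispersion m \<xi>) *\<^sub>R dirac_symbol m \<xi>)"

text \<open>The library's \<open>exp\<close> lives in real normed algebras, which square matrices do not instantiate
  (their \<open>*\<close> is componentwise), hence the exponential series is written out.\<close>

definition matrix_exp :: "complex^4^4 \<Rightarrow> complex^4^4" where
  "matrix_exp A = (\<Sum>n. (1 / fact n) *\<^sub>R (((**) A) ^^ n) (mat 1))"

definition propagator_symbol :: "real \<Rightarrow> real \<Rightarrow> real^3 \<Rightarrow> complex^4^4" where
  "propagator_symbol m t \<xi> = matrix_exp (map_matrix ((*) (- \<i> * complex_of_real t)) (dirac_symbol m \<xi>))"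


section \<open>Square integrable functions and Fourier multipliers\<close>

text \<open>Elements of \<open>L\<^sup>2\<close> are represented by functions; objects that are determined only up to null
  sets are selected by Hilbert choice.\<close>

definition L2_space :: "'a measure \<Rightarrow> ('a \<Rightarrow> 'b::{real_normed_vector, second_countable_topology}) set" where
  "L2_space M = {f \<in> borel_measurable M. integrable M (\<lambda>x. (norm (f x))\<^sup>2)}"

definition L2_norm :: "'a measure \<Rightarrow> ('a \<Rightarrow> 'b::{real_normed_vector, second_countable_topology}) \<Rightarrow> real" where
  "L2_norm M f = sqrt (\<integral>x. (norm (f x))\<^sup>2 \<partial>M)"

text \<open>Normalisation: \<open>-i\<nabla>\<close> becomes multiplication by \<open>\<xi>\<close>.\<close>

definition fourier_integral :: "(real^3 \<Rightarrow> complex^4) \<Rightarrow> real^3 \<Rightarrow> complex^4" where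
  "fourier_integral f \<xi> = (\<integral>x. cis (- (x \<bullet> \<xi>)) *s f x \<partial>lborel)"

text \<open>The Fourier transform on \<open>L\<^sup>2\<close>, as the \<open>L\<^sup>2\<close>-limit of the Fourier integrals of truncations.
  The limit is expressed with the nonnegative integral, so that it cannot hold by virtue of a
  non-integrable difference.\<close>

definition fourier_L2 :: "(real^3 \<Rightarrow> complex^4) \<Rightarrow> real^3 \<Rightarrow> complex^4" where
  "fourier_L2 f = (SOME g. g \<in> L2_space lborel \<and>
     (\<lambda>n::nat. \<integral>\<^sup>+\<xi>. ennreal ((norm
         (fourier_integral (\<lambda>x. indicat_real (ball 0 (real n)) x *\<^sub>R f x) \<xi> - g \<xi>))\<^sup>2) \<partial>lborel)
       \<longlonglongrightarrow> 0)"

definition fourier_multiplier ::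
    "(real^3 \<Rightarrow> complex^4^4) \<Rightarrow> (real^3 \<Rightarrow> complex^4) \<Rightarrow> real^3 \<Rightarrow> complex^4" where
  "fourier_multiplier M f = (SOME h. h \<in> L2_space lborel \<and>
     (AE \<xi> in lborel. fourier_L2 h \<xi> = M \<xi> *v fourier_L2 f \<xi>))"

definition spectral_projection :: "real \<Rightarrow> real \<Rightarrow> (real^3 \<Rightarrow> complex^4) \<Rightarrow> real^3 \<Rightarrow> complex^4" where
  "spectral_projection m s = fourier_multiplier (projection_symbol m s)"

definition propagator :: "real \<Rightarrow> real \<Rightarrow> (real^3 \<Rightarrow> complex^4) \<Rightarrow> real^3 \<Rightarrow> complex^4" where
  "propagator m t = fourier_multiplier (propagator_symbol m t)"

definition freq_projection ::
    "(real^3 \<Rightarrow> real) \<Rightarrow> real \<Rightarrow> (real^3 \<Rightarrow> complex^4) \<Rightarrow> real^3 \<Rightarrow> complex^4" where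
  "freq_projection \<rho> K = fourier_multiplier (\<lambda>\<xi>. mat (complex_of_real (\<rho> (\<xi> /\<^sub>R K))))"


section \<open>Frequency cutoffs\<close>

text \<open>\<open>C\<^sup>k\<close>, by recursion on partial derivatives.\<close>

fun C_k :: "nat \<Rightarrow> (real^3 \<Rightarrow> real) \<Rightarrow> bool" where
  "C_k 0 f = continuous_on UNIV f"
| "C_k (Suc k) f \<longleftrightarrow> (\<forall>x. f differentiable (at x)) \<and>
     (\<forall>j. C_k k (\<lambda>x. frechet_derivative f (at x) (axis j 1)))"

definition cutoff :: "real \<Rightarrow> real \<Rightarrow> (real^3 \<Rightarrow> real) \<Rightarrow> bool" where
  "cutoff c\<^sub>0 C\<^sub>0 \<rho> \<longleftrightarrow> (\<forall>k. C_k k \<rho>) \<and> (\<forall>\<xi>. 0 \<le> \<rho> \<xi> \<and> \<rho> \<xi> \<le> 1) \<and>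
     closure {\<xi>. \<rho> \<xi> \<noteq> 0} \<subseteq> {\<xi>. c\<^sub>0 \<le> norm \<xi> \<and> norm \<xi> \<le> C\<^sub>0}"


section \<open>Space-time functions\<close>

text \<open>At each time \<open>S\<^sub>m(t) P\<^sub>K \<Pi>\<^sub>s f\<close> is fixed only up to a null set of \<open>x\<close>, and an arbitrary choice for
  each \<open>t\<close> need not be jointly measurable. We take a jointly measurable version; by Fubini it
  is unique up to null sets of space-time.\<close>

definition dirac_wave ::
    "(real^3 \<Rightarrow> real) \<Rightarrow> real \<Rightarrow> real \<Rightarrow> real \<Rightarrow> (real^3 \<Rightarrow> complex^4) \<Rightarrow> real \<times> (real^3) \<Rightarrow> complex^4" where
  "dirac_wave \<rho> m K s f = (SOME \<Phi>. \<Phi> \<in> borel_measurable lborel \<and>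
     (\<forall>t. AE x in lborel.
        \<Phi> (t, x) = propagator m t (freq_projection \<rho> K (spectral_projection m s f)) x))"

definition slab :: "real \<Rightarrow> (real \<times> (real^3)) measure" where
  "slab T = restrict_space lborel ({0..T} \<times> UNIV)"

end

theory Submission
  imports Defs "HOL-Probability.Probability"
begin

text \<open>In the regime \<open>K \<le> m\<close> the second entry of the minimum is the smaller one, because
  \<open>T powr (1/2) * (K powr (5/2) / m) = K * sqrt (m * T) * (K / m) powr (3/2)\<close>.
  Hence no dispersive estimate is needed: it suffices to bound the product at each fixed time and
  to integrate over \<open>[0, T]\<close>. The matrix \<open>\<Gamma>\<^sub>5\<close> pairs the upper
  components of one spinor with the lower components of the other. On a fixed energy branch
  one of the two halves is small: the eigenvalue equation gives it a factor \<open>\<bar>\<xi>\<bar> / (\<lambda>\<^sub>m + m) \<lesssim> K / m\<close> in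
  mean square. The other half is bounded uniformly by Bernstein's inequality, at the cost of a factor
  \<open>K powr (3/2)\<close>. The Plancherel theory that this requires is obtained by Gaussian regularisation.\<close>

section \<open>Square integrable functions\<close>

text \<open>The operators of the statement are Hilbert choices, so nothing is known about a wave
  until a witness has been exhibited for each choice. For \<open>fourier_multiplier\<close> every
  square integrable function must be a transform, which is why inversion is proved on all of L2. For
  \<open>dirac_wave\<close> a jointly measurable representative is required, and the inversion
  integral over a bounded set of frequencies provides it. On one branch the propagator is a
  unimodular scalar in frequency, so the fixed-time bounds are uniform in t. As both waves lie on
  the same branch, each of the four products in the form has exactly one small factor. This factor
  is measured in L2 and the other in the supremum, which gives K^3 (K/m)^2 for the square of each
  product. Integration in time adds the factor T, and the square root is the rate T^(1/2) K^(5/2) /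
  m. Sharp constants are not sought: sums are split by |a + b|^2 <= 2 (|a|^2 + |b|^2), and a factor
  2 from an L2 limit survives into the final constant.\<close>

definition L2_sq :: "'a measure \<Rightarrow> ('a \<Rightarrow> 'b::real_normed_vector) \<Rightarrow> ennreal" where
  "L2_sq M f = (\<integral>\<^sup>+x. ennreal ((norm (f x))\<^sup>2) \<partial>M)"

text \<open>Nonnegative integrals carry no integrability side conditions, so estimates and limits
  are carried out with \<open>L2_sq\<close>; \<open>L2_norm\<close> returns only in the final
  estimate.\<close>

lemma L2_space_iff: "f \<in> L2_space M \<longleftrightarrow> f \<in> borel_measurable M \<and> L2_sq M f < \<infinity>"
  unfolding L2_space_def L2_sq_def by (auto simp: integrable_iff_bounded)

lemma L2_norm_sq: "f \<in> L2_space M \<Longrightarrow> ennreal ((L2_norm M f)\<^sup>2) = L2_sq M f"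
  unfolding L2_space_def L2_norm_def L2_sq_def
  by (simp add: nn_integral_eq_integral Bochner_Integration.integral_nonneg)

lemma L2_sq_mono_AE:
  assumes "AE x in M. norm (f x) \<le> norm (g x)"
  shows "L2_sq M f \<le> L2_sq M g"
  unfolding L2_sq_def using assms by (intro nn_integral_mono_AE) (auto intro!: ennreal_leI power_mono)

lemma L2_sq_cong_AE:
  assumes "AE x in M. norm (f x) = norm (g x)"
  shows "L2_sq M f = L2_sq M g"
  unfolding L2_sq_def using assms by (intro nn_integral_cong_AE) auto

lemma L2_sq_cong:
  assumes "\<And>x. norm (f x) = norm (g x)"
  shows "L2_sq M f = L2_sq M g"
  by (rule L2_sq_cong_AE) (simp add: assms)

lemma L2_sq_add_le:
  fixes f g :: "'a \<Rightarrow> 'b::{real_normed_vector, second_countable_topology}"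
  assumes [measurable]: "f \<in> borel_measurable M" "g \<in> borel_measurable M"
  shows "L2_sq M (\<lambda>x. f x + g x) \<le> 2 * (L2_sq M f + L2_sq M g)"
proof -
  have "(norm (f x + g x))\<^sup>2 \<le> 2 * ((norm (f x))\<^sup>2 + (norm (g x))\<^sup>2)" for x
  proof -
    have "(norm (f x + g x))\<^sup>2 \<le> (norm (f x) + norm (g x))\<^sup>2"
      by (intro power_mono norm_triangle_ineq) auto
    also have "\<dots> \<le> 2 * ((norm (f x))\<^sup>2 + (norm (g x))\<^sup>2)"
      using sum_squares_bound[of "norm (f x)" "norm (g x)"] by (simp add: power2_sum)
    finally show ?thesis .
  qed
  then have "L2_sq M (\<lambda>x. f x + g x) \<le> (\<integral>\<^sup>+x. ennreal (2 * ((norm (f x))\<^sup>2 + (norm (g x))\<^sup>2)) \<partial>M)"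
    unfolding L2_sq_def by (intro nn_integral_mono ennreal_leI)
  also have "\<dots> = (\<integral>\<^sup>+x. 2 * (ennreal ((norm (f x))\<^sup>2) + ennreal ((norm (g x))\<^sup>2)) \<partial>M)"
    by (intro nn_integral_cong) (subst ennreal_mult', auto simp: ennreal_plus)
  also have "\<dots> = 2 * (L2_sq M f + L2_sq M g)"
    unfolding L2_sq_def by (simp add: nn_integral_cmult nn_integral_add)
  finally show ?thesis .
qed

lemma L2_sq_uminus [simp]: "L2_sq M (\<lambda>x. - f x) = L2_sq M f"
  by (simp add: L2_sq_def)

lemma L2_sq_minus_commute: "L2_sq M (\<lambda>x. f x - g x) = L2_sq M (\<lambda>x. g x - f x)"
  by (simp add: L2_sq_def norm_minus_commute)

lemma L2_sq_triangle:
  fixes f g h :: "'a \<Rightarrow> 'b::{real_normed_vector, second_countable_topology}"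
  assumes [measurable]: "f \<in> borel_measurable M" "g \<in> borel_measurable M" "h \<in> borel_measurable M"
  shows "L2_sq M (\<lambda>x. f x - h x) \<le> 2 * (L2_sq M (\<lambda>x. f x - g x) + L2_sq M (\<lambda>x. g x - h x))"
  using L2_sq_add_le[of "\<lambda>x. f x - g x" M "\<lambda>x. g x - h x"] by simp

lemma L2_sq_eq_0_iff:
  fixes f :: "'a \<Rightarrow> 'b::{real_normed_vector, second_countable_topology}"
  assumes [measurable]: "f \<in> borel_measurable M"
  shows "L2_sq M f = 0 \<longleftrightarrow> (AE x in M. f x = 0)"
  unfolding L2_sq_def by (subst nn_integral_0_iff_AE) auto

lemma L2_sq_cmult:
  fixes f :: "'a \<Rightarrow> complex"
  assumes [measurable]: "f \<in> borel_measurable M"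
  shows "L2_sq M (\<lambda>x. c * f x) = ennreal ((norm c)\<^sup>2) * L2_sq M f"
  unfolding L2_sq_def
  by (simp add: norm_mult power_mult_distrib ennreal_mult' nn_integral_cmult)

lemma L2_space_add:
  assumes "f \<in> L2_space M" "g \<in> L2_space M"
  shows "(\<lambda>x. f x + g x) \<in> L2_space M"
proof -
  have "L2_sq M (\<lambda>x. f x + g x) \<le> 2 * (L2_sq M f + L2_sq M g)"
    using assms by (intro L2_sq_add_le) (auto simp: L2_space_iff)
  also have "\<dots> < \<infinity>"
    using assms by (simp add: L2_space_iff ennreal_mult_less_top)
  finally show ?thesis using assms by (auto simp: L2_space_iff)
qed

lemma L2_space_diff:
  "f \<in> L2_space M \<Longrightarrow> g \<in> L2_space M \<Longrightarrow> (\<lambda>x. f x - g x) \<in> L2_space M"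
  using L2_space_add[of f M "\<lambda>x. - g x"] by (simp add: L2_space_iff)

lemma L2_space_cmult:
  fixes f :: "'a \<Rightarrow> complex"
  shows "f \<in> L2_space M \<Longrightarrow> (\<lambda>x. c * f x) \<in> L2_space M"
  by (auto simp: L2_space_iff L2_sq_cmult ennreal_mult_less_top)

lemma ennreal_limit_0_sandwich:
  fixes u v :: "nat \<Rightarrow> ennreal"
  assumes "v \<longlonglongrightarrow> 0" "\<And>n. u n \<le> v n"
  shows "u \<longlonglongrightarrow> 0"
  using assms by (intro tendsto_sandwich[of "\<lambda>_. 0" u sequentially v]) auto

lemma tendsto_0_twice_sum:
  fixes u v :: "nat \<Rightarrow> ennreal"
  assumes "u \<longlonglongrightarrow> 0" "v \<longlonglongrightarrow> 0"
  shows "(\<lambda>n. 2 * (u n + v n)) \<longlonglongrightarrow> 0"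
  using ennreal_tendsto_cmult[OF _ tendsto_add[OF assms], of 2] by simp

lemma L2_limit_unique:
  fixes F :: "nat \<Rightarrow> 'a \<Rightarrow> 'b::{real_normed_vector, second_countable_topology}"
  assumes [measurable]: "\<And>n. F n \<in> borel_measurable M" "g \<in> borel_measurable M" "h \<in> borel_measurable M"
    and g: "(\<lambda>n. L2_sq M (\<lambda>x. F n x - g x)) \<longlonglongrightarrow> 0"
    and h: "(\<lambda>n. L2_sq M (\<lambda>x. F n x - h x)) \<longlonglongrightarrow> 0"
  shows "AE x in M. g x = h x"
proof -
  have "L2_sq M (\<lambda>x. g x - h x) \<le> 2 * (L2_sq M (\<lambda>x. F n x - g x) + L2_sq M (\<lambda>x. F n x - h x))" for n
    using L2_sq_triangle[of g M "F n" h] by (simp add: L2_sq_minus_commute[of M g])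
  then have "(\<lambda>n::nat. L2_sq M (\<lambda>x. g x - h x)) \<longlonglongrightarrow> 0"
    by (rule ennreal_limit_0_sandwich[OF tendsto_0_twice_sum[OF g h]])
  then have "L2_sq M (\<lambda>x. g x - h x) = 0"
    by (simp add: LIMSEQ_const_iff)
  then show ?thesis by (subst (asm) L2_sq_eq_0_iff) auto
qed

text \<open>The 2 is the price of splitting g = (g - F n) + F n with squares; it reappears in
  \<open>L2_ft_bound\<close> and in the constants of \<open>dirac_wave_bounds\<close>.\<close>

lemma L2_limit_bound:
  fixes F :: "nat \<Rightarrow> 'a \<Rightarrow> 'b::{real_normed_vector, second_countable_topology}"
  assumes [measurable]: "\<And>n. F n \<in> borel_measurable M" "g \<in> borel_measurable M"
    and g: "(\<lambda>n. L2_sq M (\<lambda>x. F n x - g x)) \<longlonglongrightarrow> 0"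
    and B: "\<And>n. L2_sq M (F n) \<le> B"
  shows "L2_sq M g \<le> 2 * B"
proof -
  have "L2_sq M g \<le> 2 * (L2_sq M (\<lambda>x. F n x - g x) + B)" for n
  proof -
    have "L2_sq M g \<le> 2 * (L2_sq M (\<lambda>x. g x - F n x) + L2_sq M (F n))"
      using L2_sq_add_le[of "\<lambda>x. g x - F n x" M "F n"] by simp
    also have "\<dots> \<le> 2 * (L2_sq M (\<lambda>x. F n x - g x) + B)"
      by (intro mult_left_mono add_mono B) (auto simp: L2_sq_minus_commute)
    finally show ?thesis .
  qed
  moreover have "(\<lambda>n. 2 * (L2_sq M (\<lambda>x. F n x - g x) + B)) \<longlonglongrightarrow> 2 * (0 + B)"
    by (intro ennreal_tendsto_cmult tendsto_add g tendsto_const) simp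
  ultimately show ?thesis
    by (intro LIMSEQ_le_const[where X = "\<lambda>n. 2 * (L2_sq M (\<lambda>x. F n x - g x) + B)"]) auto
qed

text \<open>The inequality of arithmetic and geometric means gives |d| <= 2^-n + 2^n |d|^2. An
  integrable weighted sum of squares thus yields absolute convergence almost everywhere, without a
  triangle inequality for L2 norms.\<close>

lemma summable_of_weighted_squares:
  fixes d :: "nat \<Rightarrow> 'b::banach"
  assumes "summable (\<lambda>k. 2 ^ k * (norm (d k))\<^sup>2)"
  shows "summable d"
proof (rule summable_comparison_test')
  show "summable (\<lambda>k. (1/2) ^ k + 2 ^ k * (norm (d k))\<^sup>2)"
    by (intro summable_add assms summable_geometric) simp
  show "norm (d n) \<le> (1/2) ^ n + 2 ^ n * (norm (d n))\<^sup>2" for n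
  proof -
    define p :: real where "p = (1/2) ^ n"
    have p1: "2 ^ n * p = 1" by (simp add: p_def power_one_over)
    then have p: "2 ^ n * p = 1" "2 ^ n * p\<^sup>2 = p" by (auto simp: power2_eq_square simp flip: mult.assoc)
    have "2 ^ n * (2 * norm (d n) * p) \<le> 2 ^ n * (p\<^sup>2 + (norm (d n))\<^sup>2)"
      using sum_squares_bound[of "norm (d n)" p] by (intro mult_left_mono) (auto simp: add.commute)
    moreover have "2 ^ n * (2 * norm (d n) * p) = 2 * norm (d n) * (2 ^ n * p)" by (simp add: ac_simps)
    ultimately have "2 * norm (d n) \<le> p + 2 ^ n * (norm (d n))\<^sup>2"
      by (simp only: p distrib_left mult_1_right)
    then show ?thesis using norm_ge_zero[of "d n"] unfolding p_def by linarith
  qed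
qed

text \<open>Riesz-Fischer: a rapidly convergent subsequence converges almost everywhere, and Fatou's
  lemma shows that its pointwise limit is the L2 limit of the whole sequence.\<close>

lemma L2_complete:
  fixes F :: "nat \<Rightarrow> 'a \<Rightarrow> 'b::{banach, second_countable_topology}"
  assumes F: "\<And>n. F n \<in> L2_space M"
    and cauchy: "\<And>e. e > 0 \<Longrightarrow> \<exists>N. \<forall>m\<ge>N. \<forall>n\<ge>N. L2_sq M (\<lambda>x. F m x - F n x) \<le> ennreal e"
  obtains g where "g \<in> L2_space M" "(\<lambda>n. L2_sq M (\<lambda>x. F n x - g x)) \<longlonglongrightarrow> 0"
proof -
  have [measurable]: "F n \<in> borel_measurable M" for n using F by (simp add: L2_space_iff)
  \<comment> \<open>The rate (1/4)^k beats the weight 2^k of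
    \<open>summable_of_weighted_squares\<close> and leaves a geometric series of ratio 1/2.\<close>
  obtain N where N: "\<And>k m n. m \<ge> N k \<Longrightarrow> n \<ge> N k \<Longrightarrow> L2_sq M (\<lambda>x. F m x - F n x) \<le> ennreal ((1/4) ^ k)"
    using cauchy[of "(1/4) ^ k" for k] by (simp; metis)
  \<comment> \<open>Summing the thresholds makes the indices monotone and keeps \<open>r k\<close>
    above \<open>N k\<close>; the added \<open>k\<close> makes them tend to infinity.\<close>
  define r where "r k = (\<Sum>j\<le>k. N j) + k" for k
  have r_ge: "N k \<le> r k" "k \<le> r k" "r k \<le> r (Suc k)" for k
    unfolding r_def by (auto intro: member_le_sum trans_le_add1)
  define d where "d k x = F (r (Suc k)) x - F (r k) x" for k x
  have [measurable]: "d k \<in> borel_measurable M" for k unfolding d_def by measurable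
  have d: "L2_sq M (d k) \<le> ennreal ((1/4) ^ k)" for k
    unfolding d_def using r_ge[of k] by (intro N) auto
  have "(\<integral>\<^sup>+x. (\<Sum>k. ennreal (2 ^ k * (norm (d k x))\<^sup>2)) \<partial>M) = (\<Sum>k. ennreal (2 ^ k) * L2_sq M (d k))"
    unfolding L2_sq_def by (subst nn_integral_suminf) (auto simp: ennreal_mult' nn_integral_cmult)
  also have "\<dots> \<le> (\<Sum>k. ennreal ((1/2) ^ k))"
  proof (intro suminf_le)
    fix k
    have "ennreal (2 ^ k) * L2_sq M (d k) \<le> ennreal (2 ^ k) * ennreal ((1/4) ^ k)"
      by (intro mult_left_mono d) auto
    also have "\<dots> = ennreal ((1/2) ^ k)"
      by (simp add: ennreal_mult'[symmetric] power_mult_distrib[symmetric])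
    finally show "ennreal (2 ^ k) * L2_sq M (d k) \<le> ennreal ((1/2) ^ k)" .
  qed auto
  also have "\<dots> < \<infinity>"
    by (subst suminf_ennreal2) (auto intro!: summable_geometric)
  finally have "(\<integral>\<^sup>+x. (\<Sum>k. ennreal (2 ^ k * (norm (d k x))\<^sup>2)) \<partial>M) \<noteq> \<infinity>" by simp
  then have "AE x in M. (\<Sum>k. ennreal (2 ^ k * (norm (d k x))\<^sup>2)) \<noteq> \<infinity>"
    by (intro nn_integral_noteq_infinite) auto
  then have conv: "AE x in M. (\<lambda>k. F (r k) x) \<longlonglongrightarrow> lim (\<lambda>k. F (r k) x)"
  proof eventually_elim
    case (elim x)
    then have "summable (\<lambda>k. 2 ^ k * (norm (d k x))\<^sup>2)"
      by (intro summable_suminf_not_top) auto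
    then have "summable (\<lambda>k. d k x)" by (rule summable_of_weighted_squares)
    then have "convergent (\<lambda>n. \<Sum>k<n. d k x)" by (simp add: summable_iff_convergent)
    moreover have "(\<Sum>k<n. d k x) = F (r n) x - F (r 0) x" for n
      unfolding d_def by (rule sum_lessThan_telescope)
    ultimately have "convergent (\<lambda>n. F (r n) x)"
      by (simp add: convergent_diff_const_right_iff)
    then show ?case by (simp add: convergent_LIMSEQ_iff)
  qed
  define g where "g x = lim (\<lambda>k. F (r k) x)" for x
  have [measurable]: "g \<in> borel_measurable M"
    unfolding g_def by (rule borel_measurable_lim_metric) measurable
  \<comment> \<open>Fatou's lemma along the subsequence: a bound between \<open>F n\<close> and all
    later terms passes to the limit.\<close>
  have bound: "L2_sq M (\<lambda>x. F n x - g x) \<le> ennreal e"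
    if "\<And>m. m \<ge> N' \<Longrightarrow> L2_sq M (\<lambda>x. F n x - F m x) \<le> ennreal e" for n N' e
  proof -
    have "L2_sq M (\<lambda>x. F n x - g x) = (\<integral>\<^sup>+x. liminf (\<lambda>k. ennreal ((norm (F n x - F (r k) x))\<^sup>2)) \<partial>M)"
      unfolding L2_sq_def
    proof (rule nn_integral_cong_AE, use conv in eventually_elim)
      case (elim x)
      then have "(\<lambda>k. ennreal ((norm (F n x - F (r k) x))\<^sup>2)) \<longlonglongrightarrow> ennreal ((norm (F n x - g x))\<^sup>2)"
        unfolding g_def by (intro tendsto_intros)
      then show ?case by (intro lim_imp_Liminf[symmetric]) auto
    qed
    also have "\<dots> \<le> liminf (\<lambda>k. L2_sq M (\<lambda>x. F n x - F (r k) x))"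
      unfolding L2_sq_def by (rule nn_integral_liminf) measurable
    also have "\<dots> \<le> liminf (\<lambda>k. ennreal e)"
    proof (intro Liminf_mono)
      show "\<forall>\<^sub>F k in sequentially. L2_sq M (\<lambda>x. F n x - F (r k) x) \<le> ennreal e"
        using eventually_ge_at_top[of N']
        by eventually_elim (use r_ge(2) in \<open>auto intro!: that intro: order_trans\<close>)
    qed
    also have "\<dots> = ennreal e" by (simp add: Liminf_const)
    finally show ?thesis .
  qed
  have lim: "(\<lambda>n. L2_sq M (\<lambda>x. F n x - g x)) \<longlonglongrightarrow> 0"
  proof (rule order_tendstoI)
    fix a :: ennreal assume "0 < a"
    then obtain e where e: "e > 0" "ennreal e < a"
      by (metis dense ennreal_cases ennreal_less_zero_iff less_top_ennreal order_less_trans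
          ennreal_lt_0 ennreal_zero_less_top linorder_not_le zero_less_iff_neq_zero top_greatest)
    obtain N' where N': "\<And>m n. m \<ge> N' \<Longrightarrow> n \<ge> N' \<Longrightarrow> L2_sq M (\<lambda>x. F m x - F n x) \<le> ennreal e"
      using cauchy[OF e(1)] by blast
    show "\<forall>\<^sub>F n in sequentially. L2_sq M (\<lambda>x. F n x - g x) < a"
      using eventually_ge_at_top[of N']
      by eventually_elim (use bound[of N'] N' e in \<open>blast intro: le_less_trans\<close>)
  qed simp
  have "g \<in> L2_space M"
  proof -
    obtain N' where "\<And>m n. m \<ge> N' \<Longrightarrow> n \<ge> N' \<Longrightarrow> L2_sq M (\<lambda>x. F m x - F n x) \<le> ennreal 1"
      using cauchy[of 1] by auto
    then have "L2_sq M (\<lambda>x. F N' x - g x) \<le> ennreal 1" by (intro bound) auto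
    then have "(\<lambda>x. F N' x - g x) \<in> L2_space M"
      by (auto simp: L2_space_iff intro: le_less_trans)
    from L2_space_diff[OF F[of N'] this] show ?thesis by simp
  qed
  with lim show ?thesis using that by blast
qed

section \<open>Pairings, weak limits and truncations in L2\<close>

lemma L2_mult_integrable:
  fixes f g :: "'a \<Rightarrow> complex"
  assumes "f \<in> L2_space M" "g \<in> L2_space M"
  shows "integrable M (\<lambda>x. f x * g x)"
    and "(ennreal (norm (\<integral>x. f x * g x \<partial>M)))\<^sup>2 \<le> L2_sq M f * L2_sq M g"
proof -
  have [measurable]: "f \<in> borel_measurable M" "g \<in> borel_measurable M"
    using assms by (auto simp: L2_space_iff)
  have le: "(\<integral>\<^sup>+x. ennreal (norm (f x * g x)) \<partial>M)\<^sup>2 \<le> L2_sq M f * L2_sq M g"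
    using Cauchy_Schwarz_nn_integral[of "\<lambda>x. ennreal (norm (f x))" M "\<lambda>x. ennreal (norm (g x))"]
    by (simp add: L2_sq_def norm_mult ennreal_mult' ennreal_power)
  also have "\<dots> < \<infinity>"
    using assms by (simp add: L2_space_iff ennreal_mult_less_top)
  finally have "(\<integral>\<^sup>+x. ennreal (norm (f x * g x)) \<partial>M) < \<infinity>"
    by (simp add: power_less_top_ennreal)
  then show *: "integrable M (\<lambda>x. f x * g x)"
    by (intro integrableI_bounded) auto
  have "(ennreal (norm (\<integral>x. f x * g x \<partial>M)))\<^sup>2 \<le> (\<integral>\<^sup>+x. ennreal (norm (f x * g x)) \<partial>M)\<^sup>2"
    by (intro power_mono_ennreal integral_norm_bound_ennreal *)
  with le show "(ennreal (norm (\<integral>x. f x * g x \<partial>M)))\<^sup>2 \<le> L2_sq M f * L2_sq M g"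
    by simp
qed

text \<open>Cauchy-Schwarz. This carries identities for truncated functions over to L2 functions in
  \<open>L2_ft_inversion\<close>. The pairing has no conjugate, which suits the symmetric kernel of
  the Fourier integral.\<close>

lemma L2_weak_limit:
  fixes F :: "nat \<Rightarrow> 'a \<Rightarrow> complex"
  assumes F: "\<And>n. F n \<in> L2_space M" and g: "g \<in> L2_space M" and h: "h \<in> L2_space M"
    and lim: "(\<lambda>n. L2_sq M (\<lambda>x. F n x - g x)) \<longlonglongrightarrow> 0"
  shows "(\<lambda>n. \<integral>x. F n x * h x \<partial>M) \<longlonglongrightarrow> (\<integral>x. g x * h x \<partial>M)"
proof -
  have "(\<integral>x. (F n x - g x) * h x \<partial>M) = (\<integral>x. F n x * h x \<partial>M) - (\<integral>x. g x * h x \<partial>M)" for n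
    using L2_mult_integrable(1)[OF F h, of n] L2_mult_integrable(1)[OF g h]
    by (simp add: left_diff_distrib)
  then have "ennreal ((norm ((\<integral>x. F n x * h x \<partial>M) - (\<integral>x. g x * h x \<partial>M)))\<^sup>2)
      \<le> L2_sq M (\<lambda>x. F n x - g x) * L2_sq M h" for n
    using L2_mult_integrable(2)[OF L2_space_diff[OF F g] h, of n] by (simp add: ennreal_power)
  moreover have "(\<lambda>n. L2_sq M (\<lambda>x. F n x - g x) * L2_sq M h) \<longlonglongrightarrow> 0"
    using ennreal_tendsto_cmult[OF _ lim, of "L2_sq M h"] h by (simp add: L2_space_iff mult.commute)
  ultimately have "(\<lambda>n. ennreal ((norm ((\<integral>x. F n x * h x \<partial>M) - (\<integral>x. g x * h x \<partial>M)))\<^sup>2)) \<longlonglongrightarrow> ennreal 0"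
    using ennreal_limit_0_sandwich by simp
  then have "(\<lambda>n. (norm ((\<integral>x. F n x * h x \<partial>M) - (\<integral>x. g x * h x \<partial>M)))\<^sup>2) \<longlonglongrightarrow> 0"
    by (subst (asm) tendsto_ennreal_iff) auto
  then have "(\<lambda>n. norm ((\<integral>x. F n x * h x \<partial>M) - (\<integral>x. g x * h x \<partial>M))) \<longlonglongrightarrow> 0"
    using tendsto_real_sqrt[of "\<lambda>n. (norm ((\<integral>x. F n x * h x \<partial>M) - (\<integral>x. g x * h x \<partial>M)))\<^sup>2" 0 sequentially]
    by simp
  then show ?thesis by (simp add: LIM_zero_iff tendsto_norm_zero_iff)
qed

lemma L2_truncation_limit:
  fixes f :: "'a::euclidean_space \<Rightarrow> 'b::{real_normed_vector, second_countable_topology}"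
  assumes "f \<in> L2_space lborel"
  shows "(\<lambda>n::nat. L2_sq lborel (\<lambda>x. indicat_real (ball 0 (real n)) x *\<^sub>R f x - f x)) \<longlonglongrightarrow> 0"
proof -
  have [measurable]: "f \<in> borel_measurable borel" using assms by (simp add: L2_space_iff)
  have [measurable]: "ball 0 r \<in> sets (borel :: 'a measure)" for r by simp
  define u where "u n x = ennreal ((norm (indicat_real (ball 0 (real n)) x *\<^sub>R f x - f x))\<^sup>2)" for n x
  have "(\<lambda>n. \<integral>\<^sup>+x. u n x \<partial>lborel) \<longlonglongrightarrow> (\<integral>\<^sup>+x. 0 \<partial>(lborel :: 'a measure))"
  proof (rule nn_integral_dominated_convergence[where w = "\<lambda>x. ennreal ((norm (f x))\<^sup>2)"])
    show "u n \<in> borel_measurable lborel" for n unfolding u_def by measurable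
    show "AE x in lborel. u n x \<le> ennreal ((norm (f x))\<^sup>2)" for n
      unfolding u_def by (rule AE_I2) (simp add: indicator_def)
    show "(\<integral>\<^sup>+x. ennreal ((norm (f x))\<^sup>2) \<partial>lborel) < \<infinity>"
      using assms by (simp add: L2_space_iff L2_sq_def)
    show "AE x in lborel. (\<lambda>n. u n x) \<longlonglongrightarrow> 0"
    proof (rule AE_I2, rule tendsto_eventually)
      fix x :: 'a
      obtain N :: nat where N: "norm x < real N" using reals_Archimedean2 by blast
      have "u n x = 0" if "n \<ge> N" for n
        using N that by (simp add: u_def indicator_def)
      then show "\<forall>\<^sub>F n in sequentially. u n x = 0"
        unfolding eventually_sequentially by blast
    qed
  qed measurable
  then show ?thesis by (simp add: u_def L2_sq_def)
qed

text \<open>Cauchy-Schwarz against the indicator of \<open>A\<close>. The first part makes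
  truncations integrable; the second is the source of the volume factor in Bernstein's inequality,
  see \<open>ift_sup_bound\<close>.\<close>

lemma integrable_of_L2_finite_support:
  fixes f :: "'a \<Rightarrow> complex"
  assumes f: "f \<in> L2_space M" and A: "A \<in> sets M" "emeasure M A < \<infinity>"
  shows "integrable M (\<lambda>x. indicat_real A x *\<^sub>R f x)"
    and "(\<integral>\<^sup>+x. ennreal (norm (indicat_real A x *\<^sub>R f x)) \<partial>M)\<^sup>2 \<le> emeasure M A * L2_sq M f"
proof -
  have [measurable]: "f \<in> borel_measurable M" "A \<in> sets M"
    using assms by (auto simp: L2_space_iff)
  have "(\<integral>\<^sup>+x. indicator A x * ennreal (norm (f x)) \<partial>M)\<^sup>2 \<le> (\<integral>\<^sup>+x. (indicator A x)\<^sup>2 \<partial>M) * L2_sq M f"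
    using Cauchy_Schwarz_nn_integral[of "indicator A" M "\<lambda>x. ennreal (norm (f x))"]
    by (simp add: L2_sq_def ennreal_power)
  also have "(\<integral>\<^sup>+x. (indicator A x)\<^sup>2 \<partial>M) = (\<integral>\<^sup>+x. indicator A x \<partial>M)"
    by (intro nn_integral_cong) (auto simp: indicator_def)
  also have "\<dots> = emeasure M A" by simp
  also have "(\<integral>\<^sup>+x. indicator A x * ennreal (norm (f x)) \<partial>M) = (\<integral>\<^sup>+x. ennreal (norm (indicat_real A x *\<^sub>R f x)) \<partial>M)"
    by (intro nn_integral_cong) (auto simp: indicator_def)
  finally show le: "(\<integral>\<^sup>+x. ennreal (norm (indicat_real A x *\<^sub>R f x)) \<partial>M)\<^sup>2 \<le> emeasure M A * L2_sq M f" .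
  also have "\<dots> < \<infinity>" using f A by (simp add: L2_space_iff ennreal_mult_less_top)
  finally have "(\<integral>\<^sup>+x. ennreal (norm (indicat_real A x *\<^sub>R f x)) \<partial>M) < \<infinity>"
    by (simp add: power_less_top_ennreal)
  then show "integrable M (\<lambda>x. indicat_real A x *\<^sub>R f x)"
    by (intro integrableI_bounded) auto
qed

section \<open>The Fourier integral and Gaussians\<close>

text \<open>Unnormalised, like \<open>fourier_integral\<close>, whose components on truncated L2
  functions are values of \<open>ft\<close>. The factor (2 pi)^d therefore appears in Plancherel's
  bound and in inversion.\<close>

definition ft :: "('a::euclidean_space \<Rightarrow> complex) \<Rightarrow> 'a \<Rightarrow> complex" where
  "ft f \<xi> = (\<integral>x. cis (- (x \<bullet> \<xi>)) * f x \<partial>lborel)"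

definition ift :: "('a::euclidean_space \<Rightarrow> complex) \<Rightarrow> 'a \<Rightarrow> complex" where
  "ift f x = (\<integral>\<xi>. cis (\<xi> \<bullet> x) * f \<xi> \<partial>lborel)"

lemma borel_measurable_cis [measurable (raw)]:
  "h \<in> borel_measurable M \<Longrightarrow> (\<lambda>x. cis (h x)) \<in> borel_measurable M"
  by (rule borel_measurable_continuous_on[where f = cis]) (auto intro!: continuous_intros)

lemma integrable_cis_mult:
  fixes f :: "'a \<Rightarrow> complex"
  assumes [measurable]: "h \<in> borel_measurable M" and f: "integrable M f"
  shows "integrable M (\<lambda>x. cis (h x) * f x)"
  by (rule Bochner_Integration.integrable_bound[OF f])
     (use f in \<open>auto simp: norm_mult\<close>)

lemma ft_measurable [measurable]:
  assumes [measurable]: "f \<in> borel_measurable borel"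
  shows "ft f \<in> borel_measurable borel"
  unfolding ft_def by measurable

lemma ift_measurable [measurable]:
  assumes [measurable]: "f \<in> borel_measurable borel"
  shows "ift f \<in> borel_measurable borel"
  unfolding ift_def by measurable

text \<open>Conjugation exchanges the two kernels; through it \<open>ift_L2_bound\<close> and
  \<open>L2_ift_iff_cnj\<close> reduce to facts about \<open>ft\<close>.\<close>

lemma ift_eq_cnj_ft: "ift f x = cnj (ft (\<lambda>\<xi>. cnj (f \<xi>)) x)"
  unfolding ift_def ft_def by (subst Bochner_Integration.integral_cnj[symmetric]) (simp only: cis_cnj complex_cnj_mult complex_cnj_cnj minus_minus)

lemma norm_ft_le: "integrable lborel f \<Longrightarrow> norm (ft f \<xi>) \<le> (\<integral>x. norm (f x) \<partial>lborel)"
  unfolding ft_def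
  by (rule order_trans[OF integral_norm_bound]) (simp add: norm_mult)

lemma norm_ift_le: "integrable lborel f \<Longrightarrow> norm (ift f \<xi>) \<le> (\<integral>x. norm (f x) \<partial>lborel)"
  unfolding ift_def
  by (rule order_trans[OF integral_norm_bound]) (simp add: norm_mult)

lemma ft_diff:
  assumes "integrable lborel f" "integrable lborel g"
  shows "ft (\<lambda>x. f x - g x) \<xi> = ft f \<xi> - ft g \<xi>"
  unfolding ft_def using assms
  by (simp add: right_diff_distrib integrable_cis_mult)

text \<open>Fubini's theorem, the kernel having modulus 1. The parameter \<open>c\<close> is -1 for
  \<open>ft\<close> and 1 for \<open>ift\<close>, so that one statement gives both adjoint
  relations.\<close>

lemma fourier_kernel_swap:
  fixes f g :: "'a::euclidean_space \<Rightarrow> complex"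
  assumes f: "integrable lborel f" and g: "integrable lborel g"
  shows "(\<integral>\<xi>. (\<integral>x. cis (c * (x \<bullet> \<xi>)) * f x \<partial>lborel) * g \<xi> \<partial>lborel) =
    (\<integral>x. f x * (\<integral>\<xi>. cis (c * (x \<bullet> \<xi>)) * g \<xi> \<partial>lborel) \<partial>lborel)"
proof -
  have [measurable]: "f \<in> borel_measurable borel" "g \<in> borel_measurable borel"
    using f g by auto
  have "integrable (lborel \<Otimes>\<^sub>M lborel) (\<lambda>(x, \<xi>). cis (c * (x \<bullet> \<xi>)) * f x * g \<xi>)"
  proof (rule lborel_pair.Fubini_integrable)
    show "integrable lborel (\<lambda>x. \<integral>\<xi>. norm (case (x, \<xi>) of (x, \<xi>) \<Rightarrow> cis (c * (x \<bullet> \<xi>)) * f x * g \<xi>) \<partial>lborel)"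
      using f g by (simp add: norm_mult)
    show "AE x in lborel. integrable lborel (\<lambda>\<xi>. case (x, \<xi>) of (x, \<xi>) \<Rightarrow> cis (c * (x \<bullet> \<xi>)) * f x * g \<xi>)"
      using integrable_cis_mult[OF _ g] by (auto simp: mult.assoc mult.left_commute[of "cis _"])
  qed measurable
  from lborel_pair.Fubini_integral[OF this]
  have "(\<integral>\<xi>. (\<integral>x. cis (c * (x \<bullet> \<xi>)) * f x * g \<xi> \<partial>lborel) \<partial>lborel) =
    (\<integral>x. (\<integral>\<xi>. f x * (cis (c * (x \<bullet> \<xi>)) * g \<xi>) \<partial>lborel) \<partial>lborel)"
    by (simp add: ac_simps)
  then show ?thesis by simp
qed

lemma lborel_integral_affine:
  fixes f :: "'a::euclidean_space \<Rightarrow> 'b::{banach, second_countable_topology}"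
  assumes [measurable]: "f \<in> borel_measurable borel" and c: "c \<noteq> 0"
  shows "(\<integral>x. f x \<partial>lborel) = \<bar>c\<bar> ^ DIM('a) *\<^sub>R (\<integral>x. f (t + c *\<^sub>R x) \<partial>lborel)"
  by (subst lborel_affine[OF c, of t]) (simp add: integral_density integral_distr)

lemma nn_integral_lborel_translate:
  fixes f :: "'a::euclidean_space \<Rightarrow> ennreal"
  assumes [measurable]: "f \<in> borel_measurable borel"
  shows "(\<integral>\<^sup>+x. f (x + a) \<partial>lborel) = (\<integral>\<^sup>+x. f x \<partial>lborel)"
  by (subst lborel_distr_plus[of a, symmetric]) (simp add: nn_integral_distr add.commute)

section \<open>Gaussians and the regularised pairing\<close>

definition gauss :: "'a::euclidean_space \<Rightarrow> real" where
  "gauss x = exp (- (norm x)\<^sup>2 / 2)"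

lemma gauss_measurable [measurable]: "gauss \<in> borel_measurable borel"
  unfolding gauss_def by measurable

lemma gauss_bounds: "0 < gauss x" "gauss x \<le> 1" "0 \<le> gauss x"
  by (auto simp: gauss_def)

text \<open>Up to the constant of the density, the integral is the characteristic function of the
  standard normal distribution.\<close>

lemma gaussian_fourier_real:
  "(\<integral>x. cis (x * t) * complex_of_real (exp (- x\<^sup>2 / 2)) \<partial>lborel) = complex_of_real (sqrt (2 * pi) * exp (- t\<^sup>2 / 2))"
  and gaussian_integrable_real: "integrable lborel (\<lambda>x. cis (x * t) * complex_of_real (exp (- x\<^sup>2 / 2)))"
proof -
  have eq: "std_normal_density x *\<^sub>R cis (t * x) = complex_of_real (1 / sqrt (2 * pi)) * (cis (x * t) * complex_of_real (exp (- x\<^sup>2 / 2)))" for x t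
    by (simp add: std_normal_density_def scaleR_conv_of_real mult.commute)
  have *: "complex_of_real (exp (- t\<^sup>2 / 2)) = complex_of_real (1 / sqrt (2 * pi)) * (\<integral>x. cis (x * t) * complex_of_real (exp (- x\<^sup>2 / 2)) \<partial>lborel)" for t
  proof -
    have "complex_of_real (exp (- t\<^sup>2 / 2)) = (\<integral>x. cis (t * x) \<partial>std_normal_distribution)"
      using fun_cong[OF char_std_normal_distribution, of t] by (simp add: char_def cis_conv_exp)
    also have "\<dots> = (\<integral>x. std_normal_density x *\<^sub>R cis (t * x) \<partial>lborel)"
      by (subst integral_density) auto
    also have "\<dots> = complex_of_real (1 / sqrt (2 * pi)) * (\<integral>x. cis (x * t) * complex_of_real (exp (- x\<^sup>2 / 2)) \<partial>lborel)"
      unfolding eq by (rule integral_mult_right_zero)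
    finally show ?thesis .
  qed
  then show "(\<integral>x. cis (x * t) * complex_of_real (exp (- x\<^sup>2 / 2)) \<partial>lborel) = complex_of_real (sqrt (2 * pi) * exp (- t\<^sup>2 / 2))"
    by (simp add: field_simps)
  \<comment> \<open>The Bochner integral of a non-integrable function is 0, so a nonzero value
    proves integrability.\<close>
  have "(\<integral>x. cis (x * 0) * complex_of_real (exp (- x\<^sup>2 / 2)) \<partial>lborel) \<noteq> 0"
    using *[of 0] by auto
  then have "integrable lborel (\<lambda>x. cis (x * 0) * complex_of_real (exp (- x\<^sup>2 / 2)))"
    using not_integrable_integral_eq by blast
  then have "integrable lborel (\<lambda>x. complex_of_real (exp (- x\<^sup>2 / 2)))" by (simp only: mult_zero_right cis_zero mult_1_left)
  then show "integrable lborel (\<lambda>x. cis (x * t) * complex_of_real (exp (- x\<^sup>2 / 2)))"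
    by (intro integrable_cis_mult) auto
qed

text \<open>Kernel and Gaussian factor over the coordinates, and Lebesgue measure is the image of a
  product measure, which leaves the one-dimensional integral.\<close>

lemma gaussian_fourier:
  fixes \<xi> :: "'a::euclidean_space"
  shows "(\<integral>x. cis (x \<bullet> \<xi>) * complex_of_real (gauss x) \<partial>lborel) = complex_of_real (sqrt (2 * pi) ^ DIM('a) * gauss \<xi>)"
proof -
  interpret product_sigma_finite "\<lambda>_::'a. lborel :: real measure" ..
  have norm_sq: "(norm y)\<^sup>2 = (\<Sum>b\<in>Basis. (y \<bullet> b)\<^sup>2)" for y :: 'a
    by (subst power2_norm_eq_inner, subst euclidean_inner) (simp add: power2_eq_square)
  have cis_sum: "cis (sum h B) = (\<Prod>b\<in>B. cis (h b))" if "finite B" for h and B :: "'a set"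
    using that by induction (auto simp: cis_mult[symmetric])
  have gauss_prod: "gauss y = (\<Prod>b\<in>Basis. exp (- (y \<bullet> b)\<^sup>2 / 2))" for y :: 'a
    by (simp add: gauss_def norm_sq exp_sum[symmetric] sum_negf sum_divide_distrib)
  define k where "k b x = cis (x * (\<xi> \<bullet> b)) * complex_of_real (exp (- x\<^sup>2 / 2))" for b :: 'a and x :: real
  have prod: "cis (x \<bullet> \<xi>) * complex_of_real (gauss x) = (\<Prod>b\<in>Basis. k b (x \<bullet> b))" for x
    unfolding k_def prod.distrib gauss_prod of_real_prod
    by (subst euclidean_inner) (simp add: cis_sum)
  have [measurable]: "k b \<in> borel_measurable borel" for b unfolding k_def by measurable
  have "(\<integral>x. cis (x \<bullet> \<xi>) * complex_of_real (gauss x) \<partial>lborel) = (\<integral>f. (\<Prod>b\<in>Basis. k b (f b)) \<partial>(\<Pi>\<^sub>M b\<in>Basis. lborel))"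
    unfolding prod by (subst lborel_eq, subst integral_distr) auto
  also have "\<dots> = (\<Prod>b\<in>Basis. integral\<^sup>L lborel (k b))"
    unfolding k_def by (intro product_integral_prod gaussian_integrable_real finite_Basis)
  also have "\<dots> = (\<Prod>b\<in>Basis. complex_of_real (sqrt (2 * pi) * exp (- (\<xi> \<bullet> b)\<^sup>2 / 2)))"
    unfolding k_def gaussian_fourier_real ..
  also have "\<dots> = complex_of_real (sqrt (2 * pi) ^ DIM('a) * gauss \<xi>)"
    unfolding gauss_prod by (simp add: prod.distrib of_real_prod)
  finally show ?thesis .
qed

lemma gauss_integral: "(\<integral>x. gauss (x::'a::euclidean_space) \<partial>lborel) = sqrt (2 * pi) ^ DIM('a)"
proof -
  have "complex_of_real (\<integral>x. gauss (x::'a) \<partial>lborel) = complex_of_real (sqrt (2 * pi) ^ DIM('a))"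
    using gaussian_fourier[of "0::'a"] by (simp add: gauss_def)
  then show ?thesis by (simp only: of_real_eq_iff)
qed

lemma gauss_integrable [simp, intro]: "integrable lborel (gauss :: 'a::euclidean_space \<Rightarrow> real)"
  using gauss_integral[where 'a = 'a] by (auto intro: ccontr simp: not_integrable_integral_eq)

lemma nn_integral_gauss: "(\<integral>\<^sup>+x. ennreal (gauss (x::'a::euclidean_space)) \<partial>lborel) = ennreal (sqrt (2 * pi) ^ DIM('a))"
  by (subst nn_integral_eq_integral) (auto simp: gauss_integral gauss_bounds)

lemma gauss_scaled_integrable:
  assumes "\<epsilon> \<noteq> 0"
  shows "integrable lborel (\<lambda>\<xi>::'a::euclidean_space. complex_of_real (gauss (\<epsilon> *\<^sub>R \<xi>)))"
proof -
  have "integrable (density (distr lborel borel (\<lambda>x. 0 + \<epsilon> *\<^sub>R x)) (\<lambda>_. ennreal (\<bar>\<epsilon>\<bar> ^ DIM('a)))) (gauss :: 'a \<Rightarrow> real)"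
    using lborel_affine[OF assms, of "0::'a"] by (simp add: ennreal_power)
  then have "integrable lborel (\<lambda>x::'a. \<bar>\<epsilon>\<bar> ^ DIM('a) *\<^sub>R gauss (\<epsilon> *\<^sub>R x))"
    by (subst (asm) integrable_density) (auto simp: integrable_distr_eq)
  from integrable_mult_right[OF this, of "1 / \<bar>\<epsilon>\<bar> ^ DIM('a)"]
  have "integrable lborel (\<lambda>x::'a. gauss (\<epsilon> *\<^sub>R x))"
    using assms by simp
  then show ?thesis by simp
qed

text \<open>Parseval's identity with a Gaussian weight. \<open>ift \<phi>\<close> is merely bounded,
  and the weight makes it integrable for Fubini's theorem. After the exchange the weight has become
  an average of \<open>\<phi>\<close> at scale \<open>\<epsilon>\<close>, which concentrates at
  \<open>x\<close> as \<open>\<epsilon>\<close> tends to 0.\<close>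

lemma gauss_regularised_pairing:
  fixes f \<phi> :: "'a::euclidean_space \<Rightarrow> complex"
  assumes f: "integrable lborel f" and \<phi>: "integrable lborel \<phi>" and \<epsilon>: "\<epsilon> > 0"
  shows "(\<integral>\<xi>. ft f \<xi> * (ift \<phi> \<xi> * complex_of_real (gauss (\<epsilon> *\<^sub>R \<xi>))) \<partial>lborel) =
    sqrt (2 * pi) ^ DIM('a) * (\<integral>x. f x * (\<integral>z. \<phi> (x + \<epsilon> *\<^sub>R z) * complex_of_real (gauss z) \<partial>lborel) \<partial>lborel)"
proof -
  have [measurable]: "f \<in> borel_measurable borel" "\<phi> \<in> borel_measurable borel"
    using f \<phi> by auto
  define G where "G \<xi> = complex_of_real (gauss (\<epsilon> *\<^sub>R \<xi>))" for \<xi> :: 'a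
  have [measurable]: "G \<in> borel_measurable borel" unfolding G_def by measurable
  have G: "integrable lborel G" unfolding G_def using \<epsilon> by (intro gauss_scaled_integrable) auto
  have "integrable lborel (\<lambda>\<xi>. ift \<phi> \<xi> * G \<xi>)"
  proof (rule Bochner_Integration.integrable_bound[OF integrable_mult_right[OF G, of "complex_of_real (\<integral>x. norm (\<phi> x) \<partial>lborel)"]])
    show "AE x in lborel. norm (ift \<phi> x * G x) \<le> norm (complex_of_real (\<integral>x. norm (\<phi> x) \<partial>lborel) * G x)"
      using norm_ift_le[OF \<phi>] by (auto simp: norm_mult intro!: mult_right_mono)
  qed measurable
  from fourier_kernel_swap[OF f this, of "-1"]
  have "(\<integral>\<xi>. ft f \<xi> * (ift \<phi> \<xi> * G \<xi>) \<partial>lborel) =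
      (\<integral>x. f x * (\<integral>\<xi>. cis (- (x \<bullet> \<xi>)) * (ift \<phi> \<xi> * G \<xi>) \<partial>lborel) \<partial>lborel)"
    by (simp add: ft_def)
  moreover have inner: "(\<integral>\<xi>. cis (- (x \<bullet> \<xi>)) * (ift \<phi> \<xi> * G \<xi>) \<partial>lborel) =
      sqrt (2 * pi) ^ DIM('a) * (\<integral>z. \<phi> (x + \<epsilon> *\<^sub>R z) * complex_of_real (gauss z) \<partial>lborel)" for x
  proof -
    \<comment> \<open>\<open>L\<close> is the transform of the weight recentred at \<open>x\<close>.
      At \<open>x + \<epsilon> *\<^sub>R z\<close> it is a Gaussian in \<open>z\<close> times the
      power -d of \<epsilon>, and the Jacobian of this substitution cancels that power.\<close>
    define L where "L y = (\<integral>\<xi>. cis (y \<bullet> \<xi>) * (cis (- (x \<bullet> \<xi>)) * G \<xi>) \<partial>lborel)" for y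
    have [measurable]: "L \<in> borel_measurable borel" unfolding L_def by measurable
    have L: "\<epsilon> ^ DIM('a) *\<^sub>R L (x + \<epsilon> *\<^sub>R z) = complex_of_real (sqrt (2 * pi) ^ DIM('a) * gauss z)" for z
    proof -
      have "L (x + \<epsilon> *\<^sub>R z) = (\<integral>\<xi>. cis ((\<epsilon> *\<^sub>R \<xi>) \<bullet> z) * complex_of_real (gauss (\<epsilon> *\<^sub>R \<xi>)) \<partial>lborel)"
        unfolding L_def G_def mult.assoc[symmetric] cis_mult
        by (simp add: inner_add_left inner_add_right inner_commute)
      then show ?thesis
        using lborel_integral_affine[of "\<lambda>\<eta>. cis (\<eta> \<bullet> z) * complex_of_real (gauss \<eta>)" \<epsilon> 0] \<epsilon>
        by (simp add: gaussian_fourier)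
    qed
    have "(\<integral>\<xi>. cis (- (x \<bullet> \<xi>)) * (ift \<phi> \<xi> * G \<xi>) \<partial>lborel) =
        (\<integral>\<xi>. (\<integral>y. cis (1 * (y \<bullet> \<xi>)) * \<phi> y \<partial>lborel) * (cis (- (x \<bullet> \<xi>)) * G \<xi>) \<partial>lborel)"
      by (simp add: ift_def inner_commute ac_simps)
    also have "\<dots> = (\<integral>y. \<phi> y * L y \<partial>lborel)"
      unfolding L_def by (subst fourier_kernel_swap[OF \<phi> integrable_cis_mult[OF _ G]]) auto
    also have "\<dots> = \<epsilon> ^ DIM('a) *\<^sub>R (\<integral>z. \<phi> (x + \<epsilon> *\<^sub>R z) * L (x + \<epsilon> *\<^sub>R z) \<partial>lborel)"
      using \<epsilon> by (subst lborel_integral_affine[where c = \<epsilon> and t = x]) auto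
    also have "\<dots> = (\<integral>z. \<phi> (x + \<epsilon> *\<^sub>R z) * (\<epsilon> ^ DIM('a) *\<^sub>R L (x + \<epsilon> *\<^sub>R z)) \<partial>lborel)"
      unfolding scaleR_conv_of_real integral_mult_right_zero[symmetric] by (simp only: ac_simps)
    also have "\<dots> = (\<integral>z. complex_of_real (sqrt (2 * pi) ^ DIM('a)) * (\<phi> (x + \<epsilon> *\<^sub>R z) * complex_of_real (gauss z)) \<partial>lborel)"
      unfolding L by (simp add: ac_simps)
    finally show ?thesis by (subst (asm) integral_mult_right_zero) simp
  qed
  ultimately show ?thesis
    unfolding inner mult.left_commute[of "f _"] integral_mult_right_zero by (simp add: G_def)
qed

section \<open>Plancherel and inversion\<close>

text \<open>Holds for arbitrary \<open>f\<close>, because a Bochner integral that does not exist has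
  the value 0.\<close>

lemma norm_integral_le_nn_integral:
  fixes f :: "'a \<Rightarrow> 'b::{banach, second_countable_topology}"
  shows "ennreal (norm (\<integral>x. f x \<partial>M)) \<le> (\<integral>\<^sup>+x. ennreal (norm (f x)) \<partial>M)"
  by (cases "integrable M f") (auto simp: integral_norm_bound_ennreal not_integrable_integral_eq)

lemma borel_measurable_cnj [measurable (raw)]:
  "h \<in> borel_measurable M \<Longrightarrow> (\<lambda>x. cnj (h x)) \<in> borel_measurable M"
  by (rule borel_measurable_continuous_on[where f = cnj]) (auto intro!: continuous_intros)

lemma gauss_const:
  "sqrt (2 * pi) ^ n \<ge> 0" "sqrt (2 * pi) ^ n * sqrt (2 * pi) ^ n = (2 * pi) ^ n"
proof -
  have "sqrt (2 * pi) ^ n * sqrt (2 * pi) ^ n = (sqrt (2 * pi) * sqrt (2 * pi)) ^ n"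
    by (rule power_mult_distrib[symmetric])
  also have "sqrt (2 * pi) * sqrt (2 * pi) = 2 * pi"
    by (rule real_sqrt_mult_self[THEN trans]) simp
  finally show "sqrt (2 * pi) ^ n * sqrt (2 * pi) ^ n = (2 * pi) ^ n" .
qed (rule zero_le_power, simp)

text \<open>Half of Plancherel's theorem; inversion is deduced from it and supplies the other half. With
  \<open>\<phi> = cnj f\<close> in the regularised pairing, the inequality between the arithmetic and geometric means
  decouples the two factors of the double integral, and the Gaussian weight is removed by Fatou's lemma.\<close>

lemma ft_L2_bound:
  fixes f :: "'a::euclidean_space \<Rightarrow> complex"
  assumes f: "integrable lborel f"
  shows "L2_sq lborel (ft f) \<le> ennreal ((2 * pi) ^ DIM('a)) * L2_sq lborel f"
proof -
  have [measurable]: "f \<in> borel_measurable borel" using f by auto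
  define c where "c = sqrt (2 * pi) ^ DIM('a)"
  have c: "c \<ge> 0" "c * c = (2 * pi) ^ DIM('a)" unfolding c_def by (rule gauss_const)+
  have regularised: "(\<integral>\<^sup>+\<xi>. ennreal ((norm (ft f \<xi>))\<^sup>2 * gauss (\<epsilon> *\<^sub>R \<xi>)) \<partial>lborel) \<le> ennreal ((2 * pi) ^ DIM('a)) * L2_sq lborel f"
    if \<epsilon>: "\<epsilon> > 0" for \<epsilon>
  proof -
    define R where "R x = (\<integral>z. cnj (f (x + \<epsilon> *\<^sub>R z)) * complex_of_real (gauss z) \<partial>lborel)" for x
    have int: "integrable lborel (\<lambda>\<xi>. (norm (ft f \<xi>))\<^sup>2 * gauss (\<epsilon> *\<^sub>R \<xi>))"
    proof (rule Bochner_Integration.integrable_bound)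
      show "integrable lborel (\<lambda>\<xi>::'a. complex_of_real ((\<integral>x. norm (f x) \<partial>lborel)\<^sup>2) * complex_of_real (gauss (\<epsilon> *\<^sub>R \<xi>)))"
        using \<epsilon> by (intro integrable_mult_right gauss_scaled_integrable) auto
      show "AE \<xi> in lborel. norm ((norm (ft f \<xi>))\<^sup>2 * gauss (\<epsilon> *\<^sub>R \<xi>)) \<le>
          norm (complex_of_real ((\<integral>x. norm (f x) \<partial>lborel)\<^sup>2) * complex_of_real (gauss (\<epsilon> *\<^sub>R \<xi>)))"
        unfolding norm_mult norm_of_real using norm_ft_le[OF f]
        by (auto simp: abs_mult norm_power gauss_bounds intro!: mult_right_mono power_mono)
    qed measurable
    have "ift (\<lambda>x. cnj (f x)) \<xi> = cnj (ft f \<xi>)" for \<xi> by (simp add: ift_eq_cnj_ft)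
    then have "complex_of_real (\<integral>\<xi>. (norm (ft f \<xi>))\<^sup>2 * gauss (\<epsilon> *\<^sub>R \<xi>) \<partial>lborel) =
        (\<integral>\<xi>. ft f \<xi> * (ift (\<lambda>x. cnj (f x)) \<xi> * complex_of_real (gauss (\<epsilon> *\<^sub>R \<xi>))) \<partial>lborel)"
      unfolding mult.assoc[symmetric] by (simp add: complex_norm_square[symmetric] flip: of_real_power of_real_mult)
    also have "\<dots> = c * (\<integral>x. f x * R x \<partial>lborel)"
      unfolding R_def c_def using gauss_regularised_pairing[OF f integrable_cnj[OF f] \<epsilon>] by simp
    finally have eq: "complex_of_real (\<integral>\<xi>. (norm (ft f \<xi>))\<^sup>2 * gauss (\<epsilon> *\<^sub>R \<xi>) \<partial>lborel) = c * (\<integral>x. f x * R x \<partial>lborel)" .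
    have "(\<integral>\<^sup>+\<xi>. ennreal ((norm (ft f \<xi>))\<^sup>2 * gauss (\<epsilon> *\<^sub>R \<xi>)) \<partial>lborel) =
        ennreal (\<integral>\<xi>. (norm (ft f \<xi>))\<^sup>2 * gauss (\<epsilon> *\<^sub>R \<xi>) \<partial>lborel)"
      by (intro nn_integral_eq_integral int) (auto simp: gauss_bounds)
    also have "(\<integral>\<xi>. (norm (ft f \<xi>))\<^sup>2 * gauss (\<epsilon> *\<^sub>R \<xi>) \<partial>lborel) = norm (complex_of_real (\<integral>\<xi>. (norm (ft f \<xi>))\<^sup>2 * gauss (\<epsilon> *\<^sub>R \<xi>) \<partial>lborel))"
      by (simp add: gauss_bounds Bochner_Integration.integral_nonneg)
    also have "\<dots> = c * norm (\<integral>x. f x * R x \<partial>lborel)"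
      unfolding eq using c by (simp add: norm_mult)
    also have "ennreal \<dots> = ennreal c * ennreal (norm (\<integral>x. f x * R x \<partial>lborel))"
      using c by (simp add: ennreal_mult')
    also have "\<dots> \<le> ennreal c * (\<integral>\<^sup>+z. ennreal (gauss z) * L2_sq lborel f \<partial>(lborel :: 'a measure))"
    proof (rule mult_left_mono)
      have "ennreal (norm (\<integral>x. f x * R x \<partial>lborel)) \<le> (\<integral>\<^sup>+x. ennreal (norm (f x * R x)) \<partial>lborel)"
        by (rule norm_integral_le_nn_integral)
      also have "\<dots> \<le> (\<integral>\<^sup>+x. (\<integral>\<^sup>+z. ennreal (gauss z) * (ennreal ((norm (f x))\<^sup>2 / 2) + ennreal ((norm (f (x + \<epsilon> *\<^sub>R z)))\<^sup>2 / 2)) \<partial>lborel) \<partial>lborel)"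
      proof (rule nn_integral_mono)
        fix x
        have "ennreal (norm (f x * R x)) = ennreal (norm (f x)) * ennreal (norm (R x))"
          by (simp add: norm_mult ennreal_mult')
        also have "\<dots> \<le> ennreal (norm (f x)) * (\<integral>\<^sup>+z. ennreal (norm (cnj (f (x + \<epsilon> *\<^sub>R z)) * complex_of_real (gauss z))) \<partial>lborel)"
          unfolding R_def by (intro mult_left_mono norm_integral_le_nn_integral) auto
        also have "\<dots> = (\<integral>\<^sup>+z. ennreal (norm (f x)) * ennreal (norm (cnj (f (x + \<epsilon> *\<^sub>R z)) * complex_of_real (gauss z))) \<partial>lborel)"
          by (rule nn_integral_cmult[symmetric]) measurable
        also have "\<dots> \<le> (\<integral>\<^sup>+z. ennreal (gauss z) * (ennreal ((norm (f x))\<^sup>2 / 2) + ennreal ((norm (f (x + \<epsilon> *\<^sub>R z)))\<^sup>2 / 2)) \<partial>lborel)"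
        proof (rule nn_integral_mono)
          fix z
          have "norm (f x) * norm (f (x + \<epsilon> *\<^sub>R z)) \<le> (norm (f x))\<^sup>2 / 2 + (norm (f (x + \<epsilon> *\<^sub>R z)))\<^sup>2 / 2"
            using sum_squares_bound[of "norm (f x)" "norm (f (x + \<epsilon> *\<^sub>R z))"] by simp
          then have "gauss z * (norm (f x) * norm (f (x + \<epsilon> *\<^sub>R z))) \<le> gauss z * ((norm (f x))\<^sup>2 / 2 + (norm (f (x + \<epsilon> *\<^sub>R z)))\<^sup>2 / 2)"
            by (intro mult_left_mono gauss_bounds)
          then have "ennreal (gauss z * (norm (f x) * norm (f (x + \<epsilon> *\<^sub>R z)))) \<le> ennreal (gauss z * ((norm (f x))\<^sup>2 / 2 + (norm (f (x + \<epsilon> *\<^sub>R z)))\<^sup>2 / 2))"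
            by (rule ennreal_leI)
          then show "ennreal (norm (f x)) * ennreal (norm (cnj (f (x + \<epsilon> *\<^sub>R z)) * complex_of_real (gauss z))) \<le>
              ennreal (gauss z) * (ennreal ((norm (f x))\<^sup>2 / 2) + ennreal ((norm (f (x + \<epsilon> *\<^sub>R z)))\<^sup>2 / 2))"
            by (simp add: norm_mult gauss_bounds ennreal_mult'[symmetric] ennreal_plus[symmetric] ac_simps del: ennreal_plus)
        qed
        finally show "ennreal (norm (f x * R x)) \<le> (\<integral>\<^sup>+z. ennreal (gauss z) * (ennreal ((norm (f x))\<^sup>2 / 2) + ennreal ((norm (f (x + \<epsilon> *\<^sub>R z)))\<^sup>2 / 2)) \<partial>lborel)" .
      qed
      also have "\<dots> = (\<integral>\<^sup>+z. (\<integral>\<^sup>+x. ennreal (gauss z) * (ennreal ((norm (f x))\<^sup>2 / 2) + ennreal ((norm (f (x + \<epsilon> *\<^sub>R z)))\<^sup>2 / 2)) \<partial>lborel) \<partial>lborel)"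
        by (rule lborel_pair.Fubini') measurable
      also have "\<dots> = (\<integral>\<^sup>+z. ennreal (gauss z) * L2_sq lborel f \<partial>(lborel :: 'a measure))"
      proof (rule nn_integral_cong)
        fix z :: 'a
        have half: "(\<integral>\<^sup>+x. ennreal ((norm (f x))\<^sup>2 / 2) \<partial>lborel) = ennreal (1/2) * L2_sq lborel f"
        proof -
          have "(\<integral>\<^sup>+x. ennreal ((norm (f x))\<^sup>2 / 2) \<partial>lborel) = (\<integral>\<^sup>+x. ennreal (1/2) * ennreal ((norm (f x))\<^sup>2) \<partial>lborel)"
            by (intro nn_integral_cong) (subst ennreal_mult'[symmetric], auto)
          also have "\<dots> = ennreal (1/2) * L2_sq lborel f"
            unfolding L2_sq_def by (rule nn_integral_cmult) measurable
          finally show ?thesis .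
        qed
        have "(\<integral>\<^sup>+x. ennreal (gauss z) * (ennreal ((norm (f x))\<^sup>2 / 2) + ennreal ((norm (f (x + \<epsilon> *\<^sub>R z)))\<^sup>2 / 2)) \<partial>lborel) =
            ennreal (gauss z) * ((\<integral>\<^sup>+x. ennreal ((norm (f x))\<^sup>2 / 2) \<partial>lborel) + (\<integral>\<^sup>+x. ennreal ((norm (f (x + \<epsilon> *\<^sub>R z)))\<^sup>2 / 2) \<partial>lborel))"
          by (simp add: nn_integral_cmult nn_integral_add)
        \<comment> \<open>Translation invariance makes the two halves equal, so that the inner
          integral depends on neither \<open>\<epsilon>\<close> nor the shift by \<open>z\<close>;
          this is why the bound is uniform in \<open>\<epsilon>\<close>.\<close>
        also have "(\<integral>\<^sup>+x. ennreal ((norm (f (x + \<epsilon> *\<^sub>R z)))\<^sup>2 / 2) \<partial>lborel) = (\<integral>\<^sup>+x. ennreal ((norm (f x))\<^sup>2 / 2) \<partial>lborel)"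
          by (rule nn_integral_lborel_translate) measurable
        also have "(\<integral>\<^sup>+x. ennreal ((norm (f x))\<^sup>2 / 2) \<partial>lborel) + (\<integral>\<^sup>+x. ennreal ((norm (f x))\<^sup>2 / 2) \<partial>lborel) = (ennreal (1/2) + ennreal (1/2)) * L2_sq lborel f"
          unfolding half distrib_right ..
        also have "ennreal (1/2) + ennreal (1/2) = ennreal (1/2 + 1/2)"
          by (rule ennreal_plus[symmetric]) simp_all
        finally show "(\<integral>\<^sup>+x. ennreal (gauss z) * (ennreal ((norm (f x))\<^sup>2 / 2) + ennreal ((norm (f (x + \<epsilon> *\<^sub>R z)))\<^sup>2 / 2)) \<partial>lborel) =
            ennreal (gauss z) * L2_sq lborel f" by simp
      qed
      finally show "ennreal (norm (\<integral>x. f x * R x \<partial>lborel)) \<le> (\<integral>\<^sup>+z. ennreal (gauss z) * L2_sq lborel f \<partial>(lborel :: 'a measure))" .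
    qed simp
    also have "\<dots> = ennreal (c * c) * L2_sq lborel f"
      using c(1) by (simp add: nn_integral_multc nn_integral_gauss c_def[symmetric] ennreal_mult' mult.assoc)
    finally show ?thesis by (simp add: c)
  qed
  have "L2_sq lborel (ft f) = (\<integral>\<^sup>+\<xi>. liminf (\<lambda>n. ennreal ((norm (ft f \<xi>))\<^sup>2 * gauss (inverse (real (Suc n)) *\<^sub>R \<xi>))) \<partial>lborel)"
    unfolding L2_sq_def
  proof (rule nn_integral_cong)
    fix \<xi> :: 'a
    have "(\<lambda>n. ennreal ((norm (ft f \<xi>))\<^sup>2 * gauss (inverse (real (Suc n)) *\<^sub>R \<xi>))) \<longlonglongrightarrow> ennreal ((norm (ft f \<xi>))\<^sup>2 * exp (- (norm (0 *\<^sub>R \<xi>))\<^sup>2 / 2))"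
      unfolding gauss_def by (intro tendsto_intros LIMSEQ_inverse_real_of_nat) auto
    then show "ennreal ((norm (ft f \<xi>))\<^sup>2) = liminf (\<lambda>n. ennreal ((norm (ft f \<xi>))\<^sup>2 * gauss (inverse (real (Suc n)) *\<^sub>R \<xi>)))"
      by (intro lim_imp_Liminf[symmetric]) auto
  qed
  also have "\<dots> \<le> liminf (\<lambda>n. \<integral>\<^sup>+\<xi>. ennreal ((norm (ft f \<xi>))\<^sup>2 * gauss (inverse (real (Suc n)) *\<^sub>R \<xi>)) \<partial>lborel)"
    by (rule nn_integral_liminf) measurable
  also have "\<dots> \<le> liminf (\<lambda>n::nat. ennreal ((2 * pi) ^ DIM('a)) * L2_sq lborel f)"
    by (intro Liminf_mono always_eventually allI regularised) auto
  finally show ?thesis by (simp add: Liminf_const)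
qed

lemma ift_L2_bound:
  fixes f :: "'a::euclidean_space \<Rightarrow> complex"
  assumes f: "integrable lborel f"
  shows "L2_sq lborel (ift f) \<le> ennreal ((2 * pi) ^ DIM('a)) * L2_sq lborel f"
proof -
  have "L2_sq lborel (ift f) = L2_sq lborel (ft (\<lambda>x. cnj (f x)))"
    by (rule L2_sq_cong) (simp add: ift_eq_cnj_ft)
  also have "\<dots> \<le> ennreal ((2 * pi) ^ DIM('a)) * L2_sq lborel (\<lambda>x. cnj (f x))"
    by (intro ft_L2_bound integrable_cnj f)
  also have "L2_sq lborel (\<lambda>x. cnj (f x)) = L2_sq lborel f"
    by (rule L2_sq_cong) simp
  finally show ?thesis .
qed

lemma ft_in_L2:
  fixes f :: "'a::euclidean_space \<Rightarrow> complex"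
  assumes "integrable lborel f" "f \<in> L2_space lborel"
  shows "ft f \<in> L2_space lborel"
proof -
  have "L2_sq lborel (ft f) \<le> ennreal ((2 * pi) ^ DIM('a)) * L2_sq lborel f"
    by (rule ft_L2_bound[OF assms(1)])
  also have "\<dots> < \<infinity>"
    using assms(2) by (simp add: L2_space_iff ennreal_mult_less_top del: ennreal_power)
  finally show ?thesis using assms by (auto simp: L2_space_iff)
qed

lemma ift_in_L2:
  fixes f :: "'a::euclidean_space \<Rightarrow> complex"
  assumes "integrable lborel f" "f \<in> L2_space lborel"
  shows "ift f \<in> L2_space lborel"
proof -
  have "L2_sq lborel (ift f) \<le> ennreal ((2 * pi) ^ DIM('a)) * L2_sq lborel f"
    by (rule ift_L2_bound[OF assms(1)])
  also have "\<dots> < \<infinity>"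
    using assms(2) by (simp add: L2_space_iff ennreal_mult_less_top del: ennreal_power)
  finally show ?thesis using assms by (auto simp: L2_space_iff)
qed

section \<open>Indicators of boxes as test functions\<close>

definition box_fun :: "'a::euclidean_space \<Rightarrow> 'a \<Rightarrow> 'a \<Rightarrow> complex" where
  "box_fun a b x = indicator (box a b) x"

lemma box_fun_measurable [measurable]: "box_fun a b \<in> borel_measurable borel"
  unfolding box_fun_def by measurable

lemma norm_box_fun_le: "norm (box_fun a b x) \<le> 1"
  by (simp add: box_fun_def indicator_def)

lemma box_fun_integrable: "integrable lborel (box_fun a b)"
proof -
  have "integrable lborel (\<lambda>x. complex_of_real (indicat_real (box a b) x))"
    by (intro integrable_of_real integrable_real_indicator) (auto simp: emeasure_lborel_box_eq)
  also have "(\<lambda>x. complex_of_real (indicat_real (box a b) x)) = box_fun a b"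
    by (auto simp: box_fun_def indicator_def)
  finally show ?thesis .
qed

lemma box_fun_L2: "box_fun a b \<in> L2_space lborel"
proof -
  have "L2_sq lborel (box_fun a b) = (\<integral>\<^sup>+x. indicator (box a b) x \<partial>lborel)"
    unfolding L2_sq_def box_fun_def by (intro nn_integral_cong) (auto simp: indicator_def)
  then show ?thesis by (simp add: L2_space_iff emeasure_lborel_box_eq)
qed

text \<open>The exceptional set is where the indicator jumps; off it, Gaussian averages recover the
  indicator.\<close>

lemma AE_not_box_boundary: "AE x in lborel. x \<notin> cbox a b - box a b"
proof -
  have "cbox a b - box a b \<in> null_sets lebesgue"
    using negligible_frontier_interval negligible_iff_null_sets by blast
  then have "cbox a b - box a b \<in> null_sets lborel"
    by (subst (asm) null_sets_completion_iff) auto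
  then show ?thesis by (rule AE_not_in)
qed

text \<open>Off the boundary the indicator is locally constant, so for each \<open>z\<close> the
  integrand is eventually constant in \<open>n\<close>, and \<open>gauss\<close> dominates it. The
  factor in the limit is the total mass of \<open>gauss\<close>.\<close>

lemma box_fun_mollified_tendsto:
  fixes x :: "'a::euclidean_space"
  assumes x: "x \<notin> cbox a b - box a b"
  shows "(\<lambda>n. \<integral>z. box_fun a b (x + inverse (real (Suc n)) *\<^sub>R z) * complex_of_real (gauss z) \<partial>lborel)
    \<longlonglongrightarrow> sqrt (2 * pi) ^ DIM('a) * box_fun a b x"
proof -
  have "(\<lambda>n. \<integral>z. box_fun a b (x + inverse (real (Suc n)) *\<^sub>R z) * complex_of_real (gauss z) \<partial>lborel)
      \<longlonglongrightarrow> (\<integral>z. box_fun a b x * complex_of_real (gauss z) \<partial>(lborel :: 'a measure))"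
  proof (rule integral_dominated_convergence[where w = gauss])
    show "AE z in lborel. norm (box_fun a b (x + inverse (real (Suc n)) *\<^sub>R z) * complex_of_real (gauss z)) \<le> gauss z" for n
      using norm_box_fun_le by (auto simp: norm_mult gauss_bounds intro!: mult_left_le_one_le)
    show "AE z in lborel. (\<lambda>n. box_fun a b (x + inverse (real (Suc n)) *\<^sub>R z) * complex_of_real (gauss z)) \<longlonglongrightarrow> box_fun a b x * complex_of_real (gauss z)"
    proof (rule AE_I2, intro tendsto_mult tendsto_const tendsto_eventually)
      fix z :: 'a
      have "(\<lambda>n. x + inverse (real (Suc n)) *\<^sub>R z) \<longlonglongrightarrow> x + 0 *\<^sub>R z"
        by (intro tendsto_intros LIMSEQ_inverse_real_of_nat)
      then have lim: "(\<lambda>n. x + inverse (real (Suc n)) *\<^sub>R z) \<longlonglongrightarrow> x" by simp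
      show "\<forall>\<^sub>F n in sequentially. box_fun a b (x + inverse (real (Suc n)) *\<^sub>R z) = box_fun a b x"
      proof (cases "x \<in> box a b")
        case True
        show ?thesis
          by (rule eventually_mono[OF topological_tendstoD[OF lim open_box True]]) (use True in \<open>simp add: box_fun_def\<close>)
      next
        case False
        then have "x \<in> - cbox a b" using x by auto
        from topological_tendstoD[OF lim open_Compl[OF closed_cbox] this] show ?thesis
          by (rule eventually_mono) (use False box_subset_cbox[of a b] in \<open>auto simp: box_fun_def indicator_def\<close>)
      qed
    qed
  qed auto
  then show ?thesis by (simp add: gauss_integral mult.commute flip: of_real_power)
qed

text \<open>The regularised pairing in the limit of vanishing \<epsilon>. By Cauchy-Schwarz, square
  integrability of \<open>f\<close> makes the integrand on the frequency side integrable; on the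
  other side a multiple of |f| dominates. One factor \<open>c\<close> comes from the pairing, the
  other is the mass of the Gaussian.\<close>

lemma parseval_box:
  fixes f :: "'a::euclidean_space \<Rightarrow> complex"
  assumes f: "integrable lborel f" "f \<in> L2_space lborel"
  shows "(\<integral>\<xi>. ft f \<xi> * ift (box_fun a b) \<xi> \<partial>lborel) = (2 * pi) ^ DIM('a) * (\<integral>x. f x * box_fun a b x \<partial>lborel)"
proof -
  have [measurable]: "f \<in> borel_measurable borel" using f by auto
  define c where "c = sqrt (2 * pi) ^ DIM('a)"
  have c: "c \<ge> 0" "c * c = (2 * pi) ^ DIM('a)" unfolding c_def by (rule gauss_const)+
  define R where "R n x = (\<integral>z. box_fun a b (x + inverse (real (Suc n)) *\<^sub>R z) * complex_of_real (gauss z) \<partial>lborel)" for n x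
  have [measurable]: "R n \<in> borel_measurable borel" for n unfolding R_def by measurable
  have norm_R: "norm (R n x) \<le> c" for n x
  proof -
    have "norm (R n x) \<le> (\<integral>z. gauss z \<partial>(lborel :: 'a measure))"
      unfolding R_def
      by (rule order_trans[OF integral_norm_bound Bochner_Integration.integral_mono'[OF gauss_integrable]])
         (use norm_box_fun_le in \<open>auto simp: norm_mult gauss_bounds intro!: mult_left_le_one_le\<close>)
    then show ?thesis by (simp add: gauss_integral c_def)
  qed
  have int: "integrable lborel (\<lambda>\<xi>. ft f \<xi> * ift (box_fun a b) \<xi>)"
    by (intro L2_mult_integrable ft_in_L2 ift_in_L2 f box_fun_integrable box_fun_L2)
  have "(\<lambda>n. \<integral>\<xi>. ft f \<xi> * (ift (box_fun a b) \<xi> * complex_of_real (gauss (inverse (real (Suc n)) *\<^sub>R \<xi>))) \<partial>lborel)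
      \<longlonglongrightarrow> (\<integral>\<xi>. ft f \<xi> * ift (box_fun a b) \<xi> \<partial>lborel)"
  proof (rule integral_dominated_convergence)
    show "integrable lborel (\<lambda>\<xi>. norm (ft f \<xi> * ift (box_fun a b) \<xi>))" using int by (rule integrable_norm)
    show "AE \<xi> in lborel. norm (ft f \<xi> * (ift (box_fun a b) \<xi> * complex_of_real (gauss (inverse (real (Suc n)) *\<^sub>R \<xi>)))) \<le> norm (ft f \<xi> * ift (box_fun a b) \<xi>)" for n
      by (auto simp: norm_mult gauss_bounds mult.assoc[symmetric] intro!: mult_right_le_one_le)
    show "AE \<xi> in lborel. (\<lambda>n. ft f \<xi> * (ift (box_fun a b) \<xi> * complex_of_real (gauss (inverse (real (Suc n)) *\<^sub>R \<xi>)))) \<longlonglongrightarrow> ft f \<xi> * ift (box_fun a b) \<xi>"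
    proof (rule AE_I2)
      fix \<xi> :: 'a
      have "(\<lambda>n. ft f \<xi> * (ift (box_fun a b) \<xi> * complex_of_real (gauss (inverse (real (Suc n)) *\<^sub>R \<xi>)))) \<longlonglongrightarrow> ft f \<xi> * (ift (box_fun a b) \<xi> * complex_of_real (exp (- (norm (0 *\<^sub>R \<xi>))\<^sup>2 / 2)))"
        unfolding gauss_def by (intro tendsto_intros LIMSEQ_inverse_real_of_nat) auto
      then show "(\<lambda>n. ft f \<xi> * (ift (box_fun a b) \<xi> * complex_of_real (gauss (inverse (real (Suc n)) *\<^sub>R \<xi>)))) \<longlonglongrightarrow> ft f \<xi> * ift (box_fun a b) \<xi>" by simp
    qed
  qed measurable
  moreover have "(\<integral>\<xi>. ft f \<xi> * (ift (box_fun a b) \<xi> * complex_of_real (gauss (inverse (real (Suc n)) *\<^sub>R \<xi>))) \<partial>lborel) = c * (\<integral>x. f x * R n x \<partial>lborel)" for n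
    unfolding c_def R_def by (rule gauss_regularised_pairing[OF f(1) box_fun_integrable]) simp
  moreover have "(\<lambda>n. c * (\<integral>x. f x * R n x \<partial>lborel)) \<longlonglongrightarrow> c * (\<integral>x. f x * (c * box_fun a b x) \<partial>lborel)"
  proof (intro tendsto_mult tendsto_const, rule integral_dominated_convergence)
    show "integrable lborel (\<lambda>x. norm (f x) * c)" using f by auto
    show "AE x in lborel. norm (f x * R n x) \<le> norm (f x) * c" for n
      using norm_R by (auto simp: norm_mult intro!: mult_left_mono)
    show "AE x in lborel. (\<lambda>n. f x * R n x) \<longlonglongrightarrow> f x * (c * box_fun a b x)"
      using AE_not_box_boundary[of a b]
      by eventually_elim (use box_fun_mollified_tendsto in \<open>auto simp: R_def c_def intro!: tendsto_mult\<close>)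
  qed measurable
  ultimately have "(\<integral>\<xi>. ft f \<xi> * ift (box_fun a b) \<xi> \<partial>lborel) = c * (\<integral>x. f x * (c * box_fun a b x) \<partial>lborel)"
    by (simp add: LIMSEQ_unique)
  also have "(\<integral>x. f x * (c * box_fun a b x) \<partial>lborel) = c * (\<integral>x. f x * box_fun a b x \<partial>lborel)"
    by (subst integral_mult_right_zero[symmetric]) (simp add: ac_simps)
  also have "complex_of_real c * (c * (\<integral>x. f x * box_fun a b x \<partial>lborel)) = complex_of_real (c * c) * (\<integral>x. f x * box_fun a b x \<partial>lborel)"
    by simp
  finally show ?thesis unfolding c by simp
qed

text \<open>Boxes form a pi-system that generates the Borel sets, so Dynkin's argument extends the
  vanishing integrals to all Borel sets. Since \<open>h\<close> may fail to be globally integrable,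
  this is done inside each of countably many cubes that exhaust the space.\<close>

lemma AE_zero_of_box_integrals:
  fixes h :: "'a::euclidean_space \<Rightarrow> complex"
  assumes int: "\<And>a b. integrable lborel (\<lambda>x. h x * box_fun a b x)"
    and zero: "\<And>a b. (\<integral>x. h x * box_fun a b x \<partial>lborel) = 0"
    and [measurable]: "h \<in> borel_measurable borel"
  shows "AE x in lborel. h x = 0"
proof -
  have "AE x in lborel. h x * box_fun (- real N *\<^sub>R One) (real N *\<^sub>R One) x = 0" for N
  proof -
    define Q :: "'a set" where "Q = box (- real N *\<^sub>R One) (real N *\<^sub>R One)"
    define f where "f x = h x * box_fun (- real N *\<^sub>R One) (real N *\<^sub>R One) x" for x
    have f: "integrable lborel f" unfolding f_def by (rule int)
    \<comment> \<open>An intersection of boxes is a box, so the hypothesis \<open>zero\<close> also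
      covers the restriction of \<open>h\<close> to the cube.\<close>
    have box_mult: "box_fun a b x * box_fun a' b' x = box_fun (\<Sum>i\<in>Basis. max (a \<bullet> i) (a' \<bullet> i) *\<^sub>R i) (\<Sum>i\<in>Basis. min (b \<bullet> i) (b' \<bullet> i) *\<^sub>R i) x"
      for a b a' b' x :: 'a
      unfolding box_fun_def box_Int_box[symmetric] by (simp add: indicator_def)
    have "indicat_real (box a b) x *\<^sub>R f x = h x * (box_fun a b x * box_fun (- real N *\<^sub>R One) (real N *\<^sub>R One) x)" for a b x
      by (simp add: f_def box_fun_def indicator_def)
    note f_box = this[unfolded box_mult]
    have "(\<integral>x. f x \<partial>lborel) = 0" unfolding f_def by (rule zero)
    show ?thesis unfolding f_def[symmetric]
    proof (rule sigma_finite_measure.density_zero[OF lborel.sigma_finite_measure_axioms f])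
      fix A :: "'a set" assume "A \<in> sets lborel"
      then have A: "A \<in> sigma_sets UNIV (range (\<lambda>(a, b). box a b))"
        by (simp add: borel_eq_box)
      have "Int_stable (range (\<lambda>(a, b). box a b :: 'a set))"
        by (auto simp: Int_stable_def box_Int_box)
      moreover have "range (\<lambda>(a, b). box a b :: 'a set) \<subseteq> Pow UNIV" by simp
      ultimately show "set_lebesgue_integral lborel A f = 0" using A
      proof (induction rule: sigma_sets_induct_disjoint)
        case (basic A)
        then show ?case unfolding set_lebesgue_integral_def by (auto simp: f_box zero)
      next
        case empty
        then show ?case by (simp add: set_lebesgue_integral_def)
      next
        case (compl A)
        then have A: "A \<in> sets lborel" by (simp add: borel_eq_box)
        have "set_lebesgue_integral lborel (UNIV - A) f = (\<integral>x. f x \<partial>lborel) - set_lebesgue_integral lborel A f"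
        proof -
          have "set_lebesgue_integral lborel (UNIV - A) f = (\<integral>x. f x - indicat_real A x *\<^sub>R f x \<partial>lborel)"
            unfolding set_lebesgue_integral_def by (intro Bochner_Integration.integral_cong) (auto simp: indicator_def)
          also have "\<dots> = (\<integral>x. f x \<partial>lborel) - set_lebesgue_integral lborel A f"
            unfolding set_lebesgue_integral_def
            by (intro Bochner_Integration.integral_diff f integrable_mult_indicator A)
          finally show ?thesis .
        qed
        with compl \<open>(\<integral>x. f x \<partial>lborel) = 0\<close> show ?case by simp
      next
        case (union A)
        then have A: "A i \<in> sets lborel" for i by (auto simp: borel_eq_box)
        have "set_lebesgue_integral lborel (\<Union>i. A i) f = (\<Sum>i. set_lebesgue_integral lborel (A i) f)"
        proof (rule lebesgue_integral_countable_add)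
          show "set_integrable lborel (\<Union>i. A i) f"
            unfolding set_integrable_def using A by (intro integrable_mult_indicator f sets.countable_UN) auto
          show "A i \<inter> A j = {}" if "i \<noteq> j" for i j
            using union(1) that by (auto simp: disjoint_family_on_def)
        qed (rule A)
        with union show ?case by simp
      qed
    qed
  qed
  then have "AE x in lborel. \<forall>N. h x * box_fun (- real N *\<^sub>R One) (real N *\<^sub>R One) x = 0"
    unfolding AE_all_countable by blast
  then show ?thesis
  proof eventually_elim
    case (elim x)
    obtain N :: nat where N: "norm x < real N" using reals_Archimedean2 by blast
    have "x \<in> box (- real N *\<^sub>R One) (real N *\<^sub>R One)"
      unfolding mem_box
    proof
      fix i :: 'a assume "i \<in> Basis"
      then show "(- real N *\<^sub>R One) \<bullet> i < x \<bullet> i \<and> x \<bullet> i < (real N *\<^sub>R One) \<bullet> i"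
        using Basis_le_norm[of i x] N by auto
    qed
    then show ?case using elim[rule_format, of N] by (simp add: box_fun_def)
  qed
qed

section \<open>The transform on L2 as a limit over truncations to balls\<close>

definition trunc :: "nat \<Rightarrow> ('a::euclidean_space \<Rightarrow> 'b::real_vector) \<Rightarrow> 'a \<Rightarrow> 'b" where
  "trunc n f x = indicat_real (ball 0 (real n)) x *\<^sub>R f x"

lemma trunc_measurable [measurable]:
  fixes f :: "'a::euclidean_space \<Rightarrow> complex"
  assumes [measurable]: "f \<in> borel_measurable borel"
  shows "trunc n f \<in> borel_measurable borel"
proof -
  have [measurable]: "ball 0 r \<in> sets (borel :: 'a measure)" for r by simp
  show ?thesis unfolding trunc_def by measurable
qed

lemma trunc_L2:
  fixes f :: "'a::euclidean_space \<Rightarrow> complex"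
  assumes "f \<in> L2_space lborel"
  shows "trunc n f \<in> L2_space lborel" "integrable lborel (trunc n f)" "L2_sq lborel (trunc n f) \<le> L2_sq lborel f"
proof -
  have [measurable]: "f \<in> borel_measurable borel" using assms by (simp add: L2_space_iff)
  show le: "L2_sq lborel (trunc n f) \<le> L2_sq lborel f"
    by (rule L2_sq_mono_AE) (simp add: trunc_def indicator_def)
  also have "\<dots> < \<infinity>" using assms by (simp add: L2_space_iff)
  finally show "trunc n f \<in> L2_space lborel" by (simp add: L2_space_iff)
  show "integrable lborel (trunc n f)"
    unfolding trunc_def[abs_def]
    by (rule integrable_of_L2_finite_support(1)[OF assms]) (use emeasure_bounded_finite[OF bounded_ball] in auto)
qed

lemma trunc_tendsto:
  fixes f :: "'a::euclidean_space \<Rightarrow> complex"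
  assumes "f \<in> L2_space lborel"
  shows "(\<lambda>n. L2_sq lborel (\<lambda>x. trunc n f x - f x)) \<longlonglongrightarrow> 0"
  using L2_truncation_limit[OF assms] by (simp add: trunc_def)

lemma cnj_trunc: "cnj (trunc n f x) = trunc n (\<lambda>x. cnj (f x)) x"
  by (simp add: trunc_def)

lemma cnj_L2: "f \<in> L2_space M \<Longrightarrow> (\<lambda>x. cnj (f x)) \<in> L2_space M"
  by (simp add: L2_space_iff L2_sq_def borel_measurable_cnj)

text \<open>Since transforms are determined only up to null sets, they are treated as a relation.\<close>

definition L2_ft :: "('a::euclidean_space \<Rightarrow> complex) \<Rightarrow> ('a \<Rightarrow> complex) \<Rightarrow> bool" where
  "L2_ft f g \<longleftrightarrow> f \<in> L2_space lborel \<and> g \<in> L2_space lborel \<and>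
    (\<lambda>n. L2_sq lborel (\<lambda>\<xi>. ft (trunc n f) \<xi> - g \<xi>)) \<longlonglongrightarrow> 0"

definition L2_ift :: "('a::euclidean_space \<Rightarrow> complex) \<Rightarrow> ('a \<Rightarrow> complex) \<Rightarrow> bool" where
  "L2_ift f g \<longleftrightarrow> f \<in> L2_space lborel \<and> g \<in> L2_space lborel \<and>
    (\<lambda>n. L2_sq lborel (\<lambda>\<xi>. ift (trunc n f) \<xi> - g \<xi>)) \<longlonglongrightarrow> 0"

lemma L2_ift_iff_cnj: "L2_ift f g \<longleftrightarrow> L2_ft (\<lambda>x. cnj (f x)) (\<lambda>x. cnj (g x))"
proof -
  have "L2_sq lborel (\<lambda>\<xi>. ift (trunc n f) \<xi> - g \<xi>) = L2_sq lborel (\<lambda>\<xi>. ft (trunc n (\<lambda>x. cnj (f x))) \<xi> - cnj (g \<xi>))" for n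
  proof (rule L2_sq_cong)
    fix \<xi>
    have "ift (trunc n f) \<xi> - g \<xi> = cnj (ft (trunc n (\<lambda>x. cnj (f x))) \<xi> - cnj (g \<xi>))"
      by (simp add: ift_eq_cnj_ft cnj_trunc)
    then show "norm (ift (trunc n f) \<xi> - g \<xi>) = norm (ft (trunc n (\<lambda>x. cnj (f x))) \<xi> - cnj (g \<xi>))"
      by (simp only: complex_mod_cnj)
  qed
  moreover have "(\<lambda>x. cnj (h x)) \<in> L2_space lborel \<longleftrightarrow> h \<in> L2_space lborel" for h :: "'a \<Rightarrow> complex"
    using cnj_L2[of h lborel] cnj_L2[of "\<lambda>x. cnj (h x)" lborel] by auto
  ultimately show ?thesis by (simp add: L2_ift_def L2_ft_def)
qed

text \<open>\<open>ft_L2_bound\<close> applied to differences of truncations makes their transforms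
  a Cauchy sequence, and \<open>L2_complete\<close> gives the limit.\<close>

lemma L2_ft_exists:
  fixes f :: "'a::euclidean_space \<Rightarrow> complex"
  assumes f: "f \<in> L2_space lborel"
  obtains g where "L2_ft f g"
proof -
  have [measurable]: "f \<in> borel_measurable borel" using f by (simp add: L2_space_iff)
  define c where "c = (2 * pi) ^ DIM('a)"
  have c: "c > 0" by (simp add: c_def)
  define t where "t n = L2_sq lborel (\<lambda>x. trunc n f x - f x)" for n
  have t: "t \<longlonglongrightarrow> 0" unfolding t_def by (rule trunc_tendsto[OF f])
  have diff: "L2_sq lborel (\<lambda>\<xi>. ft (trunc m f) \<xi> - ft (trunc n f) \<xi>) \<le> ennreal c * (2 * (t m + t n))" for m n
  proof -
    have "L2_sq lborel (\<lambda>\<xi>. ft (trunc m f) \<xi> - ft (trunc n f) \<xi>) = L2_sq lborel (ft (\<lambda>x. trunc m f x - trunc n f x))"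
      by (intro L2_sq_cong) (simp add: ft_diff trunc_L2 f)
    also have "\<dots> \<le> ennreal c * L2_sq lborel (\<lambda>x. trunc m f x - trunc n f x)"
      unfolding c_def by (intro ft_L2_bound Bochner_Integration.integrable_diff trunc_L2 f)
    also have "\<dots> \<le> ennreal c * (2 * (t m + t n))"
      using L2_sq_triangle[of "trunc m f" lborel f "trunc n f"]
      by (intro mult_left_mono) (auto simp: t_def L2_sq_minus_commute[of lborel f])
    finally show ?thesis .
  qed
  have "\<exists>N. \<forall>m\<ge>N. \<forall>n\<ge>N. L2_sq lborel (\<lambda>x. ft (trunc m f) x - ft (trunc n f) x) \<le> ennreal e" if e: "e > 0" for e
  proof -
    \<comment> \<open>The tolerance is chosen such that c * 2 * (e/(4c) + e/(4c)) = e.\<close>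
    have "eventually (\<lambda>n. t n < ennreal (e / (4 * c))) sequentially"
      using e c by (intro order_tendstoD[OF t]) auto
    then obtain N where N: "\<And>n. n \<ge> N \<Longrightarrow> t n < ennreal (e / (4 * c))"
      by (auto simp: eventually_sequentially)
    have "L2_sq lborel (\<lambda>x. ft (trunc m f) x - ft (trunc n f) x) \<le> ennreal e" if "m \<ge> N" "n \<ge> N" for m n
    proof -
      have "ennreal c * (2 * (t m + t n)) \<le> ennreal c * (2 * (ennreal (e / (4 * c)) + ennreal (e / (4 * c))))"
        using N[OF that(1)] N[OF that(2)] by (intro mult_left_mono add_mono) auto
      also have "\<dots> = ennreal c * (ennreal 2 * ennreal (e / (4 * c) + e / (4 * c)))"
        using e c by (subst ennreal_plus) auto
      also have "\<dots> = ennreal (c * (2 * (e / (4 * c) + e / (4 * c))))"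
        using e c by (simp only: ennreal_mult' zero_le_numeral less_imp_le)
      also have "c * (2 * (e / (4 * c) + e / (4 * c))) = e" using c by (simp add: field_simps)
      finally show ?thesis using diff[of m n] by (rule order_trans[rotated])
    qed
    then show ?thesis by blast
  qed
  note cauchy = this
  have F: "ft (trunc n f) \<in> L2_space lborel" for n by (intro ft_in_L2 trunc_L2 f)
  obtain g where "g \<in> L2_space lborel" "(\<lambda>n. L2_sq lborel (\<lambda>x. ft (trunc n f) x - g x)) \<longlonglongrightarrow> 0"
    using L2_complete[of "\<lambda>n. ft (trunc n f)" lborel, OF F cauchy] by blast
  then show ?thesis using that f by (auto simp: L2_ft_def)
qed

lemma L2_ft_unique:
  assumes "L2_ft f g" "L2_ft f h"
  shows "AE x in lborel. g x = h x"
  using assms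
  by (intro L2_limit_unique[of "\<lambda>n. ft (trunc n f)" lborel g h])
     (auto simp: L2_ft_def L2_space_iff)

lemma L2_ft_bound:
  fixes f :: "'a::euclidean_space \<Rightarrow> complex"
  assumes "L2_ft f g"
  shows "L2_sq lborel g \<le> 2 * (ennreal ((2 * pi) ^ DIM('a)) * L2_sq lborel f)"
proof (rule L2_limit_bound[of "\<lambda>n. ft (trunc n f)"])
  have f: "f \<in> L2_space lborel" using assms by (simp add: L2_ft_def)
  show "L2_sq lborel (ft (trunc n f)) \<le> ennreal ((2 * pi) ^ DIM('a)) * L2_sq lborel f" for n
    by (rule order_trans[OF ft_L2_bound mult_left_mono]) (auto intro: trunc_L2 f)
qed (use assms in \<open>auto simp: L2_ft_def L2_space_iff\<close>)

lemma L2_ft_cong_AE: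
  assumes "L2_ft f g" "AE x in lborel. f x = f' x" "AE x in lborel. g x = g' x"
    "f' \<in> borel_measurable borel" "g' \<in> borel_measurable borel"
  shows "L2_ft f' g'"
proof -
  have "L2_sq lborel f' = L2_sq lborel f" "L2_sq lborel g' = L2_sq lborel g"
    using assms(2,3) by (auto intro!: L2_sq_cong_AE)
  then have "f' \<in> L2_space lborel" "g' \<in> L2_space lborel"
    using assms by (auto simp: L2_ft_def L2_space_iff)
  moreover have "L2_sq lborel (\<lambda>\<xi>. ft (trunc n f') \<xi> - g' \<xi>) = L2_sq lborel (\<lambda>\<xi>. ft (trunc n f) \<xi> - g \<xi>)" for n
  proof (rule L2_sq_cong_AE)
    have [measurable]: "f \<in> borel_measurable borel" "f' \<in> borel_measurable borel"
      using assms by (auto simp: L2_ft_def L2_space_iff)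
    have "ft (trunc n f') \<xi> = ft (trunc n f) \<xi>" for \<xi>
    proof -
      have "AE x in lborel. cis (- (x \<bullet> \<xi>)) * trunc n f' x = cis (- (x \<bullet> \<xi>)) * trunc n f x"
        using assms(2) by eventually_elim (simp add: trunc_def)
      then show ?thesis unfolding ft_def by (intro integral_cong_AE) measurable
    qed
    then show "AE \<xi> in lborel. norm (ft (trunc n f') \<xi> - g' \<xi>) = norm (ft (trunc n f) \<xi> - g \<xi>)"
      using assms(3) by auto
  qed
  ultimately show ?thesis using assms(1) by (simp add: L2_ft_def)
qed

lemma L2_ft_cmult:
  assumes "L2_ft f g"
  shows "L2_ft (\<lambda>x. c * f x) (\<lambda>x. c * g x)"
proof -
  have [measurable]: "f \<in> borel_measurable borel" "g \<in> borel_measurable borel"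
    using assms by (auto simp: L2_ft_def L2_space_iff)
  have "ft (trunc n (\<lambda>x. c * f x)) \<xi> = c * ft (trunc n f) \<xi>" for n \<xi>
    unfolding ft_def trunc_def by (subst integral_mult_right_zero[symmetric]) (simp add: ac_simps)
  then have "L2_sq lborel (\<lambda>\<xi>. ft (trunc n (\<lambda>x. c * f x)) \<xi> - c * g \<xi>) = ennreal ((norm c)\<^sup>2) * L2_sq lborel (\<lambda>\<xi>. ft (trunc n f) \<xi> - g \<xi>)" for n
    by (subst L2_sq_cmult[symmetric]) (auto simp: right_diff_distrib)
  moreover have "(\<lambda>n. ennreal ((norm c)\<^sup>2) * L2_sq lborel (\<lambda>\<xi>. ft (trunc n f) \<xi> - g \<xi>)) \<longlonglongrightarrow> ennreal ((norm c)\<^sup>2) * 0"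
    using assms by (intro ennreal_tendsto_cmult) (auto simp: L2_ft_def)
  ultimately show ?thesis using assms by (simp add: L2_ft_def L2_space_cmult)
qed

text \<open>The inverse transform of \<open>g\<close> is identified by its integrals over boxes, where the adjoint
  relation moves both transforms onto the indicator function of the box.\<close>

lemma L2_ft_inversion:
  fixes f :: "'a::euclidean_space \<Rightarrow> complex"
  assumes fg: "L2_ft f g"
  shows "L2_ift g (\<lambda>x. (2 * pi) ^ DIM('a) * f x)"
proof -
  define c where "c = complex_of_real ((2 * pi) ^ DIM('a))"
  have f: "f \<in> L2_space lborel" and g: "g \<in> L2_space lborel" using fg by (auto simp: L2_ft_def)
  have [measurable]: "f \<in> borel_measurable borel" "g \<in> borel_measurable borel"
    using f g by (auto simp: L2_space_iff)
  \<comment> \<open>An inverse transform \<open>h\<close> of \<open>g\<close> exists, as the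
    conjugate of a forward transform; it remains to identify it with \<open>c * f\<close>.\<close>
  obtain h' where "L2_ft (\<lambda>x. cnj (g x)) h'" using L2_ft_exists[OF cnj_L2[OF g]] .
  then have gh: "L2_ift g (\<lambda>x. cnj (h' x))" by (simp add: L2_ift_iff_cnj)
  define h where "h x = cnj (h' x)" for x
  have gh: "L2_ift g h" using gh by (simp add: h_def[abs_def])
  then have h: "h \<in> L2_space lborel" by (simp add: L2_ift_def)
  then have [measurable]: "h \<in> borel_measurable borel" by (simp add: L2_space_iff)
  note box = box_fun_integrable box_fun_L2
  have box_L2: "ift (box_fun a b) \<in> L2_space lborel" for a b :: 'a
    by (intro ift_in_L2 box)
  have eq: "(\<integral>x. h x * box_fun a b x \<partial>lborel) = c * (\<integral>x. f x * box_fun a b x \<partial>lborel)" for a b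
  proof -
    have "(\<lambda>n. \<integral>x. ift (trunc n g) x * box_fun a b x \<partial>lborel) \<longlonglongrightarrow> (\<integral>x. h x * box_fun a b x \<partial>lborel)"
      using gh by (intro L2_weak_limit box ift_in_L2 trunc_L2 g h) (simp add: L2_ift_def)
    moreover have "(\<integral>x. ift (trunc n g) x * box_fun a b x \<partial>lborel) = (\<integral>\<xi>. trunc n g \<xi> * ift (box_fun a b) \<xi> \<partial>lborel)" for n
      using fourier_kernel_swap[OF trunc_L2(2)[OF g] box(1), of 1 n a b]
      by (simp add: ift_def inner_commute)
    moreover have "(\<lambda>n. \<integral>\<xi>. trunc n g \<xi> * ift (box_fun a b) \<xi> \<partial>lborel) \<longlonglongrightarrow> (\<integral>\<xi>. g \<xi> * ift (box_fun a b) \<xi> \<partial>lborel)"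
      by (intro L2_weak_limit trunc_L2 g box_L2 trunc_tendsto)
    ultimately have 1: "(\<integral>x. h x * box_fun a b x \<partial>lborel) = (\<integral>\<xi>. g \<xi> * ift (box_fun a b) \<xi> \<partial>lborel)"
      by (simp add: LIMSEQ_unique)
    have "(\<lambda>n. \<integral>\<xi>. ft (trunc n f) \<xi> * ift (box_fun a b) \<xi> \<partial>lborel) \<longlonglongrightarrow> (\<integral>\<xi>. g \<xi> * ift (box_fun a b) \<xi> \<partial>lborel)"
      using fg by (intro L2_weak_limit box_L2 ft_in_L2 trunc_L2 g f) (simp add: L2_ft_def)
    moreover have "(\<integral>\<xi>. ft (trunc n f) \<xi> * ift (box_fun a b) \<xi> \<partial>lborel) = c * (\<integral>x. trunc n f x * box_fun a b x \<partial>lborel)" for n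
      unfolding c_def by (subst parseval_box) (auto intro: trunc_L2 f)
    moreover have "(\<lambda>n. c * (\<integral>x. trunc n f x * box_fun a b x \<partial>lborel)) \<longlonglongrightarrow> c * (\<integral>x. f x * box_fun a b x \<partial>lborel)"
      by (intro tendsto_mult tendsto_const L2_weak_limit trunc_L2 f box trunc_tendsto)
    ultimately have "(\<integral>\<xi>. g \<xi> * ift (box_fun a b) \<xi> \<partial>lborel) = c * (\<integral>x. f x * box_fun a b x \<partial>lborel)"
      by (simp add: LIMSEQ_unique)
    with 1 show ?thesis by simp
  qed
  have cf: "(\<lambda>x. c * f x) \<in> L2_space lborel" by (intro L2_space_cmult f)
  have "AE x in lborel. h x - c * f x = 0"
  proof (rule AE_zero_of_box_integrals)
    show "integrable lborel (\<lambda>x. (h x - c * f x) * box_fun a b x)" for a b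
      by (intro L2_mult_integrable(1) L2_space_diff h cf box)
    show "(\<integral>x. (h x - c * f x) * box_fun a b x \<partial>lborel) = 0" for a b
    proof -
      have "(\<integral>x. (h x - c * f x) * box_fun a b x \<partial>lborel) = (\<integral>x. h x * box_fun a b x - c * (f x * box_fun a b x) \<partial>lborel)"
        by (simp add: left_diff_distrib mult.assoc)
      also have "\<dots> = (\<integral>x. h x * box_fun a b x \<partial>lborel) - (\<integral>x. c * (f x * box_fun a b x) \<partial>lborel)"
        by (intro Bochner_Integration.integral_diff integrable_mult_right L2_mult_integrable(1) h f box)
      finally show ?thesis by (simp add: eq)
    qed
  qed measurable
  then have AE: "AE x in lborel. cnj (h x) = cnj (c * f x)" by auto
  have "L2_ft (\<lambda>x. cnj (g x)) (\<lambda>x. cnj (c * f x))"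
    by (rule L2_ft_cong_AE[OF gh[unfolded L2_ift_iff_cnj] AE_I2 AE]) auto
  then show ?thesis by (simp add: L2_ift_iff_cnj c_def)
qed

text \<open>Conjugation turns inversion into surjectivity: if h is the transform of cnj g, then c *
  cnj g is the inverse transform of h, so c * g is the transform of cnj h. This supplies the witness
  for \<open>fourier_multiplier\<close>.\<close>

lemma L2_ft_surj:
  fixes g :: "'a::euclidean_space \<Rightarrow> complex"
  assumes g: "g \<in> L2_space lborel"
  obtains f where "L2_ft f g"
proof -
  define c where "c = complex_of_real ((2 * pi) ^ DIM('a))"
  have c: "c \<noteq> 0" "cnj c = c" by (auto simp: c_def)
  obtain h where "L2_ft (\<lambda>x. cnj (g x)) h" using L2_ft_exists[OF cnj_L2[OF g]] .
  from L2_ft_inversion[OF this] have "L2_ift h (\<lambda>x. c * cnj (g x))" by (simp add: c_def)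
  then have "L2_ft (\<lambda>x. cnj (h x)) (\<lambda>x. c * g x)" by (simp add: L2_ift_iff_cnj c)
  from L2_ft_cmult[OF this, of "1 / c"] c have "L2_ft (\<lambda>x. 1 / c * cnj (h x)) g" by simp
  then show ?thesis using that by blast
qed

text \<open>When \<open>g\<close> has bounded support its truncations are eventually
  \<open>g\<close> itself, so inversion in L2 becomes an ordinary integral. This gives pointwise
  control of the waves and a formula that is measurable in t and x jointly.\<close>

lemma L2_ft_inverse_integral:
  fixes f :: "'a::euclidean_space \<Rightarrow> complex"
  assumes fg: "L2_ft f g" and supp: "\<And>\<xi>. R \<le> norm \<xi> \<Longrightarrow> g \<xi> = 0"
  shows "AE x in lborel. f x = ift g x / (2 * pi) ^ DIM('a)"
proof -
  have [measurable]: "f \<in> borel_measurable borel" "g \<in> borel_measurable borel"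
    using fg by (auto simp: L2_ft_def L2_space_iff)
  obtain N :: nat where N: "R < real N" using reals_Archimedean2 by blast
  have "trunc n g = g" if "n \<ge> N" for n
  proof
    fix \<xi>
    show "trunc n g \<xi> = g \<xi>" using supp[of \<xi>] N that by (auto simp: trunc_def indicator_def)
  qed
  then have "L2_sq lborel (\<lambda>x. ift (trunc n g) x - ift g x) = 0" if "n \<ge> N" for n
    using that by (simp add: L2_sq_def)
  then have "(\<lambda>n. L2_sq lborel (\<lambda>x. ift (trunc n g) x - ift g x)) \<longlonglongrightarrow> 0"
    by (intro tendsto_eventually) (auto simp: eventually_sequentially)
  moreover have "(\<lambda>n. L2_sq lborel (\<lambda>x. ift (trunc n g) x - (2 * pi) ^ DIM('a) * f x)) \<longlonglongrightarrow> 0"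
    using L2_ft_inversion[OF fg] by (simp add: L2_ift_def)
  ultimately have "AE x in lborel. ift g x = (2 * pi) ^ DIM('a) * f x"
    by (intro L2_limit_unique[of "\<lambda>n. ift (trunc n g)"]) auto
  then show ?thesis by eventually_elim simp
qed

section \<open>The vector-valued transform and multipliers\<close>

lemma borel_measurable_vec_iff:
  fixes f :: "'a \<Rightarrow> complex^'n"
  shows "f \<in> borel_measurable M \<longleftrightarrow> (\<forall>i. (\<lambda>x. f x $ i) \<in> borel_measurable M)"
proof
  assume f: "f \<in> borel_measurable M"
  show "\<forall>i. (\<lambda>x. f x $ i) \<in> borel_measurable M"
    by (intro allI borel_measurable_continuous_on[OF _ f]) (intro continuous_intros)
next
  assume comp: "\<forall>i. (\<lambda>x. f x $ i) \<in> borel_measurable M"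
  show "f \<in> borel_measurable M"
    unfolding borel_measurable_euclidean_space[of f]
  proof
    fix b :: "complex^'n" assume "b \<in> Basis"
    then obtain i u where b: "b = axis i u" by (auto simp: Basis_vec_def)
    have [measurable]: "(\<lambda>x. f x $ i) \<in> borel_measurable M" using comp by blast
    show "(\<lambda>x. f x \<bullet> b) \<in> borel_measurable M" unfolding b inner_axis by measurable
  qed
qed

lemma norm_vec_sq: "(norm (v :: complex^'n))\<^sup>2 = (\<Sum>i\<in>UNIV. (norm (v $ i))\<^sup>2)"
  by (simp add: norm_vec_def L2_set_def sum_nonneg)

lemma L2_sq_vec:
  fixes f :: "'a \<Rightarrow> complex^'n"
  assumes "f \<in> borel_measurable M"
  shows "L2_sq M f = (\<Sum>i\<in>UNIV. L2_sq M (\<lambda>x. f x $ i))"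
proof -
  have [measurable]: "(\<lambda>x. f x $ i) \<in> borel_measurable M" for i
    using assms by (simp add: borel_measurable_vec_iff)
  show ?thesis unfolding L2_sq_def norm_vec_sq
    by (subst nn_integral_sum[symmetric]) (auto simp: sum_ennreal)
qed

lemma L2_sq_nth_le:
  fixes f :: "'a \<Rightarrow> complex^'n"
  shows "L2_sq M (\<lambda>x. f x $ i) \<le> L2_sq M f"
  by (rule L2_sq_mono_AE) (simp add: Finite_Cartesian_Product.norm_nth_le)

lemma L2_space_vec_iff:
  fixes f :: "'a \<Rightarrow> complex^'n"
  shows "f \<in> L2_space M \<longleftrightarrow> (\<forall>i. (\<lambda>x. f x $ i) \<in> L2_space M)"
proof
  assume f: "f \<in> L2_space M"
  show "\<forall>i. (\<lambda>x. f x $ i) \<in> L2_space M"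
  proof
    fix i
    have "L2_sq M (\<lambda>x. f x $ i) \<le> L2_sq M f" by (rule L2_sq_nth_le)
    also have "\<dots> < \<infinity>" using f by (simp add: L2_space_iff)
    finally show "(\<lambda>x. f x $ i) \<in> L2_space M"
      using f by (simp add: L2_space_iff borel_measurable_vec_iff)
  qed
next
  assume comp: "\<forall>i. (\<lambda>x. f x $ i) \<in> L2_space M"
  then have f: "f \<in> borel_measurable M" by (simp add: L2_space_iff borel_measurable_vec_iff)
  then show "f \<in> L2_space M" using comp
    by (simp add: L2_space_iff L2_sq_vec less_top)
qed

lemma integrable_vec:
  fixes f :: "'a \<Rightarrow> complex^'n"
  assumes "\<And>i. integrable M (\<lambda>x. f x $ i)"
  shows "integrable M f"
proof (rule Bochner_Integration.integrable_bound)
  show "integrable M (\<lambda>x. \<Sum>i\<in>UNIV. norm (f x $ i))"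
    by (intro Bochner_Integration.integrable_sum integrable_norm assms)
  show "f \<in> borel_measurable M"
    using assms by (auto simp: borel_measurable_vec_iff)
  show "AE x in M. norm (f x) \<le> norm (\<Sum>i\<in>UNIV. norm (f x $ i))"
    by (rule AE_I2) (simp add: norm_vec_def L2_set_le_sum sum_nonneg)
qed

lemma fourier_integral_truncated_nth:
  assumes "f \<in> L2_space lborel"
  shows "fourier_integral (\<lambda>x. indicat_real (ball 0 (real n)) x *\<^sub>R f x) \<xi> $ i = ft (trunc n (\<lambda>x. f x $ i)) \<xi>"
proof -
  have "integrable lborel (\<lambda>x. cis (- (x \<bullet> \<xi>)) * trunc n (\<lambda>x. f x $ i) x)" for i
    using assms by (intro integrable_cis_mult trunc_L2) (auto simp: L2_space_vec_iff)
  then have "integrable lborel (\<lambda>x. cis (- (x \<bullet> \<xi>)) *s (indicat_real (ball 0 (real n)) x *\<^sub>R f x))"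
    by (intro integrable_vec) (simp add: trunc_def)
  from integral_bounded_linear[OF bounded_linear_vec_nth[of i] this] show ?thesis
    by (simp add: fourier_integral_def ft_def trunc_def)
qed

text \<open>The squared norm is a sum over components, and a finite sum of nonnegative terms tends
  to 0 exactly when each term does. This translates the condition inside \<open>fourier_L2\<close>
  into scalar transforms.\<close>

lemma fourier_L2_limit_iff:
  assumes f: "f \<in> L2_space lborel" and g: "g \<in> L2_space lborel"
  shows "((\<lambda>n::nat. \<integral>\<^sup>+\<xi>. ennreal ((norm
         (fourier_integral (\<lambda>x. indicat_real (ball 0 (real n)) x *\<^sub>R f x) \<xi> - g \<xi>))\<^sup>2) \<partial>lborel) \<longlonglongrightarrow> 0)
     \<longleftrightarrow> (\<forall>i. L2_ft (\<lambda>x. f x $ i) (\<lambda>\<xi>. g \<xi> $ i))"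
proof -
  define u where "u i n = L2_sq lborel (\<lambda>\<xi>. ft (trunc n (\<lambda>x. f x $ i)) \<xi> - g \<xi> $ i)" for i n
  have comp: "(\<lambda>x. f x $ i) \<in> L2_space lborel" "(\<lambda>\<xi>. g \<xi> $ i) \<in> L2_space lborel" for i
    using f g by (auto simp: L2_space_vec_iff)
  then have [measurable]: "(\<lambda>x. f x $ i) \<in> borel_measurable borel" "(\<lambda>\<xi>. g \<xi> $ i) \<in> borel_measurable borel" for i
    by (auto simp: L2_space_iff)
  have nth: "(fourier_integral (\<lambda>x. indicat_real (ball 0 (real n)) x *\<^sub>R f x) \<xi> - g \<xi>) $ i =
      ft (trunc n (\<lambda>x. f x $ i)) \<xi> - g \<xi> $ i" for n \<xi> i
    by (simp add: fourier_integral_truncated_nth[OF f])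
  have meas: "(\<lambda>\<xi>. fourier_integral (\<lambda>x. indicat_real (ball 0 (real n)) x *\<^sub>R f x) \<xi> - g \<xi>) \<in> borel_measurable lborel" for n
    unfolding borel_measurable_vec_iff nth by measurable
  have sum: "(\<integral>\<^sup>+\<xi>. ennreal ((norm (fourier_integral (\<lambda>x. indicat_real (ball 0 (real n)) x *\<^sub>R f x) \<xi> - g \<xi>))\<^sup>2) \<partial>lborel) = (\<Sum>i\<in>UNIV. u i n)" for n
    using L2_sq_vec[OF meas[of n]] unfolding nth u_def[symmetric] by (simp add: L2_sq_def)
  have "(\<lambda>n. \<Sum>i\<in>UNIV. u i n) \<longlonglongrightarrow> 0 \<longleftrightarrow> (\<forall>i. u i \<longlonglongrightarrow> 0)"
  proof
    assume lim: "(\<lambda>n. \<Sum>i\<in>UNIV. u i n) \<longlonglongrightarrow> 0"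
    show "\<forall>i. u i \<longlonglongrightarrow> 0"
      by (intro allI ennreal_limit_0_sandwich[OF lim] member_le_sum) auto
  next
    assume "\<forall>i. u i \<longlonglongrightarrow> 0"
    then have "(\<lambda>n. \<Sum>i\<in>UNIV. u i n) \<longlonglongrightarrow> (\<Sum>i\<in>(UNIV::4 set). 0)"
      by (intro tendsto_sum) auto
    then show "(\<lambda>n. \<Sum>i\<in>UNIV. u i n) \<longlonglongrightarrow> 0" by simp
  qed
  then show ?thesis unfolding sum L2_ft_def u_def using comp by auto
qed

text \<open>Four scalar transforms assemble to a witness, so the choice in \<open>fourier_L2\<close>
  satisfies its specification.\<close>

lemma fourier_L2_spec:
  assumes f: "f \<in> L2_space lborel"
  shows "fourier_L2 f \<in> L2_space lborel" "L2_ft (\<lambda>x. f x $ i) (\<lambda>\<xi>. fourier_L2 f \<xi> $ i)"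
proof -
  have "\<exists>g. L2_ft (\<lambda>x. f x $ i) g" for i
    using f by (auto simp: L2_space_vec_iff intro: L2_ft_exists)
  then obtain g where g: "\<And>i. L2_ft (\<lambda>x. f x $ i) (g i)" by metis
  define G where "G \<xi> = (\<chi> i. g i \<xi>)" for \<xi>
  have G: "G \<in> L2_space lborel" using g by (auto simp: L2_space_vec_iff G_def L2_ft_def)
  have "\<forall>i. L2_ft (\<lambda>x. f x $ i) (\<lambda>\<xi>. G \<xi> $ i)" using g by (simp add: G_def)
  with G have "\<exists>G. G \<in> L2_space lborel \<and>
     (\<lambda>n::nat. \<integral>\<^sup>+\<xi>. ennreal ((norm
         (fourier_integral (\<lambda>x. indicat_real (ball 0 (real n)) x *\<^sub>R f x) \<xi> - G \<xi>))\<^sup>2) \<partial>lborel)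
       \<longlonglongrightarrow> 0"
    by (intro exI[of _ G]) (simp add: fourier_L2_limit_iff[OF f G])
  from someI_ex[OF this, folded fourier_L2_def] f
  show "fourier_L2 f \<in> L2_space lborel" "L2_ft (\<lambda>x. f x $ i) (\<lambda>\<xi>. fourier_L2 f \<xi> $ i)"
    by (auto simp: fourier_L2_limit_iff)
qed

lemma norm_matrix_vector_mult_le:
  fixes M :: "complex^4^4"
  assumes "\<And>i j. norm (M $ i $ j) \<le> b"
  shows "norm ((M *v v) $ i) \<le> 4 * b * norm v"
proof -
  have "norm ((M *v v) $ i) \<le> (\<Sum>j\<in>UNIV. norm (M $ i $ j * v $ j))"
    by (simp add: matrix_vector_mult_def norm_sum)
  also have "\<dots> \<le> (\<Sum>j\<in>(UNIV::4 set). b * norm v)"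
    using assms by (intro sum_mono) (auto simp: norm_mult intro!: mult_mono Finite_Cartesian_Product.norm_nth_le intro: order_trans[OF norm_ge_zero])
  finally show ?thesis by simp
qed

lemma matrix_multiplier_L2:
  fixes M :: "'a \<Rightarrow> complex^4^4"
  assumes meas: "\<And>i j. (\<lambda>\<xi>. M \<xi> $ i $ j) \<in> borel_measurable N"
    and bound: "\<And>\<xi> i j. norm (M \<xi> $ i $ j) \<le> b"
    and F: "F \<in> L2_space N"
  shows "(\<lambda>\<xi>. M \<xi> *v F \<xi>) \<in> L2_space N"
  unfolding L2_space_vec_iff
proof
  fix i
  have [measurable]: "(\<lambda>\<xi>. F \<xi> $ i) \<in> borel_measurable N" for i
    using F by (simp add: L2_space_iff borel_measurable_vec_iff)
  note meas[measurable]
  have "b \<ge> 0" using bound by (meson norm_ge_zero order_trans)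
  have "L2_sq N (\<lambda>\<xi>. (M \<xi> *v F \<xi>) $ i) \<le> L2_sq N (\<lambda>\<xi>. complex_of_real (4 * b * norm (F \<xi>)))"
    using norm_matrix_vector_mult_le[OF bound] \<open>b \<ge> 0\<close>
    by (intro L2_sq_mono_AE) (auto simp: norm_mult)
  also have "\<dots> = ennreal ((norm (complex_of_real (4 * b)))\<^sup>2) * L2_sq N (\<lambda>\<xi>. complex_of_real (norm (F \<xi>)))"
    using F by (subst L2_sq_cmult[symmetric]) (auto simp: L2_space_iff)
  also have "L2_sq N (\<lambda>\<xi>. complex_of_real (norm (F \<xi>))) = L2_sq N F"
    by (rule L2_sq_cong) simp
  also have "ennreal ((norm (complex_of_real (4 * b)))\<^sup>2) * L2_sq N F < \<infinity>"
    using F by (simp add: L2_space_iff ennreal_mult_less_top del: ennreal_power)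
  finally have "L2_sq N (\<lambda>\<xi>. (M \<xi> *v F \<xi>) $ i) < \<infinity>" .
  moreover have "(\<lambda>\<xi>. (M \<xi> *v F \<xi>) $ i) \<in> borel_measurable N"
    unfolding matrix_vector_mult_def by simp measurable
  ultimately show "(\<lambda>\<xi>. (M \<xi> *v F \<xi>) $ i) \<in> L2_space N" by (simp add: L2_space_iff)
qed

text \<open>A bounded symbol keeps the product with the transform in L2, and
  \<open>L2_ft_surj\<close> gives a preimage of each component, so the choice has a witness. The
  equation holds almost everywhere only, because \<open>fourier_L2\<close> is itself a
  choice.\<close>

lemma fourier_multiplier_spec:
  assumes meas: "\<And>i j. (\<lambda>\<xi>. M \<xi> $ i $ j) \<in> borel_measurable borel"
    and bound: "\<And>\<xi> i j. norm (M \<xi> $ i $ j) \<le> b"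
    and f: "f \<in> L2_space lborel"
  shows "fourier_multiplier M f \<in> L2_space lborel"
    and "AE \<xi> in lborel. fourier_L2 (fourier_multiplier M f) \<xi> = M \<xi> *v fourier_L2 f \<xi>"
proof -
  define G where "G \<xi> = M \<xi> *v fourier_L2 f \<xi>" for \<xi>
  have G: "G \<in> L2_space lborel"
    unfolding G_def[abs_def] by (rule matrix_multiplier_L2[OF _ bound fourier_L2_spec(1)[OF f]]) (simp add: meas)
  have "\<exists>h. L2_ft h (\<lambda>\<xi>. G \<xi> $ i)" for i
    using G by (auto simp: L2_space_vec_iff intro: L2_ft_surj)
  then obtain h where h: "\<And>i. L2_ft (h i) (\<lambda>\<xi>. G \<xi> $ i)" by metis
  define H where "H x = (\<chi> i. h i x)" for x
  have H: "H \<in> L2_space lborel" using h by (auto simp: L2_space_vec_iff H_def L2_ft_def)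
  have "AE \<xi> in lborel. \<forall>i. fourier_L2 H \<xi> $ i = G \<xi> $ i"
    unfolding AE_all_countable
  proof
    fix i
    show "AE \<xi> in lborel. fourier_L2 H \<xi> $ i = G \<xi> $ i"
      using L2_ft_unique[OF fourier_L2_spec(2)[OF H, of i]] h[of i] by (simp add: H_def)
  qed
  then have "AE \<xi> in lborel. fourier_L2 H \<xi> = G \<xi>"
    by (simp add: vec_eq_iff)
  with H have "\<exists>h. h \<in> L2_space lborel \<and> (AE \<xi> in lborel. fourier_L2 h \<xi> = M \<xi> *v fourier_L2 f \<xi>)"
    unfolding G_def by blast
  from someI_ex[OF this, folded fourier_multiplier_def]
  show "fourier_multiplier M f \<in> L2_space lborel"
    "AE \<xi> in lborel. fourier_L2 (fourier_multiplier M f) \<xi> = M \<xi> *v fourier_L2 f \<xi>" by auto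
qed

section \<open>Dirac algebra\<close>

lemma vector_4_nth:
  "vector [a, b, c, d] $ (1::4) = a" "vector [a, b, c, d] $ (2::4) = b"
  "vector [a, b, c, d] $ (3::4) = c" "vector [a, b, c, d] $ (4::4) = (d :: 'a::zero)"
  by (simp_all add: vector_def)

lemmas dirac_entries = alpha_def beta_def gamma0_def gamma_def block_matrix_def pauli_def vector_4_nth
  matrix_matrix_mult_def sum_4 mat_def

lemma dirac_symbol_entries:
  "dirac_symbol m \<xi> = vector
    [vector [of_real m, 0, of_real (\<xi>$3), of_real (\<xi>$1) - \<i> * of_real (\<xi>$2)],
     vector [0, of_real m, of_real (\<xi>$1) + \<i> * of_real (\<xi>$2), - of_real (\<xi>$3)],
     vector [of_real (\<xi>$3), of_real (\<xi>$1) - \<i> * of_real (\<xi>$2), - of_real m, 0],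
     vector [of_real (\<xi>$1) + \<i> * of_real (\<xi>$2), - of_real (\<xi>$3), 0, - of_real m]]"
  unfolding vec_eq_iff forall_4 dirac_symbol_def sum_3 vector_add_component vector_scaleR_component
  by (simp add: dirac_entries scaleR_conv_of_real)

text \<open>In the Dirac representation \<open>gamma5\<close> swaps the upper and lower halves of a
  spinor, and \<open>beta\<close> then negates the lower half. Hence each term couples an index in
  {1, 2} with one in {3, 4}, and one of these two sets is \<open>small_index s\<close>.\<close>

lemma bilin_Gamma5:
  "bilin Gamma5 z w = cnj (z$3) * w$1 + cnj (z$4) * w$2 - cnj (z$1) * w$3 - cnj (z$2) * w$4"
  unfolding bilin_def hermitian_inner_def Gamma5_def gamma5_def matrix_vector_mult_def
  by (simp add: dirac_entries)

lemma norm_bilin_Gamma5_sq_le: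
  "(norm (bilin Gamma5 z w))\<^sup>2 \<le> 4 * ((norm (z$3) * norm (w$1))\<^sup>2 + (norm (z$4) * norm (w$2))\<^sup>2
    + (norm (z$1) * norm (w$3))\<^sup>2 + (norm (z$2) * norm (w$4))\<^sup>2)"
proof -
  have sq: "(a + b + c + d)\<^sup>2 \<le> 4 * (a\<^sup>2 + b\<^sup>2 + c\<^sup>2 + d\<^sup>2)" for a b c d :: real
    using sum_squares_bound[of a b] sum_squares_bound[of a c] sum_squares_bound[of a d]
      sum_squares_bound[of b c] sum_squares_bound[of b d] sum_squares_bound[of c d]
    by (simp add: power2_eq_square algebra_simps)
  have "norm (bilin Gamma5 z w) \<le> norm (cnj (z$3) * w$1) + norm (cnj (z$4) * w$2) + norm (cnj (z$1) * w$3) + norm (cnj (z$2) * w$4)"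
    unfolding bilin_Gamma5
    by (intro order_trans[OF norm_triangle_ineq4] order_trans[OF norm_triangle_ineq] add_mono order_refl)
  then have "(norm (bilin Gamma5 z w))\<^sup>2 \<le> (norm (z$3) * norm (w$1) + norm (z$4) * norm (w$2) + norm (z$1) * norm (w$3) + norm (z$2) * norm (w$4))\<^sup>2"
    by (intro power_mono) (auto simp: norm_mult)
  also note sq
  finally show ?thesis .
qed

lemma dispersion_pos: "m > 0 \<Longrightarrow> dispersion m \<xi> > 0"
  by (simp add: dispersion_def add_nonneg_pos)

lemma dispersion_sq: "(dispersion m \<xi>)\<^sup>2 = (norm \<xi>)\<^sup>2 + m\<^sup>2"
  by (simp add: dispersion_def)

lemma norm_le_dispersion: "norm \<xi> \<le> dispersion m \<xi>"
  unfolding dispersion_def by (rule real_le_rsqrt) simp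

lemma dispersion_ge: "0 \<le> m \<Longrightarrow> m \<le> dispersion m \<xi>"
  unfolding dispersion_def by (rule real_le_rsqrt) simp

text \<open>The mixed terms cancel by anticommutation. The eigenvalue equation on the two branches
  rests on this identity.\<close>

lemma dirac_symbol_square:
  "dirac_symbol m \<xi> ** dirac_symbol m \<xi> = mat (complex_of_real ((dispersion m \<xi>)\<^sup>2))"
proof -
  have n: "(norm \<xi>)\<^sup>2 = (\<xi>$1)\<^sup>2 + (\<xi>$2)\<^sup>2 + (\<xi>$3)\<^sup>2"
    by (simp add: norm_vec_def L2_set_def sum_3)
  show ?thesis
    unfolding vec_eq_iff forall_4 dirac_symbol_entries dispersion_sq n
    by (simp add: matrix_matrix_mult_def sum_4 vector_4_nth mat_def algebra_simps power2_eq_square)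
qed

lemma norm_dirac_symbol_entry:
  assumes "m \<ge> 0"
  shows "norm (dirac_symbol m \<xi> $ i $ j) \<le> 2 * dispersion m \<xi>"
proof -
  have c: "\<bar>\<xi> $ k\<bar> \<le> dispersion m \<xi>" for k
    using component_le_norm_cart[of \<xi> k] norm_le_dispersion[of \<xi> m] by linarith
  have "norm (of_real (\<xi>$1) - \<i> * of_real (\<xi>$2)) \<le> \<bar>\<xi>$1\<bar> + \<bar>\<xi>$2\<bar>"
    "norm (of_real (\<xi>$1) + \<i> * of_real (\<xi>$2)) \<le> \<bar>\<xi>$1\<bar> + \<bar>\<xi>$2\<bar>"
    by (rule order_trans[OF norm_triangle_ineq4] order_trans[OF norm_triangle_ineq], simp add: norm_mult)+
  then show ?thesis
    using c[of 1] c[of 2] c[of 3] dispersion_ge[OF assms, of \<xi>] assms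
    unfolding dirac_symbol_entries
    using exhaust_4[of i] exhaust_4[of j] by (auto simp: vector_4_nth)
qed

text \<open>Complex multiples in the form in which \<open>propagator_symbol\<close> writes them;
  \<open>*\<^sub>R\<close> admits real scalars only.\<close>

abbreviation cscale :: "complex \<Rightarrow> complex^4^4 \<Rightarrow> complex^4^4" where
  "cscale c M \<equiv> map_matrix ((*) c) M"

lemma cscale_one: "cscale 1 M = M"
  by (simp add: vec_eq_iff)

lemma cscale_mult: "cscale c M ** cscale d N = cscale (c * d) (M ** N)"
  by (simp add: vec_eq_iff matrix_matrix_mult_def sum_distrib_left ac_simps)

lemma cscale_matrix_mult: "cscale c M ** N = cscale c (M ** N)"
  by (simp add: vec_eq_iff matrix_matrix_mult_def sum_distrib_left ac_simps)

lemma matrix_add_mult_distrib: "((A :: complex^4^4) + B) ** C = A ** C + B ** C"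
  by (simp add: vec_eq_iff matrix_matrix_mult_def distrib_right sum.distrib)

section \<open>Spectral projections and the propagator symbol\<close>

lemma projection_symbol_alt:
  "projection_symbol m s \<xi> = cscale (1/2) (mat 1) + cscale (of_real (s / (2 * dispersion m \<xi>))) (dirac_symbol m \<xi>)"
  unfolding projection_symbol_def vec_eq_iff
  by (simp only: vector_scaleR_component vector_add_component nth_map_matrix)
    (simp add: scaleR_conv_of_real distrib_left)

text \<open>Write H for the symbol and l for the dispersion. From H^2 = l^2 and s^2 = 1 it follows
  that H (1 + s H / l) = H + s l = s l (1 + s H / l).\<close>

lemma dirac_symbol_projection:
  assumes m: "m > 0" and s: "s \<in> {1, -1}"
  shows "dirac_symbol m \<xi> ** projection_symbol m s \<xi> = cscale (of_real (s * dispersion m \<xi>)) (projection_symbol m s \<xi>)"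
proof -
  define l where "l = dispersion m \<xi>"
  have l: "l > 0" using dispersion_pos[OF m] by (simp add: l_def)
  have "dirac_symbol m \<xi> ** projection_symbol m s \<xi> =
      cscale (1/2) (dirac_symbol m \<xi>) + cscale (of_real (s / (2 * l))) (dirac_symbol m \<xi> ** dirac_symbol m \<xi>)"
    unfolding projection_symbol_alt l_def[symmetric] matrix_add_ldistrib
    using cscale_mult[of 1 "dirac_symbol m \<xi>" "1/2" "mat 1"] cscale_mult[of 1 "dirac_symbol m \<xi>" "of_real (s / (2 * l))" "dirac_symbol m \<xi>"]
    by (simp add: map_matrix_def matrix_mul_rid)
  also have "\<dots> = cscale (of_real (s * l)) (projection_symbol m s \<xi>)"
    unfolding dirac_symbol_square projection_symbol_alt l_def[symmetric]
    using l s by (auto simp: vec_eq_iff mat_def field_simps power2_eq_square)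
  finally show ?thesis by (simp add: l_def)
qed

lemma projection_symbol_sum: "projection_symbol m 1 \<xi> + projection_symbol m (-1) \<xi> = mat 1"
  unfolding projection_symbol_alt by (simp add: vec_eq_iff mat_def)

lemma projection_symbol_mult:
  assumes m: "m > 0" and s: "s \<in> {1, -1}" and r: "r \<in> {1, -1}"
  shows "projection_symbol m r \<xi> ** projection_symbol m s \<xi> = (if r = s then projection_symbol m s \<xi> else 0)"
proof -
  define l where "l = dispersion m \<xi>"
  have l: "l > 0" using dispersion_pos[OF m] by (simp add: l_def)
  have "projection_symbol m r \<xi> ** projection_symbol m s \<xi> =
      cscale (1/2) (projection_symbol m s \<xi>) + cscale (of_real (r / (2 * l))) (dirac_symbol m \<xi> ** projection_symbol m s \<xi>)"
    by (subst projection_symbol_alt) (simp add: matrix_add_mult_distrib cscale_matrix_mult matrix_mul_lid l_def)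
  also have "\<dots> = (if r = s then projection_symbol m s \<xi> else 0)"
    unfolding dirac_symbol_projection[OF m s] l_def[symmetric]
    using l s r by (auto simp: vec_eq_iff)
  finally show ?thesis .
qed

text \<open>The identity is the sum of the two projections, and the exponent acts on each as a
  scalar. Every term of the matrix series is therefore a combination of the two projections, and two
  scalar exponential series remain.\<close>

lemma propagator_symbol_eq:
  assumes m: "m > 0"
  shows "propagator_symbol m t \<xi> = cscale (cis (- (t * dispersion m \<xi>))) (projection_symbol m 1 \<xi>)
    + cscale (cis (t * dispersion m \<xi>)) (projection_symbol m (-1) \<xi>)"
proof -
  define l where "l = dispersion m \<xi>"
  define P where "P s = projection_symbol m s \<xi>" for s
  define A where "A = cscale (- \<i> * complex_of_real t) (dirac_symbol m \<xi>)"
  define z where "z = \<i> * complex_of_real (t * l)"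
  have AP: "A ** cscale c (P s) = cscale (c * (- of_real s * z)) (P s)" if "s \<in> {1, -1}" for c s
    unfolding A_def cscale_mult P_def dirac_symbol_projection[OF m that] l_def[symmetric] z_def
    by (simp add: vec_eq_iff ac_simps)
  have pow: "((**) A ^^ n) (mat 1) = cscale ((- z) ^ n) (P 1) + cscale (z ^ n) (P (-1))" for n
  proof (induction n)
    case 0
    have "mat 1 = cscale 1 (P 1) + cscale 1 (P (-1))"
      unfolding cscale_one using projection_symbol_sum[of m \<xi>] by (simp add: P_def)
    then show ?case by (simp only: funpow.simps id_apply power_0)
  next
    case (Suc n)
    have e: "(- z) ^ n * (- complex_of_real 1 * z) = (- z) ^ Suc n" "z ^ n * (- complex_of_real (- 1) * z) = z ^ Suc n"
      by simp_all
    have "((**) A ^^ Suc n) (mat 1) = A ** cscale ((- z) ^ n) (P 1) + A ** cscale (z ^ n) (P (- 1))"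
      by (simp only: funpow.simps comp_apply Suc.IH matrix_add_ldistrib)
    then show ?case
      unfolding AP[OF insertI1, of "(- z) ^ n", unfolded e(1)] AP[OF insertI2[OF singletonI], of "z ^ n", unfolded e(2)] .
  qed
  \<comment> \<open>Linearity in the scalar carries the convergence of the two exponential series
    over to matrices.\<close>
  have lin: "bounded_linear (\<lambda>c. cscale c M)" for M
    by (rule linear_conv_bounded_linear[THEN iffD1]) (auto intro!: linearI simp: vec_eq_iff distrib_right)
  have "(\<lambda>n. cscale ((- z) ^ n /\<^sub>R fact n) (P 1) + cscale (z ^ n /\<^sub>R fact n) (P (-1))) sums
      (cscale (exp (- z)) (P 1) + cscale (exp z) (P (-1)))"
    by (intro sums_add bounded_linear.sums[OF lin] exp_converges)
  moreover have "cscale ((- z) ^ n /\<^sub>R fact n) (P 1) + cscale (z ^ n /\<^sub>R fact n) (P (-1)) = (1 / fact n) *\<^sub>R ((**) A ^^ n) (mat 1)" for n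
    unfolding pow vec_eq_iff
    by (simp only: vector_add_component nth_map_matrix vector_scaleR_component)
      (simp add: scaleR_conv_of_real field_simps)
  ultimately have "matrix_exp A = cscale (exp (- z)) (P 1) + cscale (exp z) (P (-1))"
    unfolding matrix_exp_def by (simp add: sums_iff)
  then show ?thesis
    by (simp add: propagator_symbol_def A_def z_def P_def l_def cis_conv_exp)
qed

lemma cscale_vector_mult: "cscale c M *v v = c *s (M *v v)"
  by (simp add: vec_eq_iff matrix_vector_mult_def sum_distrib_left ac_simps)

text \<open>Orthogonality of the projections leaves a single phase. It has modulus 1, so the
  evolution changes no modulus of a Fourier coefficient.\<close>

lemma propagator_symbol_on_branch:
  assumes m: "m > 0" and s: "s \<in> {1, -1}"
  shows "propagator_symbol m t \<xi> *v (projection_symbol m s \<xi> *v v) = cis (- (t * s * dispersion m \<xi>)) *s (projection_symbol m s \<xi> *v v)"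
proof -
  have z: "cscale c 0 = 0" for c by (simp add: vec_eq_iff)
  show ?thesis
    using s unfolding propagator_symbol_eq[OF m] matrix_vector_mul_assoc matrix_add_mult_distrib cscale_matrix_mult
    by (auto simp: projection_symbol_mult[OF m] z cscale_vector_mult)
qed

text \<open>Crude: this bound only makes the symbol a bounded multiplier and does not enter the
  final constant.\<close>

lemma norm_projection_symbol_entry:
  assumes m: "m > 0" and s: "s \<in> {1, -1}"
  shows "norm (projection_symbol m s \<xi> $ i $ j) \<le> 2"
proof -
  define l where "l = dispersion m \<xi>"
  have l: "l > 0" using dispersion_pos[OF m] by (simp add: l_def)
  have "norm (projection_symbol m s \<xi> $ i $ j) \<le> norm ((1/2) * (mat 1 :: complex^4^4) $ i $ j) + norm (of_real (s / (2 * l)) * dirac_symbol m \<xi> $ i $ j)"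
    unfolding projection_symbol_alt l_def[symmetric] vector_add_component nth_map_matrix by (rule norm_triangle_ineq)
  also have "norm ((1/2) * (mat 1 :: complex^4^4) $ i $ j) \<le> 1"
    by (simp add: mat_def)
  also have "norm (of_real (s / (2 * l)) * dirac_symbol m \<xi> $ i $ j) \<le> 1 / (2 * l) * (2 * l)"
    unfolding norm_mult norm_of_real using s l norm_dirac_symbol_entry[of m \<xi> i j] m
    by (intro mult_mono) (auto simp: l_def)
  also have "1 / (2 * l) * (2 * l) = 1" using l by simp
  finally show ?thesis by simp
qed

lemma norm_propagator_symbol_entry:
  assumes m: "m > 0"
  shows "norm (propagator_symbol m t \<xi> $ i $ j) \<le> 4"
proof -
  have "norm (propagator_symbol m t \<xi> $ i $ j) \<le> norm (cis (- (t * dispersion m \<xi>)) * projection_symbol m 1 \<xi> $ i $ j)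
      + norm (cis (t * dispersion m \<xi>) * projection_symbol m (-1) \<xi> $ i $ j)"
    unfolding propagator_symbol_eq[OF m] by (simp add: norm_triangle_ineq)
  also have "\<dots> \<le> 2 + 2"
    unfolding norm_mult norm_cis mult_1_left by (intro add_mono norm_projection_symbol_entry m) auto
  finally show ?thesis by simp
qed

text \<open>At zero frequency the symbol is m * \<open>beta\<close>, whose eigenvectors for m and -m
  live in the upper and the lower half respectively; the other half is the small one.\<close>

definition small_index :: "real \<Rightarrow> 4 set" where
  "small_index s = (if s = 1 then {3, 4} else {1, 2})"

text \<open>On the branch \<open>s\<close> the eigenvalue equation expresses the small components through the large
  ones, with the denominator \<open>\<lambda> + m\<close>.\<close>

lemma small_component_bound:
  assumes m: "m > 0" and s: "s \<in> {1, -1}" and i: "i \<in> small_index s"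
  shows "norm ((projection_symbol m s \<xi> *v v) $ i) \<le> 3 * norm \<xi> / m * norm (projection_symbol m s \<xi> *v v)"
proof -
  define l where "l = dispersion m \<xi>"
  have l: "l > 0" using dispersion_pos[OF m] by (simp add: l_def)
  define w where "w = projection_symbol m s \<xi> *v v"
  have ev: "dirac_symbol m \<xi> *v w = of_real (s * l) *s w"
    unfolding w_def matrix_vector_mul_assoc dirac_symbol_projection[OF m s] cscale_vector_mult l_def ..
  \<comment> \<open>The denominator \<open>l + m\<close> is bounded below by \<open>m\<close>. The 3
    is 1 + 2, for the coefficients \<xi>_3 and \<xi>_1 \<plusminus> i \<xi>_2 of a row.\<close>
  have key: "norm x \<le> 3 * norm \<xi> / m * norm w"
    if eq: "of_real (l + m) * x = a * w $ j + b * w $ k" and ab: "norm a \<le> norm \<xi>" "norm b \<le> 2 * norm \<xi>" for x a b j k and w :: "complex^4"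
  proof -
    have "m * norm x \<le> norm (of_real (l + m) * x)"
      using l m unfolding norm_mult norm_of_real by (intro mult_right_mono) auto
    also have "\<dots> \<le> norm a * norm (w $ j) + norm b * norm (w $ k)"
      unfolding eq using norm_triangle_ineq[of "a * w $ j" "b * w $ k"] by (simp add: norm_mult)
    also have "\<dots> \<le> norm \<xi> * norm w + (2 * norm \<xi>) * norm w"
      using ab by (intro add_mono mult_mono Finite_Cartesian_Product.norm_nth_le) auto
    finally show ?thesis using m by (simp add: field_simps)
  qed
  have c: "\<bar>\<xi> $ k\<bar> \<le> norm \<xi>" for k by (rule component_le_norm_cart)
  have n: "norm (of_real (\<xi>$1) - \<i> * of_real (\<xi>$2)) \<le> 2 * norm \<xi>"
    "norm (of_real (\<xi>$1) + \<i> * of_real (\<xi>$2)) \<le> 2 * norm \<xi>"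
    by (rule order_trans[OF norm_triangle_ineq4] order_trans[OF norm_triangle_ineq],
        use c[of 1] c[of 2] in \<open>simp add: norm_mult\<close>)+
  have comp: "(dirac_symbol m \<xi> *v w) $ k = of_real (s * l) * w $ k" for k
    unfolding ev by simp
  note comps = comp[of 1] comp[of 2] comp[of 3] comp[of 4]
  note comps = comps[unfolded matrix_vector_mult_def dirac_symbol_entries, simplified, unfolded sum_4 vector_4_nth]
  show ?thesis unfolding w_def[symmetric]
  proof (cases "s = 1")
    case True
    have "of_real (l + m) * w $ 3 = of_real (\<xi>$3) * w $ 1 + (of_real (\<xi>$1) - \<i> * of_real (\<xi>$2)) * w $ 2"
      using comps(3) True by (simp add: algebra_simps)
    from key[OF this _ n(1)] c[of 3] have 3: "norm (w $ 3) \<le> 3 * norm \<xi> / m * norm w" by simp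
    have "of_real (l + m) * w $ 4 = (- of_real (\<xi>$3)) * w $ 2 + (of_real (\<xi>$1) + \<i> * of_real (\<xi>$2)) * w $ 1"
      using comps(4) True by (simp add: algebra_simps)
    from key[OF this _ n(2)] c[of 3] have "norm (w $ 4) \<le> 3 * norm \<xi> / m * norm w" by simp
    with 3 show "norm (w $ i) \<le> 3 * norm \<xi> / m * norm w"
      using i True by (auto simp: small_index_def)
  next
    case False
    then have s: "s = -1" using s by auto
    \<comment> \<open>On the negative branch the eigenvalue is \<open>- l\<close>, so that the
      off-diagonal terms change sign; \<open>key\<close> is applied to \<open>- w\<close>, which has
      the same norm.\<close>
    have "of_real (l + m) * w $ 1 = of_real (\<xi>$3) * (- w) $ 3 + (of_real (\<xi>$1) - \<i> * of_real (\<xi>$2)) * (- w) $ 4"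
      using comps(1) s by (simp add: algebra_simps)
    from key[OF this _ n(1)] c[of 3] have 1: "norm (w $ 1) \<le> 3 * norm \<xi> / m * norm w" by simp
    have "of_real (l + m) * w $ 2 = (- of_real (\<xi>$3)) * (- w) $ 4 + (of_real (\<xi>$1) + \<i> * of_real (\<xi>$2)) * (- w) $ 3"
      using comps(2) s by (simp add: algebra_simps)
    from key[OF this _ n(2)] c[of 3] have "norm (w $ 2) \<le> 3 * norm \<xi> / m * norm w" by simp
    with 1 show "norm (w $ i) \<le> 3 * norm \<xi> / m * norm w"
      using i s by (auto simp: small_index_def)
  qed
qed

section \<open>The waves\<close>

lemma real_vec_nth_measurable [measurable]: "(\<lambda>\<xi>::real^'n. \<xi> $ k) \<in> borel_measurable borel"
  by (intro borel_measurable_continuous_onI continuous_intros)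

lemma dispersion_measurable [measurable]: "dispersion m \<in> borel_measurable borel"
  unfolding dispersion_def by measurable

lemma dirac_symbol_measurable: "(\<lambda>\<xi>. dirac_symbol m \<xi> $ i $ j) \<in> borel_measurable borel"
proof -
  have "\<forall>i j. (\<lambda>\<xi>. dirac_symbol m \<xi> $ i $ j) \<in> borel_measurable borel"
    unfolding dirac_symbol_entries forall_4 vector_4_nth by simp
  then show ?thesis by blast
qed

lemma projection_symbol_measurable: "(\<lambda>\<xi>. projection_symbol m s \<xi> $ i $ j) \<in> borel_measurable borel"
proof -
  note dirac_symbol_measurable[measurable]
  show ?thesis unfolding projection_symbol_alt vector_add_component nth_map_matrix by measurable
qed

lemma propagator_symbol_measurable:
  assumes "m > 0"
  shows "(\<lambda>\<xi>. propagator_symbol m t \<xi> $ i $ j) \<in> borel_measurable borel"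
proof -
  note projection_symbol_measurable[measurable]
  show ?thesis unfolding propagator_symbol_eq[OF assms] vector_add_component nth_map_matrix by measurable
qed

lemma mat_vector_mult: "mat c *v v = c *s (v :: complex^4)"
  by (simp add: vec_eq_iff matrix_vector_mult_def mat_def if_distrib[of "\<lambda>a. a * _"] cong: if_cong)

lemma cutoff_facts:
  assumes "cutoff c\<^sub>0 C\<^sub>0 \<rho>"
  shows "\<rho> \<in> borel_measurable borel" "\<bar>\<rho> \<xi>\<bar> \<le> 1" "C\<^sub>0 < norm \<xi> \<Longrightarrow> \<rho> \<xi> = 0"
proof -
  have "C_k 0 \<rho>" using assms unfolding cutoff_def by blast
  then show "\<rho> \<in> borel_measurable borel" by (simp add: borel_measurable_continuous_onI)
  show "\<bar>\<rho> \<xi>\<bar> \<le> 1" using assms by (simp add: cutoff_def)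
  show "\<rho> \<xi> = 0" if "C\<^sub>0 < norm \<xi>"
  proof (rule ccontr)
    assume "\<rho> \<xi> \<noteq> 0"
    then have "\<xi> \<in> closure {\<xi>. \<rho> \<xi> \<noteq> 0}" using closure_subset[of "{\<xi>. \<rho> \<xi> \<noteq> 0}"] by blast
    also have "\<dots> \<subseteq> {\<xi>. c\<^sub>0 \<le> norm \<xi> \<and> norm \<xi> \<le> C\<^sub>0}" using assms unfolding cutoff_def by blast
    finally show False using that by simp
  qed
qed

text \<open>\<open>G\<close> is the transform of the projected initial datum. It carries all that is
  needed later: its support gives Bernstein's inequality, its small components the gain, and time
  enters as a phase. The proof also shows that the choice in \<open>dirac_wave\<close> has a
  witness.\<close>

lemma dirac_wave_structure:
  assumes cut: "cutoff c\<^sub>0 C\<^sub>0 \<rho>" and m: "m > 0" and K: "K > 0" and s: "s \<in> {1, -1}"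
    and f: "f \<in> L2_space lborel"
  defines "\<Phi> \<equiv> dirac_wave \<rho> m K s f"
  obtains G where "G \<in> L2_space lborel" "\<And>\<xi>. C\<^sub>0 * K < norm \<xi> \<Longrightarrow> G \<xi> = 0"
    "\<And>\<xi> i. i \<in> small_index s \<Longrightarrow> norm (G \<xi> $ i) \<le> 3 * norm \<xi> / m * norm (G \<xi>)"
    "\<Phi> \<in> borel_measurable borel"
    "\<And>t i. AE x in lborel. \<Phi> (t, x) $ i = ift (\<lambda>\<xi>. cis (- (t * s * dispersion m \<xi>)) * G \<xi> $ i) x / (2 * pi) ^ 3"
    "\<And>i. L2_ft (\<lambda>x. \<Phi> (0, x) $ i) (\<lambda>\<xi>. G \<xi> $ i)"
proof -
  note cut = cutoff_facts[OF cut]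
  note cut(1)[measurable]
  define f1 where "f1 = spectral_projection m s f"
  define f2 where "f2 = freq_projection \<rho> K f1"
  define u where "u t = propagator m t f2" for t
  \<comment> \<open>The scalar cutoff commutes with the projection. With the projection outermost,
    \<open>propagator_symbol_on_branch\<close> and \<open>small_component_bound\<close> apply to
    \<open>G\<close>.\<close>
  define G where "G \<xi> = projection_symbol m s \<xi> *v (complex_of_real (\<rho> (\<xi> /\<^sub>R K)) *s fourier_L2 f \<xi>)" for \<xi>
  have f1: "f1 \<in> L2_space lborel" "AE \<xi> in lborel. fourier_L2 f1 \<xi> = projection_symbol m s \<xi> *v fourier_L2 f \<xi>"
    unfolding f1_def spectral_projection_def
    by (rule fourier_multiplier_spec[OF projection_symbol_measurable norm_projection_symbol_entry[OF m s] f])+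
  have mat_measurable: "(\<lambda>\<xi>. (mat (complex_of_real (\<rho> (\<xi> /\<^sub>R K))) :: complex^4^4) $ i $ j) \<in> borel_measurable borel" for i j
    by (cases "i = j") (simp_all add: mat_def)
  have mat_bound: "norm ((mat (complex_of_real (\<rho> (\<xi> /\<^sub>R K))) :: complex^4^4) $ i $ j) \<le> 1" for \<xi> i j
    using cut(2) by (simp add: mat_def)
  have f2: "f2 \<in> L2_space lborel"
    "AE \<xi> in lborel. fourier_L2 f2 \<xi> = mat (complex_of_real (\<rho> (\<xi> /\<^sub>R K))) *v fourier_L2 f1 \<xi>"
    unfolding f2_def freq_projection_def by (rule fourier_multiplier_spec[OF mat_measurable mat_bound f1(1)])+
  have f2G: "AE \<xi> in lborel. fourier_L2 f2 \<xi> = G \<xi>"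
    using f1(2) f2(2)
    by eventually_elim (simp only: G_def mat_vector_mult vector_scalar_commute)
  have G: "G \<in> L2_space lborel"
    unfolding G_def[abs_def]
  proof (rule matrix_multiplier_L2[OF _ norm_projection_symbol_entry[OF m s]])
    have F: "fourier_L2 f \<in> L2_space lborel" by (rule fourier_L2_spec(1)[OF f])
    then have [measurable]: "(\<lambda>\<xi>. fourier_L2 f \<xi> $ i) \<in> borel_measurable borel" for i
      by (simp add: L2_space_iff borel_measurable_vec_iff)
    have "L2_sq lborel (\<lambda>\<xi>. complex_of_real (\<rho> (\<xi> /\<^sub>R K)) * fourier_L2 f \<xi> $ i) \<le> L2_sq lborel (\<lambda>\<xi>. fourier_L2 f \<xi> $ i)" for i
      using cut(2) by (intro L2_sq_mono_AE) (auto simp: norm_mult intro!: mult_left_le_one_le)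
    then have "(\<lambda>\<xi>. complex_of_real (\<rho> (\<xi> /\<^sub>R K)) * fourier_L2 f \<xi> $ i) \<in> L2_space lborel" for i
      using F order.strict_trans1 by (fastforce simp: L2_space_vec_iff L2_space_iff)
    then show "(\<lambda>\<xi>. complex_of_real (\<rho> (\<xi> /\<^sub>R K)) *s fourier_L2 f \<xi>) \<in> L2_space lborel"
      by (simp add: L2_space_vec_iff)
  qed (simp add: projection_symbol_measurable)
  have [measurable]: "(\<lambda>\<xi>. G \<xi> $ i) \<in> borel_measurable borel" for i
    using G by (simp add: L2_space_iff borel_measurable_vec_iff)
  have supp: "G \<xi> = 0" if "C\<^sub>0 * K < norm \<xi>" for \<xi>
  proof -
    have "C\<^sub>0 < norm (\<xi> /\<^sub>R K)" using that K by (simp add: field_simps)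
    then have "\<rho> (\<xi> /\<^sub>R K) = 0" by (rule cut(3))
    then show ?thesis by (simp add: G_def vec_eq_iff matrix_vector_mult_def)
  qed
  define g where "g t i \<xi> = cis (- (t * s * dispersion m \<xi>)) * G \<xi> $ i" for t i \<xi>
  have [measurable]: "g t i \<in> borel_measurable borel" for t i unfolding g_def by measurable
  have u: "u t \<in> L2_space lborel" "AE \<xi> in lborel. fourier_L2 (u t) \<xi> = propagator_symbol m t \<xi> *v fourier_L2 f2 \<xi>" for t
    unfolding u_def propagator_def
    by (rule fourier_multiplier_spec[OF propagator_symbol_measurable[OF m] norm_propagator_symbol_entry[OF m] f2(1)])+
  have L2u: "L2_ft (\<lambda>x. u t x $ i) (g t i)" for t i
  proof (rule L2_ft_cong_AE[OF fourier_L2_spec(2)[OF u(1)]])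
    show "AE \<xi> in lborel. fourier_L2 (u t) \<xi> $ i = g t i \<xi>"
      using u(2)[of t] f2G
    proof eventually_elim
      case (elim \<xi>)
      have "fourier_L2 (u t) \<xi> = cis (- (t * s * dispersion m \<xi>)) *s G \<xi>"
        unfolding elim unfolding G_def by (rule propagator_symbol_on_branch[OF m s])
      then show ?case by (simp add: g_def)
    qed
    show "(\<lambda>x. u t x $ i) \<in> borel_measurable borel"
      using u(1)[of t] by (simp add: L2_space_iff borel_measurable_vec_iff)
  qed auto
  have u_eq: "AE x in lborel. u t x $ i = ift (g t i) x / (2 * pi) ^ 3" for t i
  proof -
    \<comment> \<open>The 1 bridges a strict and a non-strict inequality: \<open>supp\<close> needs
      norms strictly above the radius, \<open>L2_ft_inverse_integral\<close> asks for vanishing from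
      its radius on.\<close>
    have "g t i \<xi> = 0" if "C\<^sub>0 * K + 1 \<le> norm \<xi>" for \<xi>
      using supp[of \<xi>] that by (simp add: g_def)
    from L2_ft_inverse_integral[OF L2u this] show ?thesis by simp
  qed
  \<comment> \<open>The witness for \<open>dirac_wave\<close>: an integral with a jointly measurable
    parameter dependence, equal to the chosen propagator almost everywhere at each time.\<close>
  define W :: "real \<times> (real^3) \<Rightarrow> complex^4"
    where "W p = (\<chi> i. (\<integral>\<xi>. cis (\<xi> \<bullet> snd p) * (cis (- (fst p * s * dispersion m \<xi>)) * G \<xi> $ i) \<partial>lborel) / (2 * pi) ^ 3)" for p
  have "(\<lambda>p. W p $ i) \<in> borel_measurable borel" for i
    unfolding W_def vec_lambda_beta borel_prod[symmetric] by measurable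
  then have "W \<in> borel_measurable lborel" by (simp add: borel_measurable_vec_iff)
  moreover have "AE x in lborel. W (t, x) = u t x" for t
  proof -
    have "AE x in lborel. \<forall>i. u t x $ i = ift (g t i) x / (2 * pi) ^ 3"
      unfolding AE_all_countable using u_eq by blast
    then show ?thesis
      by eventually_elim (simp add: vec_eq_iff W_def ift_def g_def)
  qed
  ultimately have "\<exists>\<Phi>. \<Phi> \<in> borel_measurable lborel \<and>
     (\<forall>t. AE x in lborel. \<Phi> (t, x) = propagator m t (freq_projection \<rho> K (spectral_projection m s f)) x)"
    unfolding u_def f2_def f1_def by blast
  from someI_ex[OF this] have \<Phi>: "\<Phi> \<in> borel_measurable borel" "\<And>t. AE x in lborel. \<Phi> (t, x) = u t x"
    unfolding \<Phi>_def dirac_wave_def u_def f2_def f1_def by auto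
  show ?thesis
  proof (rule that[OF G supp _ \<Phi>(1)])
    show "norm (G \<xi> $ i) \<le> 3 * norm \<xi> / m * norm (G \<xi>)" if "i \<in> small_index s" for \<xi> i
      unfolding G_def by (rule small_component_bound[OF m s that])
    show "AE x in lborel. \<Phi> (t, x) $ i = ift (\<lambda>\<xi>. cis (- (t * s * dispersion m \<xi>)) * G \<xi> $ i) x / (2 * pi) ^ 3" for t i
      using \<Phi>(2)[of t] u_eq[of t i] by eventually_elim (simp add: g_def[abs_def])
    show "L2_ft (\<lambda>x. \<Phi> (0, x) $ i) (\<lambda>\<xi>. G \<xi> $ i)" for i
    proof (rule L2_ft_cong_AE[OF L2u[of 0 i]])
      show "AE x in lborel. u 0 x $ i = \<Phi> (0, x) $ i" using \<Phi>(2)[of 0] by eventually_elim simp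
      show "AE \<xi> in lborel. g 0 i \<xi> = G \<xi> $ i" by (simp add: g_def)
      have "(\<lambda>x. \<Phi> (0, x)) \<in> borel_measurable borel"
        using \<Phi>(1) by (rule measurable_compose[rotated]) (intro borel_measurable_continuous_onI continuous_intros)
      then show "(\<lambda>x. \<Phi> (0, x) $ i) \<in> borel_measurable borel" by (simp add: borel_measurable_vec_iff)
    qed measurable
  qed
qed

text \<open>Bernstein's inequality from L2 to the supremum: Cauchy-Schwarz on the ball that contains
  the support. For radius \<open>C\<^sub>0 * K\<close> in dimension 3 the volume contributes
  K^3.\<close>

lemma ift_sup_bound:
  fixes g :: "'a::euclidean_space \<Rightarrow> complex"
  assumes g: "g \<in> L2_space lborel" and supp: "\<And>\<xi>. R < norm \<xi> \<Longrightarrow> g \<xi> = 0"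
  shows "integrable lborel g"
    and "ennreal ((norm (ift g x))\<^sup>2) \<le> emeasure lborel (cball (0::'a) R) * L2_sq lborel g"
proof -
  have ind: "indicat_real (cball 0 R) \<xi> *\<^sub>R g \<xi> = g \<xi>" for \<xi>
    using supp[of \<xi>] by (auto simp: indicator_def)
  have fin: "emeasure lborel (cball (0::'a) R) < \<infinity>"
    by (rule emeasure_bounded_finite) simp
  note fs = integrable_of_L2_finite_support[OF g _ fin, unfolded ind]
  show int: "integrable lborel g" by (rule fs) simp
  have "ennreal (norm (ift g x)) \<le> (\<integral>\<^sup>+\<xi>. ennreal (norm (cis (\<xi> \<bullet> x) * g \<xi>)) \<partial>lborel)"
    unfolding ift_def by (rule norm_integral_le_nn_integral)
  also have "\<dots> = (\<integral>\<^sup>+\<xi>. ennreal (norm (g \<xi>)) \<partial>lborel)"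
    by (simp add: norm_mult)
  finally have "(ennreal (norm (ift g x)))\<^sup>2 \<le> (\<integral>\<^sup>+\<xi>. ennreal (norm (g \<xi>)) \<partial>lborel)\<^sup>2"
    by (rule power_mono) simp
  also have "\<dots> \<le> emeasure lborel (cball (0::'a) R) * L2_sq lborel g"
    by (rule fs) simp
  finally show "ennreal ((norm (ift g x))\<^sup>2) \<le> emeasure lborel (cball (0::'a) R) * L2_sq lborel g"
    by (simp add: ennreal_power)
qed

lemma ennreal_mult_collect: "0 \<le> a \<Longrightarrow> 0 \<le> b \<Longrightarrow> ennreal a * (ennreal b * X) = ennreal (a * b) * X"
  by (simp add: ennreal_mult mult.assoc)

text \<open>Put p = (2 pi)^3. Returning from \<open>G\<close> to the wave costs 1/p^2 on squares,
  and \<open>L2_ft_bound\<close> costs 2 p. With the volume v of the ball the third bound has the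
  constant 2 v / p. The fourth gains p from Plancherel's bound, which leaves 2 (3 C_0 K / m)^2,
  whence the 18.\<close>

lemma dirac_wave_bounds:
  assumes cut: "cutoff c\<^sub>0 C\<^sub>0 \<rho>" and C0: "C\<^sub>0 > 0" and m: "m > 0" and K: "K > 0" and s: "s \<in> {1, -1}"
    and f: "f \<in> L2_space lborel"
  defines "\<Phi> \<equiv> dirac_wave \<rho> m K s f"
  shows "\<Phi> \<in> borel_measurable borel"
    and "(\<lambda>x. \<Phi> (0, x)) \<in> L2_space lborel"
    and "AE x in lborel. ennreal ((norm (\<Phi> (t, x) $ i))\<^sup>2) \<le>
      ennreal (2 * unit_ball_vol 3 * C\<^sub>0 ^ 3 / (2 * pi) ^ 3 * K ^ 3) * L2_sq lborel (\<lambda>x. \<Phi> (0, x))"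
    and "i \<in> small_index s \<Longrightarrow> L2_sq lborel (\<lambda>x. \<Phi> (t, x) $ i) \<le>
      ennreal (18 * C\<^sub>0\<^sup>2 * (K / m)\<^sup>2) * L2_sq lborel (\<lambda>x. \<Phi> (0, x))"
proof -
  obtain G where G: "G \<in> L2_space lborel" and supp: "\<And>\<xi>. C\<^sub>0 * K < norm \<xi> \<Longrightarrow> G \<xi> = 0"
    and small: "\<And>\<xi> i. i \<in> small_index s \<Longrightarrow> norm (G \<xi> $ i) \<le> 3 * norm \<xi> / m * norm (G \<xi>)"
    and meas: "\<Phi> \<in> borel_measurable borel"
    and rep: "\<And>t i. AE x in lborel. \<Phi> (t, x) $ i = ift (\<lambda>\<xi>. cis (- (t * s * dispersion m \<xi>)) * G \<xi> $ i) x / (2 * pi) ^ 3"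
    and ft0: "\<And>i. L2_ft (\<lambda>x. \<Phi> (0, x) $ i) (\<lambda>\<xi>. G \<xi> $ i)"
    using dirac_wave_structure[OF cut m K s f] unfolding \<Phi>_def by blast
  show "\<Phi> \<in> borel_measurable borel" by (rule meas)
  show \<Phi>0: "(\<lambda>x. \<Phi> (0, x)) \<in> L2_space lborel"
    using ft0 by (simp add: L2_space_vec_iff L2_ft_def)
  have [measurable]: "(\<lambda>\<xi>. G \<xi> $ i) \<in> borel_measurable borel" for i
    using G by (simp add: L2_space_iff borel_measurable_vec_iff)
  have [measurable]: "G \<in> borel_measurable borel" using G by (simp add: L2_space_iff)
  define p where "p = (2 * pi) ^ 3"
  have p: "p > 0" by (simp add: p_def)
  have dim: "DIM(real^3) = 3" by simp
  define A where "A = L2_sq lborel (\<lambda>x. \<Phi> (0, x))"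
  have Gi: "L2_sq lborel (\<lambda>\<xi>. G \<xi> $ i) \<le> ennreal (2 * p) * L2_sq lborel (\<lambda>x. \<Phi> (0, x) $ i)" for i
    using L2_ft_bound[OF ft0[of i], unfolded dim, folded p_def] p by (simp add: ennreal_mult' mult.assoc)
  have GA: "L2_sq lborel G \<le> ennreal (2 * p) * A"
  proof -
    have "L2_sq lborel G = (\<Sum>i\<in>UNIV. L2_sq lborel (\<lambda>\<xi>. G \<xi> $ i))"
      using G by (intro L2_sq_vec) (simp add: L2_space_iff)
    also have "\<dots> \<le> (\<Sum>i\<in>UNIV. ennreal (2 * p) * L2_sq lborel (\<lambda>x. \<Phi> (0, x) $ i))"
      by (intro sum_mono Gi)
    also have "\<dots> = ennreal (2 * p) * A"
      unfolding A_def using \<Phi>0 by (subst L2_sq_vec) (simp_all add: L2_space_iff sum_distrib_left)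
    finally show ?thesis .
  qed
  \<comment> \<open>The phase leaves every modulus unchanged, so the bounds on \<open>g\<close> do
    not depend on \<open>t\<close>.\<close>
  define g where "g \<xi> = cis (- (t * s * dispersion m \<xi>)) * G \<xi> $ i" for \<xi>
  have [measurable]: "g \<in> borel_measurable borel" unfolding g_def by measurable
  have g_eq: "L2_sq lborel g = L2_sq lborel (\<lambda>\<xi>. G \<xi> $ i)"
    by (rule L2_sq_cong) (simp add: g_def norm_mult)
  have gL2: "g \<in> L2_space lborel"
  proof -
    have "(\<lambda>\<xi>. G \<xi> $ i) \<in> L2_space lborel" using G by (simp add: L2_space_vec_iff)
    then show ?thesis by (simp add: L2_space_iff g_eq)
  qed
  have g_supp: "g \<xi> = 0" if "C\<^sub>0 * K < norm \<xi>" for \<xi> using supp[OF that] by (simp add: g_def)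
  have norm_eq: "AE x in lborel. norm (\<Phi> (t, x) $ i) = norm (complex_of_real (1 / p) * ift g x)"
    using rep[of t i] by eventually_elim (simp add: norm_divide g_def[abs_def] p_def norm_mult)
  show "AE x in lborel. ennreal ((norm (\<Phi> (t, x) $ i))\<^sup>2) \<le>
      ennreal (2 * unit_ball_vol 3 * C\<^sub>0 ^ 3 / (2 * pi) ^ 3 * K ^ 3) * L2_sq lborel (\<lambda>x. \<Phi> (0, x))"
    using norm_eq
  proof eventually_elim
    case (elim x)
    define v where "v = unit_ball_vol 3 * (C\<^sub>0 * K) ^ 3"
    have v: "v \<ge> 0" using C0 K by (simp add: v_def)
    have "ennreal ((norm (\<Phi> (t, x) $ i))\<^sup>2) = ennreal ((1 / p)\<^sup>2) * ennreal ((norm (ift g x))\<^sup>2)"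
      unfolding elim using p by (simp add: norm_mult norm_divide power_divide flip: ennreal_mult)
    also have "\<dots> \<le> ennreal ((1 / p)\<^sup>2) * (ennreal v * (ennreal (2 * p) * A))"
    proof (intro mult_left_mono)
      have "ennreal ((norm (ift g x))\<^sup>2) \<le> emeasure lborel (cball (0::real^3) (C\<^sub>0 * K)) * L2_sq lborel g"
        by (rule ift_sup_bound[OF gL2 g_supp])
      also have "emeasure lborel (cball (0::real^3) (C\<^sub>0 * K)) = ennreal v"
        using C0 K by (subst emeasure_cball) (auto simp: v_def)
      also have "L2_sq lborel g \<le> L2_sq lborel G" unfolding g_eq by (rule L2_sq_nth_le)
      also note GA
      finally show "ennreal ((norm (ift g x))\<^sup>2) \<le> ennreal v * (ennreal (2 * p) * A)"
        by (simp add: mult_left_mono)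
    qed simp
    also have "\<dots> = ennreal ((1 / p)\<^sup>2 * (v * (2 * p))) * A"
      using p v by (simp only: ennreal_mult_collect zero_le_power2 mult_nonneg_nonneg less_imp_le zero_le_numeral)
    also have "(1 / p)\<^sup>2 * (v * (2 * p)) = 2 * unit_ball_vol 3 * C\<^sub>0 ^ 3 / p * K ^ 3"
      using p by (simp add: v_def power2_eq_square power_mult_distrib field_simps)
    finally show ?case unfolding A_def p_def .
  qed
  show "L2_sq lborel (\<lambda>x. \<Phi> (t, x) $ i) \<le> ennreal (18 * C\<^sub>0\<^sup>2 * (K / m)\<^sup>2) * L2_sq lborel (\<lambda>x. \<Phi> (0, x))"
    if i: "i \<in> small_index s"
  proof -
    define a where "a = 3 * (C\<^sub>0 * K) / m"
    have a: "a \<ge> 0" using C0 K m by (simp add: a_def)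
    have "L2_sq lborel (\<lambda>x. \<Phi> (t, x) $ i) = L2_sq lborel (\<lambda>x. complex_of_real (1 / p) * ift g x)"
      by (rule L2_sq_cong_AE[OF norm_eq])
    also have "\<dots> = ennreal ((norm (complex_of_real (1 / p)))\<^sup>2) * L2_sq lborel (ift g)"
      by (rule L2_sq_cmult) measurable
    also have "(norm (complex_of_real (1 / p)))\<^sup>2 = (1 / p)\<^sup>2" by (simp only: norm_of_real power2_abs)
    also have "L2_sq lborel (ift g) \<le> ennreal p * L2_sq lborel g"
      using ift_L2_bound[OF ift_sup_bound(1)[OF gL2 g_supp], unfolded dim, folded p_def] by simp
    also have "L2_sq lborel g \<le> L2_sq lborel (\<lambda>\<xi>. complex_of_real a * complex_of_real (norm (G \<xi>)))"
      unfolding g_eq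
    proof (rule L2_sq_mono_AE, rule AE_I2)
      fix \<xi>
      have "norm (G \<xi> $ i) \<le> a * norm (G \<xi>)"
      proof (cases "C\<^sub>0 * K < norm \<xi>")
        case False
        have "norm (G \<xi> $ i) \<le> 3 * norm \<xi> / m * norm (G \<xi>)" by (rule small[OF i])
        also have "\<dots> \<le> a * norm (G \<xi>)"
          unfolding a_def using False m by (intro mult_right_mono divide_right_mono) auto
        finally show ?thesis .
      qed (simp add: supp)
      then show "norm (G \<xi> $ i) \<le> norm (complex_of_real a * complex_of_real (norm (G \<xi>)))"
        using a by (simp add: norm_mult)
    qed
    also have "\<dots> = ennreal (a\<^sup>2) * L2_sq lborel G"
    proof -
      have "L2_sq lborel (\<lambda>\<xi>. complex_of_real a * complex_of_real (norm (G \<xi>))) = ennreal ((norm (complex_of_real a))\<^sup>2) * L2_sq lborel (\<lambda>\<xi>. complex_of_real (norm (G \<xi>)))"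
        by (intro L2_sq_cmult) measurable
      also have "L2_sq lborel (\<lambda>\<xi>. complex_of_real (norm (G \<xi>))) = L2_sq lborel G"
        by (rule L2_sq_cong) simp
      finally show ?thesis by simp
    qed
    also note GA
    finally have "L2_sq lborel (\<lambda>x. \<Phi> (t, x) $ i) \<le> ennreal ((1 / p)\<^sup>2) * (ennreal p * (ennreal (a\<^sup>2) * (ennreal (2 * p) * A)))"
      by (simp add: mult_left_mono)
    also have "\<dots> = ennreal ((1 / p)\<^sup>2 * (p * (a\<^sup>2 * (2 * p)))) * A"
      using p by (simp only: ennreal_mult_collect zero_le_power2 mult_nonneg_nonneg less_imp_le zero_le_numeral)
    also have "(1 / p)\<^sup>2 * (p * (a\<^sup>2 * (2 * p))) = 18 * C\<^sub>0\<^sup>2 * (K / m)\<^sup>2"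
      using p m by (simp add: a_def power2_eq_square field_simps)
    finally show ?thesis unfolding A_def .
  qed
qed

section \<open>Products in space-time and the comparison of the two rates\<close>

lemma bilin_measurable:
  assumes \<Phi>: "\<Phi> \<in> borel_measurable M" and \<Psi>: "\<Psi> \<in> borel_measurable M"
  shows "(\<lambda>z. bilin Gamma5 (\<Phi> z) (\<Psi> z)) \<in> borel_measurable M"
proof -
  have [measurable]: "(\<lambda>z. \<Phi> z $ i) \<in> borel_measurable M" "(\<lambda>z. \<Psi> z $ i) \<in> borel_measurable M" for i
    using \<Phi> \<Psi> by (auto simp: borel_measurable_vec_iff)
  show ?thesis unfolding bilin_Gamma5 by measurable
qed

lemma L2_sq_slab_le:
  fixes B :: "real \<times> (real^3) \<Rightarrow> complex"
  assumes [measurable]: "B \<in> borel_measurable borel" and E: "\<And>t. L2_sq lborel (\<lambda>x. B (t, x)) \<le> E"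
    and T: "T \<ge> 0"
  shows "L2_sq (slab T) B \<le> ennreal T * E"
proof -
  have [measurable]: "B \<in> borel_measurable (lborel \<Otimes>\<^sub>M lborel)"
    using assms(1) by (simp add: lborel_prod)
  have S: "{0..T} \<times> UNIV \<in> sets (lborel :: (real \<times> (real^3)) measure)"
    by (simp add: borel_closed closed_Times)
  have "L2_sq (slab T) B = (\<integral>\<^sup>+z. ennreal ((norm (B z))\<^sup>2) * indicator ({0..T} \<times> UNIV) z \<partial>lborel)"
    unfolding L2_sq_def slab_def using S by (subst nn_integral_restrict_space) auto
  also have "\<dots> = (\<integral>\<^sup>+z. ennreal ((norm (B z))\<^sup>2) * indicator {0..T} (fst z) \<partial>(lborel \<Otimes>\<^sub>M lborel))"
    unfolding lborel_prod by (intro nn_integral_cong) (auto simp: indicator_def)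
  also have "\<dots> = (\<integral>\<^sup>+t. \<integral>\<^sup>+x. ennreal ((norm (B (t, x)))\<^sup>2) * indicator {0..T} t \<partial>lborel \<partial>lborel)"
    by (subst lborel.nn_integral_fst[symmetric]) auto
  also have "\<dots> \<le> (\<integral>\<^sup>+t. E * indicator {0..T} t \<partial>lborel)"
  proof (rule nn_integral_mono)
    fix t :: real
    have "(\<lambda>x. B (t, x)) \<in> borel_measurable borel" by measurable
    then have "(\<integral>\<^sup>+x. ennreal ((norm (B (t, x)))\<^sup>2) * indicator {0..T} t \<partial>lborel) = L2_sq lborel (\<lambda>x. B (t, x)) * indicator {0..T} t"
      unfolding L2_sq_def by (intro nn_integral_multc) simp
    also have "\<dots> \<le> E * indicator {0..T} t" by (intro mult_right_mono E) simp
    finally show "(\<integral>\<^sup>+x. ennreal ((norm (B (t, x)))\<^sup>2) * indicator {0..T} t \<partial>lborel) \<le> E * indicator {0..T} t" .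
  qed
  also have "\<dots> = ennreal T * E"
    using T by (subst nn_integral_cmult) (auto simp: mult.commute)
  finally show ?thesis .
qed

text \<open>Hoelder's inequality with exponents infinity and 2, the first factor being controlled
  almost everywhere by its squared modulus.\<close>

lemma L2_sq_product_le:
  fixes a b :: "'a \<Rightarrow> complex"
  assumes a: "AE x in M. ennreal ((norm (a x))\<^sup>2) \<le> P" and b: "L2_sq M b \<le> Q"
    and [measurable]: "b \<in> borel_measurable M"
  shows "(\<integral>\<^sup>+x. ennreal ((norm (a x) * norm (b x))\<^sup>2) \<partial>M) \<le> P * Q"
proof -
  have "(\<integral>\<^sup>+x. ennreal ((norm (a x) * norm (b x))\<^sup>2) \<partial>M) \<le> (\<integral>\<^sup>+x. P * ennreal ((norm (b x))\<^sup>2) \<partial>M)"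
  proof (rule nn_integral_mono_AE)
    show "AE x in M. ennreal ((norm (a x) * norm (b x))\<^sup>2) \<le> P * ennreal ((norm (b x))\<^sup>2)"
      using a by eventually_elim (simp add: power_mult_distrib ennreal_mult mult_right_mono)
  qed
  also have "\<dots> = P * L2_sq M b" unfolding L2_sq_def by (rule nn_integral_cmult) measurable
  also have "\<dots> \<le> P * Q" by (intro mult_left_mono b) simp
  finally show ?thesis .
qed

text \<open>After squaring and dropping the 2 the claim is T K^5 / m^2 <= K^2 m T, that is K^3 <=
  m^3.\<close>

lemma bernstein_rate_le_strichartz_rate:
  fixes K m T :: real
  assumes "0 < K" "K \<le> m" "0 < T"
  shows "T powr (1/2) * (K powr (5/2) / m) \<le> K * sqrt (2 + m * T)"
proof -
  have sq: "(T powr (1/2) * (K powr (5/2) / m))\<^sup>2 = T * K ^ 5 / m\<^sup>2"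
    using assms by (simp add: power_mult_distrib power_divide powr_half_sqrt powr_power)
  have "K ^ 3 \<le> m ^ 3" using assms by (intro power_mono) auto
  then have "K\<^sup>2 * T * K ^ 3 \<le> K\<^sup>2 * T * m ^ 3"
    using assms by (intro mult_left_mono) auto
  then have "T * K ^ 5 / m\<^sup>2 \<le> K\<^sup>2 * (m * T)"
    using assms by (simp add: divide_simps eval_nat_numeral ac_simps)
  also have "\<dots> \<le> K\<^sup>2 * (2 + m * T)" by (intro mult_left_mono) auto
  also have "\<dots> = (K * sqrt (2 + m * T))\<^sup>2"
    using assms by (simp add: power_mult_distrib)
  finally show ?thesis
    unfolding sq[symmetric] by (rule power2_le_imp_le) (use assms in simp)
qed

theorem theorem1p2:
  fixes \<rho> :: "real^3 \<Rightarrow> real" and c\<^sub>0 C\<^sub>0 :: real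
  assumes "0 < c\<^sub>0" and "c\<^sub>0 < C\<^sub>0" and "cutoff c\<^sub>0 C\<^sub>0 \<rho>"
  shows "\<exists>c>0. \<exists>C>0. \<forall>m>0. \<forall>T>0. \<forall>K\<in>range (\<lambda>j::int. (2::real) powi j). K \<le> c * m \<longrightarrow>
    (\<forall>s\<in>{1, -1::real}. \<forall>\<Phi>\<^sub>0\<in>L2_space lborel. \<forall>\<Psi>\<^sub>0\<in>L2_space lborel.
      (let \<Phi> = dirac_wave \<rho> m K s \<Phi>\<^sub>0;
           \<Psi> = dirac_wave \<rho> m K s \<Psi>\<^sub>0;
           B = (\<lambda>z. bilin Gamma5 (\<Phi> z) (\<Psi> z))
       in B \<in> L2_space (slab T) \<and>
          L2_norm (slab T) B
            \<le> C * min (K * sqrt (2 + m * T)) (T powr (1/2) * (K powr (5/2) / m))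
                * L2_norm lborel (\<lambda>x. \<Phi> (0, x)) * L2_norm lborel (\<lambda>x. \<Psi> (0, x))))"
proof -
  have C0: "C\<^sub>0 > 0" using assms by simp
  \<comment> \<open>\<open>C1\<close> is the constant of the supremum bound and \<open>C2\<close>
    that of the small components; they depend on the cutoff only through
    \<open>C\<^sub>0\<close>.\<close>
  define C1 where "C1 = 2 * unit_ball_vol 3 * C\<^sub>0 ^ 3 / (2 * pi) ^ 3"
  define C2 where "C2 = 18 * C\<^sub>0\<^sup>2"
  have C12: "C1 > 0" "C2 > 0" using C0 by (auto simp: C1_def C2_def)
  \<comment> \<open>The square of \<open>C\<close> contains 16 = 4 * 4: one 4 from squaring a sum of
    four terms, the other from adding four products with the same bound.\<close>
  define C where "C = 4 * sqrt (C1 * C2)"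
  have C: "C > 0" "C\<^sup>2 = 16 * (C1 * C2)" using C12 by (auto simp: C_def power_mult_distrib)
  have main: "B \<in> L2_space (slab T) \<and> L2_norm (slab T) B
      \<le> C * min (K * sqrt (2 + m * T)) (T powr (1/2) * (K powr (5/2) / m))
          * L2_norm lborel (\<lambda>x. \<Phi> (0, x)) * L2_norm lborel (\<lambda>x. \<Psi> (0, x))"
    if m: "m > 0" and T: "T > 0" and K: "K > 0" "K \<le> m" and s: "s \<in> {1, -1}"
      and f: "\<Phi>\<^sub>0 \<in> L2_space lborel" "\<Psi>\<^sub>0 \<in> L2_space lborel"
      and \<Phi>_def: "\<Phi> = dirac_wave \<rho> m K s \<Phi>\<^sub>0" and \<Psi>_def: "\<Psi> = dirac_wave \<rho> m K s \<Psi>\<^sub>0"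
      and B_def: "B = (\<lambda>z. bilin Gamma5 (\<Phi> z) (\<Psi> z))"
    for m T K s \<Phi>\<^sub>0 \<Psi>\<^sub>0 \<Phi> \<Psi> B
  proof -
    note bd\<Phi> = dirac_wave_bounds[OF assms(3) C0 m K(1) s f(1), folded \<Phi>_def C1_def C2_def]
    note bd\<Psi> = dirac_wave_bounds[OF assms(3) C0 m K(1) s f(2), folded \<Psi>_def C1_def C2_def]
    define a where "a = L2_norm lborel (\<lambda>x. \<Phi> (0, x))"
    define b where "b = L2_norm lborel (\<lambda>x. \<Psi> (0, x))"
    have ab: "a \<ge> 0" "b \<ge> 0" by (auto simp: a_def b_def L2_norm_def Bochner_Integration.integral_nonneg)
    have A: "L2_sq lborel (\<lambda>x. \<Phi> (0, x)) = ennreal (a\<^sup>2)" "L2_sq lborel (\<lambda>x. \<Psi> (0, x)) = ennreal (b\<^sup>2)"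
      unfolding a_def b_def using L2_norm_sq[OF bd\<Phi>(2)] L2_norm_sq[OF bd\<Psi>(2)] by auto
    \<comment> \<open>A supremum bound for one wave times an L2 bound for a small component of the
      other; the expression is symmetric in \<open>a\<close> and \<open>b\<close>, so it does not
      matter which wave has the small component.\<close>
    define D where "D = C1 * K ^ 3 * a\<^sup>2 * (C2 * (K / m)\<^sup>2 * b\<^sup>2)"
    have D: "D \<ge> 0" using C12 K by (simp add: D_def)
    have slice: "(\<lambda>x. \<Phi> (t, x) $ i) \<in> borel_measurable borel" "(\<lambda>x. \<Psi> (t, x) $ i) \<in> borel_measurable borel" for t i
    proof -
      have "(\<lambda>x. \<Phi> (t, x)) \<in> borel_measurable borel" "(\<lambda>x. \<Psi> (t, x)) \<in> borel_measurable borel"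
        by (rule measurable_compose[OF _ bd\<Phi>(1)] measurable_compose[OF _ bd\<Psi>(1)],
            intro borel_measurable_continuous_onI continuous_intros)+
      then show "(\<lambda>x. \<Phi> (t, x) $ i) \<in> borel_measurable borel" "(\<lambda>x. \<Psi> (t, x) $ i) \<in> borel_measurable borel"
        by (auto simp: borel_measurable_vec_iff)
    qed
    note slice[measurable]
    have pair: "(\<integral>\<^sup>+x. ennreal ((norm (\<Phi> (t, x) $ i) * norm (\<Psi> (t, x) $ j))\<^sup>2) \<partial>lborel) \<le> ennreal D"
      if "i \<in> small_index s \<or> j \<in> small_index s" for t i j
    proof (cases "j \<in> small_index s")
      case True
      have "(\<integral>\<^sup>+x. ennreal ((norm (\<Phi> (t, x) $ i) * norm (\<Psi> (t, x) $ j))\<^sup>2) \<partial>lborel)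
          \<le> ennreal (C1 * K ^ 3) * ennreal (a\<^sup>2) * (ennreal (C2 * (K / m)\<^sup>2) * ennreal (b\<^sup>2))"
        using bd\<Phi>(3)[of t i] bd\<Psi>(4)[OF True, of t] unfolding A by (intro L2_sq_product_le) auto
      also have "\<dots> = ennreal D"
        using C12 K by (simp add: D_def ennreal_mult[symmetric])
      finally show ?thesis .
    next
      case False
      then have i: "i \<in> small_index s" using that by blast
      have "(\<integral>\<^sup>+x. ennreal ((norm (\<Psi> (t, x) $ j) * norm (\<Phi> (t, x) $ i))\<^sup>2) \<partial>lborel)
          \<le> ennreal (C1 * K ^ 3) * ennreal (b\<^sup>2) * (ennreal (C2 * (K / m)\<^sup>2) * ennreal (a\<^sup>2))"
        using bd\<Psi>(3)[of t j] bd\<Phi>(4)[OF i, of t] unfolding A by (intro L2_sq_product_le) auto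
      also have "\<dots> = ennreal D"
        using C12 K by (simp add: D_def ennreal_mult[symmetric] ac_simps)
      finally show ?thesis by (simp add: mult.commute)
    qed
    have slice_bound: "L2_sq lborel (\<lambda>x. B (t, x)) \<le> ennreal (16 * D)" for t
    proof -
      define h where "h i j x = ennreal ((norm (\<Phi> (t, x) $ i) * norm (\<Psi> (t, x) $ j))\<^sup>2)" for i j x
      have [measurable]: "h i j \<in> borel_measurable borel" for i j unfolding h_def by measurable
      have h: "(\<integral>\<^sup>+x. h i j x \<partial>lborel) \<le> ennreal D" if "i \<in> small_index s \<or> j \<in> small_index s" for i j
        unfolding h_def by (rule pair[OF that])
      have "L2_sq lborel (\<lambda>x. B (t, x)) \<le> (\<integral>\<^sup>+x. 4 * (h 3 1 x + h 4 2 x + h 1 3 x + h 2 4 x) \<partial>lborel)"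
        unfolding L2_sq_def
      proof (rule nn_integral_mono)
        fix x
        have "ennreal ((norm (B (t, x)))\<^sup>2) \<le> ennreal (4 * ((norm (\<Phi> (t, x) $ 3) * norm (\<Psi> (t, x) $ 1))\<^sup>2 + (norm (\<Phi> (t, x) $ 4) * norm (\<Psi> (t, x) $ 2))\<^sup>2
            + (norm (\<Phi> (t, x) $ 1) * norm (\<Psi> (t, x) $ 3))\<^sup>2 + (norm (\<Phi> (t, x) $ 2) * norm (\<Psi> (t, x) $ 4))\<^sup>2))"
          unfolding B_def by (intro ennreal_leI norm_bilin_Gamma5_sq_le)
        also have "\<dots> = 4 * (h 3 1 x + h 4 2 x + h 1 3 x + h 2 4 x)"
          unfolding h_def by (subst ennreal_mult) (simp_all del: distrib_left_numeral)
        finally show "ennreal ((norm (B (t, x)))\<^sup>2) \<le> 4 * (h 3 1 x + h 4 2 x + h 1 3 x + h 2 4 x)" .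
      qed
      also have "\<dots> = 4 * ((\<integral>\<^sup>+x. h 3 1 x \<partial>lborel) + (\<integral>\<^sup>+x. h 4 2 x \<partial>lborel) + (\<integral>\<^sup>+x. h 1 3 x \<partial>lborel) + (\<integral>\<^sup>+x. h 2 4 x \<partial>lborel))"
        by (subst nn_integral_cmult) (simp_all add: nn_integral_add)
      \<comment> \<open>For either sign, each of the four index pairs meets
        \<open>small_index s\<close>, since it takes one index from each half.\<close>
      also have "\<dots> \<le> 4 * (ennreal D + ennreal D + ennreal D + ennreal D)"
        using s by (intro mult_left_mono add_mono h) (auto simp: small_index_def)
      also have "\<dots> = ennreal 4 * ennreal (D + D + D + D)"
        using D by (simp only: ennreal_plus add_nonneg_nonneg) simp
      also have "\<dots> = ennreal (16 * D)"
        using D by (subst ennreal_mult[symmetric]) auto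
      finally show ?thesis .
    qed
    have B: "B \<in> borel_measurable borel"
      unfolding B_def by (rule bilin_measurable[OF bd\<Phi>(1) bd\<Psi>(1)])
    have "L2_sq (slab T) B \<le> ennreal T * ennreal (16 * D)"
      using T by (intro L2_sq_slab_le B slice_bound) simp
    also have "\<dots> = ennreal (T * (16 * D))" using T D by (simp add: ennreal_mult)
    finally have le: "L2_sq (slab T) B \<le> ennreal (T * (16 * D))" .
    have BL2: "B \<in> L2_space (slab T)"
      unfolding L2_space_iff
    proof
      show "B \<in> borel_measurable (slab T)"
        unfolding slab_def using B by (intro measurable_restrict_space1) simp
      show "L2_sq (slab T) B < \<infinity>" using le by (rule le_less_trans) simp
    qed
    have e: "(T powr (1/2))\<^sup>2 = T" "(K powr (5/2))\<^sup>2 = K ^ 5"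
      using T K by (simp_all add: powr_half_sqrt powr_power)
    have "(L2_norm (slab T) B)\<^sup>2 \<le> T * (16 * D)"
      using le T D by (subst (asm) L2_norm_sq[OF BL2, symmetric]) simp
    also have "\<dots> = (C * (T powr (1/2) * (K powr (5/2) / m)) * a * b)\<^sup>2"
      unfolding power_mult_distrib C power_divide D_def e
      using m by (simp add: eval_nat_numeral field_simps)
    finally have "L2_norm (slab T) B \<le> C * (T powr (1/2) * (K powr (5/2) / m)) * a * b"
      by (rule power2_le_imp_le) (use ab C m in simp)
    with BL2 bernstein_rate_le_strichartz_rate[OF K T] show ?thesis
      by (simp add: a_def b_def min_absorb2)
  qed
  show ?thesis
  \<comment> \<open>The threshold c = 1 suffices, because the comparison of the two rates only uses
    K <= m.\<close>
  proof (rule exI[of _ 1], rule conjI[OF zero_less_one], rule exI[of _ C], rule conjI[OF C(1)], intro allI impI ballI)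
    fix m T K s :: real and \<Phi>\<^sub>0 \<Psi>\<^sub>0 :: "real^3 \<Rightarrow> complex^4"
    assume "0 < m" "0 < T" "K \<in> range (\<lambda>j::int. (2::real) powi j)" "K \<le> 1 * m" "s \<in> {1, -1}"
      "\<Phi>\<^sub>0 \<in> L2_space lborel" "\<Psi>\<^sub>0 \<in> L2_space lborel"
    moreover from this have "K > 0" by auto
    ultimately show "let \<Phi> = dirac_wave \<rho> m K s \<Phi>\<^sub>0; \<Psi> = dirac_wave \<rho> m K s \<Psi>\<^sub>0;
           B = (\<lambda>z. bilin Gamma5 (\<Phi> z) (\<Psi> z))
       in B \<in> L2_space (slab T) \<and>
          L2_norm (slab T) B
            \<le> C * min (K * sqrt (2 + m * T)) (T powr (1/2) * (K powr (5/2) / m))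
                * L2_norm lborel (\<lambda>x. \<Phi> (0, x)) * L2_norm lborel (\<lambda>x. \<Psi> (0, x))"
      unfolding Let_def by (intro main[OF _ _ _ _ _ _ _ refl refl refl]) auto
  qed
qed

end
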